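(* Let $(M,g)$ be an almost-Kähler surface, with almost-complex structure $J$. The decompositions $TM=\mathcal{H}\oplus\mathcal{V}$ of $TM$ into a $g$-orthogonal direct sum of two integrable complex-line subbundles $\mathcal{H}$ and $\mathcal{V}$ (the pair $(\mathcal{H},\mathcal{V})$ being ordered) stand in a one-to-one correspondence with the unit-length closed anti-self-dual $2$-forms $\zeta$ on $M$. The correspondence associates with a given decomposition $TM=\mathcal{H}\oplus\mathcal{V}$ the $2$-form $\zeta$ such that $\mathcal{H}$ and $\mathcal{V}$ are $\zeta$-orthogonal (that is, $\zeta(v,w)=0$ for all $v\in\mathcal{H}_z$, $w\in\mathcal{V}_z$, $z\in M$), while $\zeta$ restricted to each leaf of $\mathcal{H}$ equals $-1/\sqrt{2}$ times the area form of the leaf, and $\zeta$ restricted to each leaf of $\mathcal{V}$ equals $1/\sqrt{2}$ times the area form of the leaf.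
   Context: All manifolds, mappings, bundles and tensor fields are smooth, and all manifolds are connected. An almost-Kähler surface is a Riemannian manifold $(M,g)$ of real dimension four with an almost-complex structure $J$ such that $\omega=g(J\cdot,\cdot)$ is skew-symmetric and closed (i.e. a closed differential $2$-form). A complex-line subbundle of $TM$ is a $J$-invariant subbundle of real rank two. $M$ and the leaves of $\mathcal{H}$ and $\mathcal{V}$, being almost-complex manifolds, are canonically oriented: $(v,Jv)$ is positively oriented on a leaf for every nonzero $v$ tangent to it, and $(v,Jv,w,Jw)$ is positively oriented on $M$ whenever it is a basis. Area forms of leaves refer to the restriction of $g$ and this orientation. A $2$-form $\zeta$ is anti-self-dual if $*\zeta=-\zeta$, where $*$ is the Hodge star of the oriented Riemannian manifold $(M,g)$. The norm of $2$-forms is normalized by $2|\zeta|^2=\zeta^{ij}\zeta_{ij}$ (summation over all $i,j$), so that $|e^1\wedge e^2|=1$ for orthonormal $1$-forms $e^1,e^2$. *)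

theory Defs
  imports "HOL-Analysis.Analysis" "HOL-Library.Function_Algebras"
begin

(* Pointwise scalar multiplication; together with Function_Algebras it makes tangent vectors,
   which are functions of a chart, elements of a real vector space. *)

instantiation "fun" :: (type, scaleR) scaleR
begin

definition "scaleR r f = (\<lambda>x. r *\<^sub>R f x)"

instance ..

end

instance "fun" :: (type, real_vector) real_vector
  by standard (auto simp: scaleR_fun_def fun_eq_iff scaleR_add_right scaleR_add_left)

fun Ck_on :: "nat \<Rightarrow> 'b::euclidean_space set \<Rightarrow> ('b \<Rightarrow> 'c::real_normed_vector) \<Rightarrow> bool"
  where
    "Ck_on 0 S f \<longleftrightarrow> continuous_on S f"
  | "Ck_on (Suc k) S f \<longleftrightarrow> (\<forall>x\<in>S. f differentiable (at x)) \<and>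
       (\<forall>i\<in>Basis. Ck_on k S (\<lambda>x. frechet_derivative f (at x) i))"

(* Meant for open S only. *)
definition smooth_on :: "'b::euclidean_space set \<Rightarrow> ('b \<Rightarrow> 'c::real_normed_vector) \<Rightarrow> bool"
  where "smooth_on S f \<longleftrightarrow> (\<forall>k. Ck_on k S f)"


text \<open>The manifold is a whole type. A chart is a pair of an open domain and a coordinate map,
  whose values off the domain are irrelevant.\<close>

type_synonym ('a, 'e) chart = "'a set \<times> ('a \<Rightarrow> 'e)"

abbreviation cdom :: "('a, 'e) chart \<Rightarrow> 'a set" where "cdom \<equiv> fst"
abbreviation cmap :: "('a, 'e) chart \<Rightarrow> 'a \<Rightarrow> 'e" where "cmap \<equiv> snd"

definition cinv :: "('a, 'e) chart \<Rightarrow> 'e \<Rightarrow> 'a"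
  where "cinv c = inv_into (cdom c) (cmap c)"

definition is_chart :: "('a::topological_space, 'e::euclidean_space) chart \<Rightarrow> bool"
  where "is_chart c \<longleftrightarrow> open (cdom c) \<and> open (cmap c ` cdom c) \<and>
    homeomorphism (cdom c) (cmap c ` cdom c) (cmap c) (cinv c)"

(* Hausdorffness and second countability are carried by the sort. *)
definition smooth_atlas ::
  "('a::{t2_space, second_countable_topology}, 'e::euclidean_space) chart set \<Rightarrow> bool"
  where "smooth_atlas A \<longleftrightarrow> (\<forall>c\<in>A. is_chart c) \<and> (\<Union>c\<in>A. cdom c) = UNIV \<and>
    (\<forall>c\<in>A. \<forall>d\<in>A. smooth_on (cmap c ` (cdom c \<inter> cdom d)) (cmap d \<circ> cinv c))"

text \<open>A tangent vector at \<open>z\<close> assigns to every chart of the atlas around \<open>z\<close> its vector of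
  components, subject to the transformation law; it is 0 on all other arguments.\<close>

type_synonym ('a, 'e) tvec = "('a, 'e) chart \<Rightarrow> 'e"

definition tangent_space ::
  "('a, 'e::euclidean_space) chart set \<Rightarrow> 'a \<Rightarrow> ('a, 'e) tvec set"
  where "tangent_space A z = {v.
    (\<forall>c. \<not> (c \<in> A \<and> z \<in> cdom c) \<longrightarrow> v c = 0) \<and>
    (\<forall>c\<in>A. \<forall>d\<in>A. z \<in> cdom c \<inter> cdom d \<longrightarrow>
      v d = frechet_derivative (cmap d \<circ> cinv c) (at (cmap c z)) (v c))}"

definition differential ::
  "('a, 'e::euclidean_space) chart set \<Rightarrow> ('b::euclidean_space \<Rightarrow> 'a) \<Rightarrow> 'b \<Rightarrow> 'b \<Rightarrow> ('a, 'e) tvec"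
  where "differential A f x a = (\<lambda>c. if c \<in> A \<and> f x \<in> cdom c
    then frechet_derivative (cmap c \<circ> f) (at x) a else 0)"

definition coord_field ::
  "('a, 'e::euclidean_space) chart set \<Rightarrow> ('a, 'e) chart \<Rightarrow> 'e \<Rightarrow> 'e \<Rightarrow> ('a, 'e) tvec"
  where "coord_field A c i x = differential A (cinv c) x i"

definition smooth_map_into ::
  "('a::topological_space, 'e::euclidean_space) chart set \<Rightarrow> 'b::euclidean_space set
    \<Rightarrow> ('b \<Rightarrow> 'a) \<Rightarrow> bool"
  where "smooth_map_into A U f \<longleftrightarrow> continuous_on U f \<and>
    (\<forall>c\<in>A. smooth_on (U \<inter> f -` cdom c) (cmap c \<circ> f))"

definition smooth_vector_field_on ::
  "('a, 'e::euclidean_space) chart set \<Rightarrow> 'a set \<Rightarrow> ('a \<Rightarrow> ('a, 'e) tvec) \<Rightarrow> bool"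
  where "smooth_vector_field_on A W X \<longleftrightarrow> (\<forall>z\<in>W. X z \<in> tangent_space A z) \<and>
    (\<forall>c\<in>A. smooth_on (cmap c ` (cdom c \<inter> W)) (\<lambda>x. X (cinv c x) c))"


type_synonym ('a, 'e) bilin = "('a, 'e) tvec \<Rightarrow> ('a, 'e) tvec \<Rightarrow> real"

definition component ::
  "('a, 'e::euclidean_space) chart set \<Rightarrow> ('a \<Rightarrow> ('a, 'e) bilin) \<Rightarrow> ('a, 'e) chart
    \<Rightarrow> 'e \<Rightarrow> 'e \<Rightarrow> 'e \<Rightarrow> real"
  where "component A B c i j x = B (cinv c x) (coord_field A c i x) (coord_field A c j x)"

definition smooth_bilinear_field ::
  "('a, 'e::euclidean_space) chart set \<Rightarrow> ('a \<Rightarrow> ('a, 'e) bilin) \<Rightarrow> bool"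
  where "smooth_bilinear_field A B \<longleftrightarrow>
    (\<forall>z. \<forall>u\<in>tangent_space A z. \<forall>v\<in>tangent_space A z. \<forall>w\<in>tangent_space A z. \<forall>r s.
      B z (r *\<^sub>R u + s *\<^sub>R v) w = r * B z u w + s * B z v w \<and>
      B z w (r *\<^sub>R u + s *\<^sub>R v) = r * B z w u + s * B z w v) \<and>
    (\<forall>c\<in>A. \<forall>i\<in>Basis. \<forall>j\<in>Basis. smooth_on (cmap c ` cdom c) (component A B c i j))"

definition riemannian_metric ::
  "('a, 'e::euclidean_space) chart set \<Rightarrow> ('a \<Rightarrow> ('a, 'e) bilin) \<Rightarrow> bool"
  where "riemannian_metric A g \<longleftrightarrow> smooth_bilinear_field A g \<and>
    (\<forall>z. \<forall>v\<in>tangent_space A z. \<forall>w\<in>tangent_space A z. g z v w = g z w v) \<and>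
    (\<forall>z. \<forall>v\<in>tangent_space A z. v \<noteq> 0 \<longrightarrow> g z v v > 0)"

definition skew_symmetric ::
  "('a, 'e::euclidean_space) chart set \<Rightarrow> ('a \<Rightarrow> ('a, 'e) bilin) \<Rightarrow> bool"
  where "skew_symmetric A B \<longleftrightarrow>
    (\<forall>z. \<forall>v\<in>tangent_space A z. \<forall>w\<in>tangent_space A z. B z v w = - B z w v)"

(* The last clause makes a 2-form determined, as a HOL function, by its values on the
   tangent spaces. *)
definition two_form ::
  "('a, 'e::euclidean_space) chart set \<Rightarrow> ('a \<Rightarrow> ('a, 'e) bilin) \<Rightarrow> bool"
  where "two_form A \<zeta> \<longleftrightarrow> smooth_bilinear_field A \<zeta> \<and> skew_symmetric A \<zeta> \<and>
    (\<forall>z v w. \<not> (v \<in> tangent_space A z \<and> w \<in> tangent_space A z) \<longrightarrow> \<zeta> z v w = 0)"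

(* The ijk component of the exterior derivative in the chart c, at the point with
   coordinates x. *)
definition ext_deriv ::
  "('a, 'e::euclidean_space) chart set \<Rightarrow> ('a \<Rightarrow> ('a, 'e) bilin) \<Rightarrow> ('a, 'e) chart
    \<Rightarrow> 'e \<Rightarrow> 'e \<Rightarrow> 'e \<Rightarrow> 'e \<Rightarrow> real"
  where "ext_deriv A \<zeta> c i j k x =
    frechet_derivative (component A \<zeta> c j k) (at x) i +
    frechet_derivative (component A \<zeta> c k i) (at x) j +
    frechet_derivative (component A \<zeta> c i j) (at x) k"

definition closed_form ::
  "('a, 'e::euclidean_space) chart set \<Rightarrow> ('a \<Rightarrow> ('a, 'e) bilin) \<Rightarrow> bool"
  where "closed_form A \<zeta> \<longleftrightarrow> (\<forall>c\<in>A. \<forall>x\<in>cmap c ` cdom c.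
    \<forall>i\<in>Basis. \<forall>j\<in>Basis. \<forall>k\<in>Basis. ext_deriv A \<zeta> c i j k x = 0)"

definition almost_complex ::
  "('a, 'e::euclidean_space) chart set \<Rightarrow> ('a \<Rightarrow> ('a, 'e) tvec \<Rightarrow> ('a, 'e) tvec) \<Rightarrow> bool"
  where "almost_complex A J \<longleftrightarrow>
    (\<forall>z. \<forall>v\<in>tangent_space A z. J z v \<in> tangent_space A z \<and> J z (J z v) = - v) \<and>
    (\<forall>z. \<forall>v\<in>tangent_space A z. \<forall>w\<in>tangent_space A z. \<forall>r s.
      J z (r *\<^sub>R v + s *\<^sub>R w) = r *\<^sub>R J z v + s *\<^sub>R J z w) \<and>
    (\<forall>c\<in>A. \<forall>i\<in>Basis. smooth_on (cmap c ` cdom c) (\<lambda>x. J (cinv c x) (coord_field A c i x) c))"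

definition kahler_form ::
  "('a, 'e::euclidean_space) chart set \<Rightarrow> ('a \<Rightarrow> ('a, 'e) bilin)
    \<Rightarrow> ('a \<Rightarrow> ('a, 'e) tvec \<Rightarrow> ('a, 'e) tvec) \<Rightarrow> 'a \<Rightarrow> ('a, 'e) bilin"
  where "kahler_form A g J z v w =
    (if v \<in> tangent_space A z \<and> w \<in> tangent_space A z then g z (J z v) w else 0)"

definition almost_kahler_surface ::
  "('a::{t2_space, second_countable_topology}, real^4) chart set \<Rightarrow> ('a \<Rightarrow> ('a, real^4) bilin)
    \<Rightarrow> ('a \<Rightarrow> ('a, real^4) tvec \<Rightarrow> ('a, real^4) tvec) \<Rightarrow> bool"
  where "almost_kahler_surface A g J \<longleftrightarrow>
    smooth_atlas A \<and> connected (UNIV :: 'a set) \<and>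
    riemannian_metric A g \<and> almost_complex A J \<and>
    skew_symmetric A (kahler_form A g J) \<and> closed_form A (kahler_form A g J)"


(* In a g-orthonormal frame e, the matrix (g v_i e_j) is the one expressing v in terms of e. *)
definition frame_det ::
  "('a, 'e) bilin \<Rightarrow> ('a, 'e::euclidean_space) tvec ^'n \<Rightarrow> ('a, 'e) tvec ^'n \<Rightarrow> real"
  where "frame_det gz v e = det (\<chi> i j. gz (v $ i) (e $ j))"

definition oriented_frame ::
  "('a, real^4) chart set \<Rightarrow> ('a \<Rightarrow> ('a, real^4) bilin)
    \<Rightarrow> ('a \<Rightarrow> ('a, real^4) tvec \<Rightarrow> ('a, real^4) tvec) \<Rightarrow> 'a \<Rightarrow> ('a, real^4) tvec ^4 \<Rightarrow> bool"
  where "oriented_frame A g J z e \<longleftrightarrow>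
    (\<forall>i. e $ i \<in> tangent_space A z) \<and>
    (\<forall>i j. g z (e $ i) (e $ j) = (if i = j then 1 else 0)) \<and>
    (\<forall>v\<in>tangent_space A z. \<forall>w\<in>tangent_space A z.
      span {v, J z v, w, J z w} = tangent_space A z \<longrightarrow>
      frame_det (g z) (vector [v, J z v, w, J z w]) e > 0)"

(* The choice of frame is immaterial for volume_form, hodge_star and form_norm. *)
definition some_frame ::
  "('a, real^4) chart set \<Rightarrow> ('a \<Rightarrow> ('a, real^4) bilin)
    \<Rightarrow> ('a \<Rightarrow> ('a, real^4) tvec \<Rightarrow> ('a, real^4) tvec) \<Rightarrow> 'a \<Rightarrow> ('a, real^4) tvec ^4"
  where "some_frame A g J z = (SOME e. oriented_frame A g J z e)"

definition volume_form ::
  "('a, real^4) chart set \<Rightarrow> ('a \<Rightarrow> ('a, real^4) bilin)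
    \<Rightarrow> ('a \<Rightarrow> ('a, real^4) tvec \<Rightarrow> ('a, real^4) tvec) \<Rightarrow> 'a \<Rightarrow> ('a, real^4) tvec ^4 \<Rightarrow> real"
  where "volume_form A g J z v = frame_det (g z) v (some_frame A g J z)"

(* The formula star(\<zeta>)_kl = 1/2 \<zeta>^ij vol_ijkl, in an orthonormal frame. *)
definition hodge_star ::
  "('a, real^4) chart set \<Rightarrow> ('a \<Rightarrow> ('a, real^4) bilin)
    \<Rightarrow> ('a \<Rightarrow> ('a, real^4) tvec \<Rightarrow> ('a, real^4) tvec)
    \<Rightarrow> ('a \<Rightarrow> ('a, real^4) bilin) \<Rightarrow> 'a \<Rightarrow> ('a, real^4) bilin"
  where "hodge_star A g J \<zeta> z v w = (let e = some_frame A g J z in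
    1/2 * (\<Sum>i\<in>UNIV. \<Sum>j\<in>UNIV.
      \<zeta> z (e $ i) (e $ j) * volume_form A g J z (vector [e $ i, e $ j, v, w])))"

definition anti_self_dual ::
  "('a, real^4) chart set \<Rightarrow> ('a \<Rightarrow> ('a, real^4) bilin)
    \<Rightarrow> ('a \<Rightarrow> ('a, real^4) tvec \<Rightarrow> ('a, real^4) tvec) \<Rightarrow> ('a \<Rightarrow> ('a, real^4) bilin) \<Rightarrow> bool"
  where "anti_self_dual A g J \<zeta> \<longleftrightarrow>
    (\<forall>z. \<forall>v\<in>tangent_space A z. \<forall>w\<in>tangent_space A z. hodge_star A g J \<zeta> z v w = - \<zeta> z v w)"

(* Normalized by 2|\<zeta>|^2 = \<zeta>^ij \<zeta>_ij, summed over all i and j. *)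
definition form_norm ::
  "('a, real^4) chart set \<Rightarrow> ('a \<Rightarrow> ('a, real^4) bilin)
    \<Rightarrow> ('a \<Rightarrow> ('a, real^4) tvec \<Rightarrow> ('a, real^4) tvec) \<Rightarrow> ('a \<Rightarrow> ('a, real^4) bilin) \<Rightarrow> 'a \<Rightarrow> real"
  where "form_norm A g J \<zeta> z = (let e = some_frame A g J z in
    sqrt (1/2 * (\<Sum>i\<in>UNIV. \<Sum>j\<in>UNIV. (\<zeta> z (e $ i) (e $ j))\<^sup>2)))"


definition subbundle ::
  "('a::topological_space, 'e::euclidean_space) chart set \<Rightarrow> nat \<Rightarrow> ('a \<Rightarrow> ('a, 'e) tvec set) \<Rightarrow> bool"
  where "subbundle A k D \<longleftrightarrow>
    (\<forall>z. subspace (D z) \<and> D z \<subseteq> tangent_space A z \<and> dim (D z) = k) \<and>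
    (\<forall>z. \<exists>W X. open W \<and> z \<in> W \<and> (\<forall>m<k. smooth_vector_field_on A W (X m)) \<and>
      (\<forall>y\<in>W. D y = span ((\<lambda>m. X m y) ` {..<k})))"

definition complex_line_subbundle ::
  "('a::topological_space, 'e::euclidean_space) chart set
    \<Rightarrow> ('a \<Rightarrow> ('a, 'e) tvec \<Rightarrow> ('a, 'e) tvec) \<Rightarrow> ('a \<Rightarrow> ('a, 'e) tvec set) \<Rightarrow> bool"
  where "complex_line_subbundle A J D \<longleftrightarrow> subbundle A 2 D \<and> (\<forall>z. J z ` D z \<subseteq> D z)"

(* A parametrized connected integral surface of D. When D has rank 2 it is an injective
   immersion, as its differentials map the plane onto the planes of D. *)
definition integral_patch ::
  "('a::topological_space, 'e::euclidean_space) chart set \<Rightarrow> ('a \<Rightarrow> ('a, 'e) tvec set)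
    \<Rightarrow> (real^2) set \<Rightarrow> (real^2 \<Rightarrow> 'a) \<Rightarrow> bool"
  where "integral_patch A D U \<phi> \<longleftrightarrow> open U \<and> connected U \<and>
    smooth_map_into A U \<phi> \<and> inj_on \<phi> U \<and> (\<forall>u\<in>U. range (differential A \<phi> u) = D (\<phi> u))"

definition integrable_distribution ::
  "('a::topological_space, 'e::euclidean_space) chart set \<Rightarrow> ('a \<Rightarrow> ('a, 'e) tvec set) \<Rightarrow> bool"
  where "integrable_distribution A D \<longleftrightarrow> (\<forall>z. \<exists>U \<phi>. integral_patch A D U \<phi> \<and> z \<in> \<phi> ` U)"

(* Leaves are the maximal connected integral manifolds: two points are in the same leaf iff
   a finite chain of overlapping integral patches joins them. The patches contained in a leaf
   are the local parametrizations of its (immersed) manifold structure. *)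
definition leaves ::
  "('a::topological_space, 'e::euclidean_space) chart set \<Rightarrow> ('a \<Rightarrow> ('a, 'e) tvec set) \<Rightarrow> 'a set set"
  where "leaves A D = range (\<lambda>z.
    {y. (\<lambda>p q. \<exists>U \<phi>. integral_patch A D U \<phi> \<and> p \<in> \<phi> ` U \<and> q \<in> \<phi> ` U)\<^sup>*\<^sup>* z y})"

definition oriented_plane_frame ::
  "('a, 'e::euclidean_space) bilin \<Rightarrow> (('a, 'e) tvec \<Rightarrow> ('a, 'e) tvec) \<Rightarrow> ('a, 'e) tvec set
    \<Rightarrow> ('a, 'e) tvec ^2 \<Rightarrow> bool"
  where "oriented_plane_frame gz Jz P e \<longleftrightarrow>
    (\<forall>i. e $ i \<in> P) \<and> (\<forall>i j. gz (e $ i) (e $ j) = (if i = j then 1 else 0)) \<and>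
    (\<forall>v\<in>P. v \<noteq> 0 \<longrightarrow> frame_det gz (vector [v, Jz v]) e > 0)"

(* For J-invariant P; the choice of frame is immaterial. *)
definition area_form ::
  "('a, 'e::euclidean_space) bilin \<Rightarrow> (('a, 'e) tvec \<Rightarrow> ('a, 'e) tvec) \<Rightarrow> ('a, 'e) tvec set
    \<Rightarrow> ('a, 'e) bilin"
  where "area_form gz Jz P v w = frame_det gz (vector [v, w]) (SOME e. oriented_plane_frame gz Jz P e)"

(* The area form of L at x is that of the plane D x, the tangent plane of L. *)
definition restricts_to_area_multiple ::
  "('a::topological_space, 'e::euclidean_space) chart set \<Rightarrow> ('a \<Rightarrow> ('a, 'e) bilin)
    \<Rightarrow> ('a \<Rightarrow> ('a, 'e) tvec \<Rightarrow> ('a, 'e) tvec) \<Rightarrow> ('a \<Rightarrow> ('a, 'e) tvec set) \<Rightarrow> 'a set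
    \<Rightarrow> ('a \<Rightarrow> ('a, 'e) bilin) \<Rightarrow> real \<Rightarrow> bool"
  where "restricts_to_area_multiple A g J D L \<zeta> r \<longleftrightarrow>
    (\<forall>U \<phi>. integral_patch A D U \<phi> \<and> \<phi> ` U \<subseteq> L \<longrightarrow>
      (\<forall>u\<in>U. \<forall>a b. let x = \<phi> u; d = differential A \<phi> u in
        \<zeta> x (d a) (d b) = r * area_form (g x) (J x) (range d) (d a) (d b)))"


definition orthogonal_decompositions ::
  "('a::topological_space, real^4) chart set \<Rightarrow> ('a \<Rightarrow> ('a, real^4) bilin)
    \<Rightarrow> ('a \<Rightarrow> ('a, real^4) tvec \<Rightarrow> ('a, real^4) tvec)
    \<Rightarrow> (('a \<Rightarrow> ('a, real^4) tvec set) \<times> ('a \<Rightarrow> ('a, real^4) tvec set)) set"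
  where "orthogonal_decompositions A g J = {(H, V).
    complex_line_subbundle A J H \<and> integrable_distribution A H \<and>
    complex_line_subbundle A J V \<and> integrable_distribution A V \<and>
    (\<forall>z. {v + w | v w. v \<in> H z \<and> w \<in> V z} = tangent_space A z \<and> H z \<inter> V z = {0}) \<and>
    (\<forall>z. \<forall>v\<in>H z. \<forall>w\<in>V z. g z v w = 0)}"

definition unit_closed_asd_forms ::
  "('a, real^4) chart set \<Rightarrow> ('a \<Rightarrow> ('a, real^4) bilin)
    \<Rightarrow> ('a \<Rightarrow> ('a, real^4) tvec \<Rightarrow> ('a, real^4) tvec) \<Rightarrow> ('a \<Rightarrow> ('a, real^4) bilin) set"
  where "unit_closed_asd_forms A g J = {\<zeta>. two_form A \<zeta> \<and> closed_form A \<zeta> \<and>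
    anti_self_dual A g J \<zeta> \<and> (\<forall>z. form_norm A g J \<zeta> z = 1)}"

definition corresponding_form ::
  "('a::topological_space, real^4) chart set \<Rightarrow> ('a \<Rightarrow> ('a, real^4) bilin)
    \<Rightarrow> ('a \<Rightarrow> ('a, real^4) tvec \<Rightarrow> ('a, real^4) tvec)
    \<Rightarrow> ('a \<Rightarrow> ('a, real^4) tvec set) \<Rightarrow> ('a \<Rightarrow> ('a, real^4) tvec set)
    \<Rightarrow> ('a \<Rightarrow> ('a, real^4) bilin) \<Rightarrow> bool"
  where "corresponding_form A g J H V \<zeta> \<longleftrightarrow> two_form A \<zeta> \<and>
    (\<forall>z. \<forall>v\<in>H z. \<forall>w\<in>V z. \<zeta> z v w = 0) \<and>
    (\<forall>L\<in>leaves A H. restricts_to_area_multiple A g J H L \<zeta> (- 1 / sqrt 2)) \<and>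
    (\<forall>L\<in>leaves A V. restricts_to_area_multiple A g J V L \<zeta> (1 / sqrt 2))"

end

theory Submission
  imports Defs
begin

text \<open>At each point, a unit anti-self-dual form is \<open>\<zeta> = (- f1 \<and> f2 + f3 \<and> f4) / \<surd>2\<close> in the dual
  \<open>(f1, f2, f3, f4)\<close> of a suitable orthonormal frame \<open>(p, J p, q, J q)\<close>, while the Kaehler form is
  \<open>\<omega> = f1 \<and> f2 + f3 \<and> f4\<close>. So \<open>\<H>\<close> and \<open>\<V>\<close> are recovered as the kernels of the decomposable forms
  \<open>\<omega> + \<surd>2 \<zeta>\<close> and \<open>\<omega> - \<surd>2 \<zeta>\<close>, and what remains is that \<open>\<zeta>\<close> is closed if and only if both kernels are
  integrable. A closed decomposable form has an involutive kernel, which by the Frobenius theorem is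
  integrable. Conversely, integrability of the kernel of a form \<open>\<beta>\<close> makes \<open>d \<beta>\<close> vanish as soon as two
  of its arguments lie in that kernel; since \<open>d \<omega> = 0\<close>, so does \<open>d \<zeta>\<close>.\<close>

section \<open>Smooth maps between open sets of Euclidean spaces\<close>

text \<open>The obstacle in the Frobenius theorem is smooth dependence of solutions on parameters.
  It is met by a choice of fields and of a parametrization. In a chart the kernel is complemented,
  near a given point, by a fixed plane of constant vectors, and constant fields projected onto the
  kernel along that plane commute. Commuting fields are integrated along rays from the origin of the
  parameter plane, by one fixed point for all rays at once; a single estimate gives the derivative
  of the resulting map in all directions, and the differential equation then gives higher
  smoothness. For the converse no brackets of fields are formed: mixed second derivatives of a
  parametrized integral surface cancel instead. Leaves enter only through their tangent planes,
  because the area form of a complex line is the restriction of \<omega>. What is shown for \<H>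
  applies to \<V> with - \<zeta> in place of \<zeta>. Linear algebra is relative to subspaces, since
  a tangent space is a set inside one space of functions on charts.\<close>

abbreviation fderiv :: "('b::real_normed_vector \<Rightarrow> 'c::real_normed_vector) \<Rightarrow> 'b \<Rightarrow> 'b \<Rightarrow> 'c"
  where "fderiv f x \<equiv> frechet_derivative f (at x)"

lemma Ck_on_SucD:
  assumes "Ck_on (Suc k) S f"
  shows "x \<in> S \<Longrightarrow> (f has_derivative fderiv f x) (at x)"
    and "i \<in> Basis \<Longrightarrow> Ck_on k S (\<lambda>x. fderiv f x i)"
  using assms by (auto simp: frechet_derivative_works[symmetric])

lemma Ck_on_cong:
  assumes "open S" "\<And>x. x \<in> S \<Longrightarrow> f x = g x" "Ck_on k S f"
  shows "Ck_on k S g"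
  using assms
proof (induction k arbitrary: f g)
  case 0
  then show ?case by (simp cong: continuous_on_cong_simp)
next
  case (Suc k)
  have eq: "fderiv f x = fderiv g x" if "x \<in> S" for x
    using Suc.prems that by (intro frechet_derivative_transform_within_open[of f x S g]) auto
  have "g differentiable (at x)" if x: "x \<in> S" for x
  proof -
    obtain D where "(f has_derivative D) (at x)"
      using Ck_on_SucD(1)[OF Suc.prems(3) x] by blast
    then have "(g has_derivative D) (at x)"
      using Suc.prems(1,2) x by (intro has_derivative_transform_within_open[of f D x UNIV S g]) auto
    then show ?thesis by (auto simp: differentiable_def)
  qed
  moreover have "Ck_on k S (\<lambda>x. fderiv g x i)" if "i \<in> Basis" for i
    by (rule Suc.IH[of "\<lambda>x. fderiv f x i"]) (use Suc.prems that eq in auto)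
  ultimately show ?case by simp
qed

lemma Ck_on_subset: "Ck_on k S f \<Longrightarrow> T \<subseteq> S \<Longrightarrow> Ck_on k T f"
  by (induction k arbitrary: f) (auto intro: continuous_on_subset)

lemma Ck_on_local:
  assumes "\<And>x. x \<in> S \<Longrightarrow> \<exists>T. open T \<and> x \<in> T \<and> Ck_on k T f"
  shows "Ck_on k S f"
  using assms
proof (induction k arbitrary: f)
  case 0
  have "isCont f x" if "x \<in> S" for x
    using 0[OF that] by (auto simp: continuous_on_eq_continuous_at)
  then show ?case by (simp add: continuous_at_imp_continuous_on)
next
  case (Suc k)
  have "\<exists>T. open T \<and> x \<in> T \<and> Ck_on k T (\<lambda>x. fderiv f x i)"
    if "x \<in> S" "i \<in> Basis" for x i
    using Suc.prems[OF that(1)] Ck_on_SucD(2) that(2) by blast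
  moreover have "f differentiable (at x)" if "x \<in> S" for x
    using Suc.prems[OF that] by auto
  ultimately show ?case using Suc.IH by simp
qed

lemma Ck_on_Suc_imp: "Ck_on (Suc k) S f \<Longrightarrow> Ck_on k S f"
proof (induction k arbitrary: f)
  case 0
  then show ?case
    by (simp add: continuous_at_imp_continuous_on differentiable_imp_continuous_within)
next
  case (Suc k)
  have "Ck_on k S (\<lambda>x. fderiv f x i)" if "i \<in> Basis" for i
    by (rule Suc.IH) (use Suc.prems that in simp)
  then show ?case using Suc.prems by simp
qed

text \<open>An explicit derivative in place of \<open>fderiv\<close>: in the closure properties
  below the formula for \<open>f'\<close> is again built from maps to which the induction hypothesis
  applies.\<close>

lemma Ck_on_SucI:
  assumes "open S" and f': "\<And>x. x \<in> S \<Longrightarrow> (f has_derivative f' x) (at x)"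
    and "\<And>i. i \<in> Basis \<Longrightarrow> Ck_on k S (\<lambda>x. f' x i)"
  shows "Ck_on (Suc k) S f"
proof -
  have "fderiv f x = f' x" if "x \<in> S" for x
    using frechet_derivative_at[OF f'[OF that]] by simp
  then have "Ck_on k S (\<lambda>x. fderiv f x i)" if "i \<in> Basis" for i
    using Ck_on_cong[OF assms(1) _ assms(3)[OF that]] by simp
  then show ?thesis using f' by (auto simp: differentiable_def)
qed

lemma Ck_on_const: "Ck_on k S (\<lambda>x. c)"
  by (induction k arbitrary: c) simp_all

lemma Ck_on_add:
  assumes "open S" "Ck_on k S f" "Ck_on k S g"
  shows "Ck_on k S (\<lambda>x. f x + g x)"
  using assms(2,3)
proof (induction k arbitrary: f g)
  case 0
  then show ?case by (simp add: continuous_on_add)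
next
  case (Suc k)
  have "Ck_on k S (\<lambda>x. fderiv f x i + fderiv g x i)"
    if "i \<in> Basis" for i
    by (intro Suc.IH Ck_on_SucD(2)[OF Suc.prems(1)] Ck_on_SucD(2)[OF Suc.prems(2)] that)
  moreover have "((\<lambda>x. f x + g x) has_derivative
      (\<lambda>i. fderiv f x i + fderiv g x i)) (at x)" if "x \<in> S" for x
    by (rule has_derivative_add[OF Ck_on_SucD(1)[OF Suc.prems(1) that] Ck_on_SucD(1)[OF Suc.prems(2) that]])
  ultimately show ?case
    by (intro Ck_on_SucI[OF assms(1)])
qed

lemma Ck_on_sum:
  assumes "open S" "\<And>i. i \<in> I \<Longrightarrow> Ck_on k S (f i)"
  shows "Ck_on k S (\<lambda>x. \<Sum>i\<in>I. f i x)"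
  using assms(2)
proof (induction I rule: infinite_finite_induct)
  case (insert i I)
  have "Ck_on k S (\<lambda>x. f i x + (\<Sum>i\<in>I. f i x))"
    by (rule Ck_on_add[OF assms(1)]) (use insert in auto)
  then show ?case using insert by simp
qed (simp_all add: Ck_on_const)

lemma Ck_on_bilinear:
  assumes "open S" "bounded_bilinear p" "Ck_on k S f" "Ck_on k S g"
  shows "Ck_on k S (\<lambda>x. p (f x) (g x))"
  using assms(3,4)
proof (induction k arbitrary: f g)
  case 0
  then show ?case by (simp add: bounded_bilinear.continuous_on[OF assms(2)])
next
  case (Suc k)
  have "Ck_on k S (\<lambda>x. p (f x) (fderiv g x i) + p (fderiv f x i) (g x))"
    if "i \<in> Basis" for i
    by (intro Ck_on_add assms(1) Suc.IH Ck_on_SucD(2)[OF Suc.prems(1)] Ck_on_SucD(2)[OF Suc.prems(2)]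
        Ck_on_Suc_imp[OF Suc.prems(1)] Ck_on_Suc_imp[OF Suc.prems(2)] that)
  moreover have "((\<lambda>x. p (f x) (g x)) has_derivative (\<lambda>i. p (f x) (fderiv g x i) +
      p (fderiv f x i) (g x))) (at x)" if "x \<in> S" for x
    by (rule bounded_bilinear.FDERIV[OF assms(2)
          Ck_on_SucD(1)[OF Suc.prems(1) that] Ck_on_SucD(1)[OF Suc.prems(2) that]])
  ultimately show ?case
    by (intro Ck_on_SucI[OF assms(1)])
qed

text \<open>The derivative of 1/f is a product of \<open>fderiv f\<close> with two factors 1/f, so
  the induction on the order of differentiability feeds on itself with f fixed.\<close>

lemma Ck_on_inverse:
  fixes f :: "'b::euclidean_space \<Rightarrow> real"
  assumes "open S" "Ck_on k S f" "\<And>x. x \<in> S \<Longrightarrow> f x \<noteq> 0"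
  shows "Ck_on k S (\<lambda>x. inverse (f x))"
  using assms(2)
proof (induction k)
  case 0
  then show ?case using assms(3) by (simp add: continuous_on_inverse)
next
  case (Suc k)
  note inv = Suc.IH[OF Ck_on_Suc_imp[OF Suc.prems]]
  have "Ck_on k S (\<lambda>x. (- 1) * (inverse (f x) * fderiv f x i * inverse (f x)))"
    if "i \<in> Basis" for i
    by (intro Ck_on_bilinear[OF assms(1) bounded_bilinear_mult] Ck_on_const inv
        Ck_on_SucD(2)[OF Suc.prems] that)
  moreover have "((\<lambda>x. inverse (f x)) has_derivative
     (\<lambda>i. (- 1) * (inverse (f x) * fderiv f x i * inverse (f x)))) (at x)" if "x \<in> S" for x
    using Deriv.has_derivative_inverse[OF assms(3)[OF that] Ck_on_SucD(1)[OF Suc.prems that]] by simp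
  ultimately show ?case
    by (intro Ck_on_SucI[OF assms(1)])
qed

lemma has_derivative_basis_sum:
  fixes f' :: "'b::euclidean_space \<Rightarrow> 'c::real_normed_vector"
  assumes "(f has_derivative f') F"
  shows "f' v = (\<Sum>i\<in>Basis. (v \<bullet> i) *\<^sub>R f' i)"
proof -
  have "linear f'" using assms has_derivative_linear by blast
  then show ?thesis
    by (metis (no_types, lifting) euclidean_representation linear_scale linear_sum sum.cong)
qed

text \<open>\<open>Ck_on\<close> speaks of partial derivatives in fixed directions, whereas the
  chain rule has \<open>fderiv f (h x)\<close> in the moving direction \<open>fderiv h x i\<close>.
  Expanding that direction in the basis separates the two factors; f varies in the induction, h does
  not.\<close>

lemma Ck_on_compose:
  fixes f :: "'b::euclidean_space \<Rightarrow> 'c::real_normed_vector" and h :: "'a::euclidean_space \<Rightarrow> 'b"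
  assumes "open S" "open T" "h ` S \<subseteq> T" "Ck_on k T f" "Ck_on k S h"
  shows "Ck_on k S (\<lambda>x. f (h x))"
  using assms(4,5)
proof (induction k arbitrary: f)
  case 0
  then show ?case using continuous_on_compose2[of T f S h] assms(3) by simp
next
  case (Suc k)
  have "Ck_on k S (\<lambda>x. \<Sum>b\<in>Basis. (fderiv h x i \<bullet> b) *\<^sub>R fderiv f (h x) b)"
    if "i \<in> Basis" for i
  proof (intro Ck_on_sum assms(1) Ck_on_bilinear[OF assms(1) bounded_bilinear_scaleR])
    fix b :: 'b assume b: "b \<in> Basis"
    show "Ck_on k S (\<lambda>x. fderiv h x i \<bullet> b)"
      by (intro Ck_on_bilinear[OF assms(1) bounded_bilinear_inner] Ck_on_const
          Ck_on_SucD(2)[OF Suc.prems(2)] that)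
    show "Ck_on k S (\<lambda>x. fderiv f (h x) b)"
      by (rule Suc.IH[OF Ck_on_SucD(2)[OF Suc.prems(1) b] Ck_on_Suc_imp[OF Suc.prems(2)]])
  qed
  moreover have "((\<lambda>x. f (h x)) has_derivative (\<lambda>v. \<Sum>b\<in>Basis.
      (fderiv h x v \<bullet> b) *\<^sub>R fderiv f (h x) b)) (at x)" if "x \<in> S" for x
  proof -
    have f: "(f has_derivative fderiv f (h x)) (at (h x))"
      using Ck_on_SucD(1)[OF Suc.prems(1)] assms(3) that by blast
    show ?thesis
      by (rule has_derivative_eq_rhs[OF has_derivative_compose[OF Ck_on_SucD(1)[OF Suc.prems(2) that] f]])
        (rule ext, rule has_derivative_basis_sum[OF f])
  qed
  ultimately show ?case
    by (intro Ck_on_SucI[OF assms(1)])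
qed

section \<open>Closure properties of smooth maps\<close>

lemma smooth_on_cong:
  "open S \<Longrightarrow> (\<And>x. x \<in> S \<Longrightarrow> f x = g x) \<Longrightarrow> smooth_on S f \<Longrightarrow> smooth_on S g"
  unfolding smooth_on_def using Ck_on_cong by blast

lemma smooth_on_subset: "smooth_on S f \<Longrightarrow> T \<subseteq> S \<Longrightarrow> smooth_on T f"
  unfolding smooth_on_def using Ck_on_subset by blast

lemma smooth_on_local:
  "(\<And>x. x \<in> S \<Longrightarrow> \<exists>T. open T \<and> x \<in> T \<and> smooth_on T f) \<Longrightarrow> smooth_on S f"
  unfolding smooth_on_def by (blast intro!: Ck_on_local)

lemma smooth_on_const: "smooth_on S (\<lambda>x. c)"
  by (simp add: smooth_on_def Ck_on_const)

lemma smooth_on_add: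
  "open S \<Longrightarrow> smooth_on S f \<Longrightarrow> smooth_on S g \<Longrightarrow> smooth_on S (\<lambda>x. f x + g x)"
  by (simp add: smooth_on_def Ck_on_add)

lemma smooth_on_sum:
  "open S \<Longrightarrow> (\<And>i. i \<in> I \<Longrightarrow> smooth_on S (f i)) \<Longrightarrow> smooth_on S (\<lambda>x. \<Sum>i\<in>I. f i x)"
  by (simp add: smooth_on_def Ck_on_sum)

lemma smooth_on_bilinear:
  "open S \<Longrightarrow> bounded_bilinear p \<Longrightarrow> smooth_on S f \<Longrightarrow> smooth_on S g \<Longrightarrow> smooth_on S (\<lambda>x. p (f x) (g x))"
  by (simp add: smooth_on_def Ck_on_bilinear)

lemmas smooth_on_scaleR = smooth_on_bilinear[OF _ bounded_bilinear_scaleR]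
lemmas smooth_on_inner = smooth_on_bilinear[OF _ bounded_bilinear_inner]

lemma smooth_on_mult:
  fixes f g :: "'b::euclidean_space \<Rightarrow> real"
  shows "open S \<Longrightarrow> smooth_on S f \<Longrightarrow> smooth_on S g \<Longrightarrow> smooth_on S (\<lambda>x. f x * g x)"
  using smooth_on_bilinear[OF _ bounded_bilinear_mult] by blast

lemma smooth_on_diff:
  assumes "open S" "smooth_on S f" "smooth_on S g" shows "smooth_on S (\<lambda>x. f x - g x)"
  using smooth_on_add[OF assms(1,2) smooth_on_scaleR[OF assms(1) smooth_on_const[of _ "-1::real"] assms(3)]]
  by simp

lemma smooth_on_divide:
  fixes f g :: "'b::euclidean_space \<Rightarrow> real"
  assumes "open S" "smooth_on S f" "smooth_on S g" "\<And>x. x \<in> S \<Longrightarrow> g x \<noteq> 0"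
  shows "smooth_on S (\<lambda>x. f x / g x)"
  unfolding divide_inverse using assms
  by (intro smooth_on_mult) (auto simp: smooth_on_def intro: Ck_on_inverse)

lemma smooth_on_compose:
  fixes f :: "'b::euclidean_space \<Rightarrow> 'c::real_normed_vector" and h :: "'a::euclidean_space \<Rightarrow> 'b"
  assumes "open S" "open T" "h ` S \<subseteq> T" "smooth_on T f" "smooth_on S h"
  shows "smooth_on S (\<lambda>x. f (h x))"
  using assms Ck_on_compose unfolding smooth_on_def by blast

lemma smooth_on_has_derivative:
  "smooth_on S f \<Longrightarrow> x \<in> S \<Longrightarrow> (f has_derivative fderiv f x) (at x)"
  unfolding smooth_on_def using Ck_on_SucD(1)[of 0] by blast

lemma smooth_on_imp_continuous_on: "smooth_on S f \<Longrightarrow> continuous_on S f"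
  unfolding smooth_on_def by (metis Ck_on.simps(1))

lemma smooth_on_frechet_derivative:
  assumes "open S" "smooth_on S f"
  shows "smooth_on S (\<lambda>x. fderiv f x v)"
proof -
  have "smooth_on S (\<lambda>x. fderiv f x i)" if "i \<in> Basis" for i
    using assms(2) Ck_on_SucD(2)[OF _ that] unfolding smooth_on_def by blast
  then have "smooth_on S (\<lambda>x. \<Sum>i\<in>Basis. (v \<bullet> i) *\<^sub>R fderiv f x i)"
    by (intro smooth_on_sum smooth_on_scaleR smooth_on_const assms)
  then show ?thesis
    by (rule smooth_on_cong[OF assms(1), rotated])
      (simp add: has_derivative_basis_sum[OF smooth_on_has_derivative[OF assms(2)], symmetric])
qed

section \<open>Symmetry of second derivatives\<close>

lemma mvt_vector_bound:
  fixes f :: "real \<Rightarrow> 'c::real_normed_vector"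
  assumes "\<And>s. s \<in> {0..h} \<Longrightarrow> (f has_vector_derivative f' s) (at s within {0..h})"
    and "\<And>s. s \<in> {0..h} \<Longrightarrow> norm (f' s) \<le> B" and "0 \<le> h"
  shows "norm (f h - f 0) \<le> B * h"
proof -
  have "norm (f h - f 0) \<le> B * norm (h - 0)"
  proof (rule differentiable_bound[where S = "{0..h}" and f' = "\<lambda>s x. x *\<^sub>R f' s"])
    show "onorm (\<lambda>x. x *\<^sub>R f' s) \<le> B" if "s \<in> {0..h}" for s
      using assms(2)[OF that] by (auto intro!: onorm_le simp: mult.commute[of B] mult_left_mono)
  qed (use assms in \<open>auto simp: has_vector_derivative_def\<close>)
  then show ?thesis using assms(3) by simp
qed

text \<open>The mean value bound is applied to the difference of f along two parallel segments, f (x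
  + s a + h b) - f (x + s a) as a function of s, from which the expected value s h G' b is
  subtracted. Its derivative is of order eps h, since both evaluations of \<open>f' _ a\<close> are
  approximated by means of the derivative G' at x.\<close>

lemma second_difference_limit:
  fixes f :: "'b::euclidean_space \<Rightarrow> 'c::real_normed_vector"
  assumes S: "open S" "x \<in> S"
    and f': "\<And>y. y \<in> S \<Longrightarrow> (f has_derivative f' y) (at y)"
    and G': "((\<lambda>y. f' y a) has_derivative G') (at x)"
  shows "((\<lambda>h. (f (x + h *\<^sub>R a + h *\<^sub>R b) - f (x + h *\<^sub>R a) - (f (x + h *\<^sub>R b) - f x)) /\<^sub>R h\<^sup>2)
     \<longlongrightarrow> G' b) (at_right 0)"
proof (rule tendstoI)
  let ?N = "\<lambda>h. f (x + h *\<^sub>R a + h *\<^sub>R b) - f (x + h *\<^sub>R a) - (f (x + h *\<^sub>R b) - f x)"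
  fix e :: real assume e: "0 < e"
  \<comment> \<open>The two linearization errors are controlled by |s a + h b| and |s a|, at most h
    (|a| + |b|) and h |a|; their sum is at most h C. The summand 1 makes C positive, and the 2 in
    \<open>eps\<close> makes the final inequality strict.\<close>
  define C where "C = 2 * norm a + norm b + 1"
  have C: "C > 0" by (simp add: C_def add_nonneg_pos)
  define eps where "eps = e / (2 * C)"
  have eps: "eps > 0" using e C by (simp add: eps_def)
  interpret G: bounded_linear G' using G' has_derivative_bounded_linear by blast
  obtain d where d: "d > 0"
    "\<And>y. norm (y - x) < d \<Longrightarrow> norm (f' y a - f' x a - G' (y - x)) \<le> eps * norm (y - x)"
    using G' eps unfolding has_derivative_at_alt by blast
  obtain d' where d': "d' > 0" "ball x d' \<subseteq> S" using S openE by blast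
  define m where "m = min d d' / C"
  have m: "m > 0" using d d' C by (simp add: m_def)
  have "norm (?N h /\<^sub>R h\<^sup>2 - G' b) < e"
    if h: "0 < h" "h < m" for h
  proof -
    have hC: "h * C < min d d'" using h(2) C by (simp add: m_def field_simps)
    have in1: "norm (s *\<^sub>R a + t *\<^sub>R b) \<le> h * (norm a + norm b)" if "s \<in> {0..h}" "t \<in> {0..h}" for s t
    proof -
      have "s * norm a + t * norm b \<le> h * norm a + h * norm b"
        using that by (intro add_mono mult_right_mono) auto
      then show ?thesis
        using norm_triangle_ineq[of "s *\<^sub>R a" "t *\<^sub>R b"] that by (simp add: distrib_left)
    qed
    have in2: "norm (s *\<^sub>R a + t *\<^sub>R b) < min d d'" if "s \<in> {0..h}" "t \<in> {0..h}" for s t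
    proof -
      have "h * (norm a + norm b) \<le> h * C" using h by (intro mult_left_mono) (auto simp: C_def)
      then show ?thesis using in1[OF that] hC by linarith
    qed
    have inS: "x + s *\<^sub>R a + t *\<^sub>R b \<in> S" if "s \<in> {0..h}" "t \<in> {0..h}" for s t
      using in2[OF that] d'(2) by (auto simp: subset_iff dist_norm add.assoc norm_minus_commute)
    define p where "p s = f (x + s *\<^sub>R a + h *\<^sub>R b) - f (x + s *\<^sub>R a) - (s * h) *\<^sub>R G' b" for s
    have "norm (p h - p 0) \<le> (eps * (h * C)) * h"
    proof (rule mvt_vector_bound)
      fix s assume s: "s \<in> {0..h}"
      have *: "((\<lambda>s. f (x + s *\<^sub>R a + t *\<^sub>R b)) has_vector_derivative f' (x + s *\<^sub>R a + t *\<^sub>R b) a) (at s within {0..h})"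
        if "t \<in> {0..h}" for t
      proof -
        have "((\<lambda>s. x + s *\<^sub>R a + t *\<^sub>R b) has_derivative (\<lambda>s. s *\<^sub>R a)) (at s within {0..h})"
          by (auto intro!: derivative_eq_intros)
        from has_derivative_compose[OF this f'[OF inS[OF s that]]]
        show ?thesis
          using linear_scale[OF has_derivative_linear[OF f'[OF inS[OF s that]]]]
          by (simp add: has_vector_derivative_def)
      qed
      show "(p has_vector_derivative (f' (x + s *\<^sub>R a + h *\<^sub>R b) a - f' (x + s *\<^sub>R a) a - h *\<^sub>R G' b)) (at s within {0..h})"
      proof -
        have "((\<lambda>s. (s * h) *\<^sub>R G' b) has_vector_derivative h *\<^sub>R G' b) (at s within {0..h})"
          by (auto intro!: derivative_eq_intros simp: has_vector_derivative_def)
        from has_vector_derivative_diff[OF has_vector_derivative_diff[OF *[of h] *[of 0]] this]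
        show ?thesis using h unfolding p_def by simp
      qed
      have "norm (f' (x + s *\<^sub>R a + t *\<^sub>R b) a - f' x a - G' (s *\<^sub>R a + t *\<^sub>R b)) \<le> eps * norm (s *\<^sub>R a + t *\<^sub>R b)"
        if "t \<in> {0..h}" for t
        using d(2)[of "x + s *\<^sub>R a + t *\<^sub>R b"] in2[OF s that] by (simp add: add.assoc)
      from this[of h] this[of 0]
      have "norm (f' (x + s *\<^sub>R a + h *\<^sub>R b) a - f' x a - G' (s *\<^sub>R a + h *\<^sub>R b)) \<le> eps * norm (s *\<^sub>R a + h *\<^sub>R b)"
        "norm (f' (x + s *\<^sub>R a) a - f' x a - G' (s *\<^sub>R a)) \<le> eps * norm (s *\<^sub>R a)"
        using h by auto
      then have "norm ((f' (x + s *\<^sub>R a + h *\<^sub>R b) a - f' x a - G' (s *\<^sub>R a + h *\<^sub>R b)) -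
          (f' (x + s *\<^sub>R a) a - f' x a - G' (s *\<^sub>R a))) \<le> eps * norm (s *\<^sub>R a + h *\<^sub>R b) + eps * norm (s *\<^sub>R a)"
        by (meson add_mono norm_triangle_ineq4 order_trans)
      also have "\<dots> \<le> eps * (h * (norm a + norm b)) + eps * (h * norm a)"
        using in1[OF s, of h] s h eps by (intro add_mono mult_left_mono) (auto intro!: mult_right_mono)
      also have "\<dots> \<le> eps * (h * C)" using eps h by (simp add: C_def algebra_simps)
      finally show "norm (f' (x + s *\<^sub>R a + h *\<^sub>R b) a - f' (x + s *\<^sub>R a) a - h *\<^sub>R G' b) \<le> eps * (h * C)"
        by (simp add: G.add G.scaleR algebra_simps)
    qed (use h in auto)
    moreover define N where "N = ?N h"
    have "p h - p 0 = N - h\<^sup>2 *\<^sub>R G' b"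
      by (simp add: p_def N_def power2_eq_square)
    ultimately have "norm (N - h\<^sup>2 *\<^sub>R G' b) \<le> eps * C * h\<^sup>2"
      by (simp add: power2_eq_square mult.assoc mult.left_commute)
    then have "norm (N - h\<^sup>2 *\<^sub>R G' b) / h\<^sup>2 \<le> eps * C"
      using h by (simp add: pos_divide_le_eq)
    also have "\<dots> < e" using e C by (simp add: eps_def)
    also have "norm (N - h\<^sup>2 *\<^sub>R G' b) / h\<^sup>2 = norm (N /\<^sub>R h\<^sup>2 - G' b)"
    proof -
      have "N /\<^sub>R h\<^sup>2 - G' b = (N - h\<^sup>2 *\<^sub>R G' b) /\<^sub>R h\<^sup>2"
        using h by (simp add: scaleR_diff_right)
      then show ?thesis by (simp add: divide_inverse mult.commute)
    qed
    finally show ?thesis unfolding N_def .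
  qed
  then show "\<forall>\<^sub>F h in at_right 0. dist (?N h /\<^sub>R h\<^sup>2) (G' b) < e"
    using m by (auto simp: eventually_at_right_field dist_norm)
qed

text \<open>The second difference over a parallelogram is symmetric in the two sides, so both mixed
  derivatives are the limit of the same quotient.\<close>

lemma second_derivative_symmetric:
  fixes f :: "'b::euclidean_space \<Rightarrow> 'c::real_normed_vector"
  assumes "open S" "smooth_on S f" "x \<in> S"
  shows "fderiv (\<lambda>y. fderiv f y a) x b =
    fderiv (\<lambda>y. fderiv f y b) x a"
proof (rule tendsto_unique[OF trivial_limit_at_right_real])
  let ?N = "\<lambda>h. f (x + h *\<^sub>R a + h *\<^sub>R b) - f (x + h *\<^sub>R a) - (f (x + h *\<^sub>R b) - f x)"
  note lim = second_difference_limit[OF assms(1,3) smooth_on_has_derivative[OF assms(2)]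
      smooth_on_has_derivative[OF smooth_on_frechet_derivative[OF assms(1,2)] assms(3)]]
  show "((\<lambda>h. ?N h /\<^sub>R h\<^sup>2) \<longlongrightarrow> fderiv (\<lambda>y. fderiv f y a) x b) (at_right 0)"
    by (rule lim)
  show "((\<lambda>h. ?N h /\<^sub>R h\<^sup>2) \<longlongrightarrow> fderiv (\<lambda>y. fderiv f y b) x a) (at_right 0)"
    using lim[of b a] by (simp add: algebra_simps)
qed

section \<open>Integration of commuting vector fields\<close>

lemma norm_basis_sum_le:
  fixes u :: "'b::euclidean_space" and w :: "'b \<Rightarrow> 'c::real_normed_vector"
  assumes "\<And>i. i \<in> Basis \<Longrightarrow> norm (w i) \<le> B"
  shows "norm (\<Sum>i\<in>Basis. (u \<bullet> i) *\<^sub>R w i) \<le> real DIM('b) * B * norm u"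
proof -
  have "norm (\<Sum>i\<in>Basis. (u \<bullet> i) *\<^sub>R w i) \<le> (\<Sum>i\<in>(Basis::'b set). norm u * B)"
    by (rule sum_norm_le) (auto intro!: mult_mono assms Basis_le_norm)
  then show ?thesis by (simp add: algebra_simps)
qed

text \<open>Compactness bounds the map and its finitely many partial derivatives; convexity of the
  ball turns the latter bound into a Lipschitz estimate.\<close>

lemma smooth_on_cball_bounds:
  fixes f :: "'a::euclidean_space \<Rightarrow> 'c::real_normed_vector"
  assumes "open W" "cball p R \<subseteq> W" "smooth_on W f"
  obtains C where "C \<ge> 0" "\<And>q. q \<in> cball p R \<Longrightarrow> norm (f q) \<le> C"
    "\<And>q v. q \<in> cball p R \<Longrightarrow> norm (fderiv f q v) \<le> C * norm v"
    "\<And>q q'. q \<in> cball p R \<Longrightarrow> q' \<in> cball p R \<Longrightarrow> norm (f q - f q') \<le> C * norm (q - q')"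
proof -
  have bd: "\<exists>C\<ge>0. \<forall>q\<in>cball p R. norm (h q) \<le> C" if "smooth_on W h" for h :: "'a \<Rightarrow> 'c"
  proof -
    have "compact (h ` cball p R)"
      using assms(2) smooth_on_imp_continuous_on[OF that]
      by (intro compact_continuous_image) (auto intro: continuous_on_subset)
    then obtain C where "\<forall>x\<in>h ` cball p R. norm x \<le> C" using compact_imp_bounded bounded_iff by blast
    then show ?thesis by (intro exI[of _ "max C 0"]) (auto simp: le_max_iff_disj)
  qed
  obtain C0 where C0: "C0 \<ge> 0" "\<forall>q\<in>cball p R. norm (f q) \<le> C0" using bd[OF assms(3)] by blast
  have "\<exists>C\<ge>0. \<forall>q\<in>cball p R. norm (fderiv f q i) \<le> C" for i
    by (intro bd smooth_on_frechet_derivative assms)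
  then obtain D where D: "\<And>i. D i \<ge> 0" "\<And>i q. q \<in> cball p R \<Longrightarrow> norm (fderiv f q i) \<le> D i"
    by metis
  define C where "C = C0 + DIM('a) * (\<Sum>i\<in>Basis. D i)"
  have C: "C \<ge> 0" "C \<ge> C0" "C \<ge> DIM('a) * (\<Sum>i\<in>Basis. D i)"
    using C0(1) D(1) by (auto simp: C_def intro!: add_nonneg_nonneg mult_nonneg_nonneg sum_nonneg)
  have der: "(f has_derivative fderiv f q) (at q)" if "q \<in> cball p R" for q
    using smooth_on_has_derivative[OF assms(3)] assms(2) that by blast
  have nd: "norm (fderiv f q v) \<le> C * norm v" if q: "q \<in> cball p R" for q v
  proof -
    have "norm (fderiv f q i) \<le> (\<Sum>i\<in>Basis. D i)" if "i \<in> Basis" for i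
      using D(2)[OF q, of i] member_le_sum[OF that, of D] D(1) by force
    from norm_basis_sum_le[OF this, of "\<lambda>i. i"]
    have "norm (fderiv f q v) \<le> DIM('a) * (\<Sum>i\<in>Basis. D i) * norm v"
      by (subst has_derivative_basis_sum[OF der[OF q]]) simp
    also have "\<dots> \<le> C * norm v" using C by (intro mult_right_mono) auto
    finally show ?thesis .
  qed
  show thesis
  proof (rule that[OF C(1)])
    show "norm (f q) \<le> C" if "q \<in> cball p R" for q using C0(2) C(2) that by force
    show "norm (fderiv f q v) \<le> C * norm v" if "q \<in> cball p R" for q v by (rule nd[OF that])
    show "norm (f q - f q') \<le> C * norm (q - q')" if "q \<in> cball p R" "q' \<in> cball p R" for q q'
      by (rule differentiable_bound[OF convex_cball _ _ that])
        (auto intro: has_derivative_at_withinI der onorm_le nd simp del: mem_cball)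
  qed
qed

text \<open>The derivative varies at a Lipschitz rate along the segment from q to q', so the
  deviation from the linearization at q is quadratic.\<close>

lemma smooth_on_cball_taylor:
  fixes f :: "'a::euclidean_space \<Rightarrow> 'c::real_normed_vector"
  assumes "open W" "cball p R \<subseteq> W" "smooth_on W f"
  obtains C where "C \<ge> 0" "\<And>q q'. q \<in> cball p R \<Longrightarrow> q' \<in> cball p R \<Longrightarrow>
    norm (f q' - f q - fderiv f q (q' - q)) \<le> C * (norm (q' - q))\<^sup>2"
proof -
  have "\<exists>C\<ge>0. \<forall>q\<in>cball p R. \<forall>q'\<in>cball p R.
      norm (fderiv f q i - fderiv f q' i) \<le> C * norm (q - q')" for i
    using smooth_on_cball_bounds[OF assms(1,2) smooth_on_frechet_derivative[OF assms(1,3), of i]] by metis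
  then obtain D where D: "\<And>i. D i \<ge> 0" "\<And>i q q'. q \<in> cball p R \<Longrightarrow> q' \<in> cball p R \<Longrightarrow>
      norm (fderiv f q i - fderiv f q' i) \<le> D i * norm (q - q')"
    by metis
  define C where "C = DIM('a) * (\<Sum>i\<in>Basis. D i)"
  have C: "C \<ge> 0" using D(1) by (auto simp: C_def intro!: mult_nonneg_nonneg sum_nonneg)
  have der: "(f has_derivative fderiv f q) (at q)" if "q \<in> cball p R" for q
    using smooth_on_has_derivative[OF assms(3)] assms(2) that by blast
  have "norm (f q' - f q - fderiv f q (q' - q)) \<le> C * (norm (q' - q))\<^sup>2"
    if q: "q \<in> cball p R" and q': "q' \<in> cball p R" for q q'
  proof -
    have seg: "closed_segment q q' \<subseteq> cball p R"
      by (rule closed_segment_subset[OF q q' convex_cball])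
    have "norm (f q' - f q - fderiv f q (q' - q)) \<le> norm (q' - q) * (C * norm (q' - q))"
    proof (rule differentiable_bound_linearization)
      show "q + t *\<^sub>R (q' - q) \<in> closed_segment q q'" if "t \<in> {0..1}" for t
        using that by (auto simp: in_segment algebra_simps intro!: exI[of _ t])
      show "(f has_derivative fderiv f x) (at x within closed_segment q q')"
        if "x \<in> closed_segment q q'" for x
        using der seg that by (blast intro: has_derivative_at_withinI)
      show "onorm (fderiv f x - fderiv f q) \<le> C * norm (q' - q)"
        if x: "x \<in> closed_segment q q'" for x
      proof (rule onorm_le)
        fix v :: 'a
        have xq: "norm (x - q) \<le> norm (q' - q)"
          using segment_bound(1)[OF x] by simp
        have xc: "x \<in> cball p R" using x seg by blast
        have "norm (fderiv f x i - fderiv f q i)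
            \<le> (\<Sum>i\<in>Basis. D i) * norm (q' - q)" if "i \<in> Basis" for i
        proof -
          have "D i * norm (x - q) \<le> (\<Sum>i\<in>Basis. D i) * norm (q' - q)"
            using xq D(1) member_le_sum[OF that, of D] by (intro mult_mono) (auto intro: sum_nonneg)
          then show ?thesis using D(2)[OF xc q, of i] by linarith
        qed
        from norm_basis_sum_le[OF this, of "\<lambda>i. i" v]
        have "norm (\<Sum>i\<in>Basis. (v \<bullet> i) *\<^sub>R (fderiv f x i - fderiv f q i))
            \<le> C * norm (q' - q) * norm v"
          by (simp add: C_def mult.assoc)
        moreover have "(fderiv f x - fderiv f q) v =
           (\<Sum>i\<in>Basis. (v \<bullet> i) *\<^sub>R (fderiv f x i - fderiv f q i))"
          using has_derivative_basis_sum[OF der[OF xc], of v] has_derivative_basis_sum[OF der[OF q], of v]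
          by (simp add: scaleR_diff_right sum_subtractf)
        ultimately show "norm ((fderiv f x - fderiv f q) v)
            \<le> C * norm (q' - q) * norm v" by simp
      qed
    qed simp
    then show ?thesis by (simp add: power2_eq_square mult.left_commute)
  qed
  with C show thesis using that by blast
qed

text \<open>The substitution that converts the fixed point equation at the parameter s u, an
  integral over the unit interval, into the integral equation up to time s along the ray of
  u.\<close>

lemma integral_rescale:
  fixes h :: "real \<Rightarrow> 'c::euclidean_space"
  assumes "continuous_on {0..1} h" "s \<in> {0..1}"
  shows "integral {0..1} (\<lambda>t. s *\<^sub>R h (t * s)) = integral {0..s} h"
proof (cases "s = 0")
  case False
  then have s: "s > 0" using assms(2) by auto
  have "(h has_integral integral {0..s} h) {0..s}"
    using assms by (intro integrable_integral integrable_continuous_real) (auto intro: continuous_on_subset)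
  from has_integral_stretch_real[OF this False]
  have "((\<lambda>x. h (s * x)) has_integral (1 / s) *\<^sub>R integral {0..s} h) ((\<lambda>x. x / s) ` {0..s})"
    using s by simp
  moreover have "(\<lambda>x. x / s) ` {0..s} = {0..1}"
    using s by (auto simp: image_iff field_simps intro!: bexI[of _ "_ * s"])
  ultimately have "((\<lambda>x. s *\<^sub>R h (s * x)) has_integral s *\<^sub>R (1 / s) *\<^sub>R integral {0..s} h) {0..1}"
    by (metis has_integral_cmul)
  then have "((\<lambda>t. s *\<^sub>R h (t * s)) has_integral integral {0..s} h) {0..1}"
    using s by (simp add: mult.commute)
  then show ?thesis by (rule integral_unique)
qed simp

text \<open>All rays are solved by one fixed point: G u is p0 plus the integral of X u (G (t u))
  over t in [0, 1]. Homogeneity of X in u makes the restriction of G to a ray an integral curve, and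
  continuity in u comes with the function space. The contraction factor is L r \<le> 1/2.\<close>

lemma radial_integral_curves:
  fixes X :: "'b::euclidean_space \<Rightarrow> 'c::euclidean_space \<Rightarrow> 'c"
  assumes bound: "\<And>u p. norm (X u p) \<le> M * norm u"
    and lip: "\<And>u p q. norm (X u p - X u q) \<le> L * norm u * norm (p - q)"
    and scale: "\<And>s u p. X (s *\<^sub>R u) p = s *\<^sub>R X u p"
    and cont: "continuous_on UNIV (\<lambda>z. X (fst z) (snd z))"
    and r: "0 < r" "L * r \<le> 1/2" and M: "0 \<le> M" and L: "0 \<le> L"
  obtains F where "F 0 = p0"
    "\<And>u s. u \<in> cball 0 r \<Longrightarrow> s \<in> {0..1} \<Longrightarrow>
      ((\<lambda>s. F (s *\<^sub>R u)) has_vector_derivative X u (F (s *\<^sub>R u))) (at s within {0..1})"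
proof -
  \<comment> \<open>Bounded continuous functions live on the whole type, so the parameter is
    retracted to the ball of radius r, where the bounds M r and L r apply.\<close>
  define c where "c = closest_point (cball (0::'b) r)"
  have c: "norm (c u) \<le> r" for u
    using closest_point_in_set[of "cball (0::'b) r" u] r by (simp add: c_def)
  have c_id: "c u = u" if "u \<in> cball 0 r" for u
    using closest_point_self[OF that] by (simp add: c_def)
  have c_cont: "continuous_on S c" for S
    unfolding c_def by (rule continuous_on_closest_point) (use r in auto)
  define T where "T G = (\<lambda>u. p0 + integral {0..1} (\<lambda>t. X (c u) (apply_bcontfun G (t *\<^sub>R c u))))"
    for G :: "'b \<Rightarrow>\<^sub>C 'c"
  have cont': "continuous_on S (\<lambda>z. X (f z) (h z))"
    if "continuous_on S f" "continuous_on S h" for S and f :: "'x::topological_space \<Rightarrow> 'b" and h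
    using continuous_on_compose2[OF cont continuous_on_Pair[OF that]] by simp
  have G_cont: "continuous_on S (\<lambda>z. apply_bcontfun G (f z))"
    if "continuous_on S f" for S G and f :: "'x::topological_space \<Rightarrow> 'b"
    by (rule continuous_on_compose2[OF continuous_on_apply_bcontfun that]) auto
  have T_in: "T G \<in> bcontfun" for G
  proof (rule bcontfun_normI)
    have "continuous_on (UNIV \<times> cbox 0 1) (\<lambda>(u, t::real). X (c u) (apply_bcontfun G (t *\<^sub>R c u)))"
      unfolding split_beta
      by (intro cont' G_cont continuous_intros continuous_on_compose2[OF c_cont[of UNIV]]) auto
    from integral_continuous_on_param[OF this]
    show "continuous_on UNIV (T G)" unfolding T_def by (auto intro!: continuous_intros)
    fix u
    have "norm (integral {0..1} (\<lambda>t. X (c u) (apply_bcontfun G (t *\<^sub>R c u)))) \<le> (M * r) * (1 - 0)"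
    proof (rule integral_bound)
      show "norm (X (c u) (apply_bcontfun G (t *\<^sub>R c u))) \<le> M * r" if "t \<in> {0..1}" for t
        using bound[of "c u" "apply_bcontfun G (t *\<^sub>R c u)"] mult_left_mono[OF c[of u] M] by linarith
    qed (auto intro!: cont' G_cont continuous_intros)
    then show "norm (T G u) \<le> norm p0 + M * r"
      unfolding T_def using norm_triangle_le by (metis add_left_mono diff_zero mult.right_neutral)
  qed
  have "\<exists>!G. Bcontfun (T G) = G"
  proof (rule banach_fix_type[of "1/2"], simp_all, intro allI)
    fix G H :: "'b \<Rightarrow>\<^sub>C 'c"
    have "dist (Bcontfun (T G)) (Bcontfun (T H)) \<le> 1/2 * dist G H"
    proof (rule dist_bound)
      fix u
      let ?g = "\<lambda>G t. X (c u) (apply_bcontfun G (t *\<^sub>R c u))"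
      have gc: "continuous_on {0..1} (?g G)" for G by (intro cont' G_cont continuous_intros)
      have "T G u - T H u = integral {0..1} (\<lambda>t. ?g G t - ?g H t)"
        unfolding T_def by (simp add: integral_diff integrable_continuous_real gc)
      also have "norm \<dots> \<le> (1/2 * dist G H) * (1 - 0)"
      proof (rule integral_bound)
        show "continuous_on {0..1} (\<lambda>t. ?g G t - ?g H t)" by (intro continuous_intros gc)
        fix t :: real
        have "norm (?g G t - ?g H t) \<le> L * norm (c u) * dist G H"
          using lip[of "c u" "apply_bcontfun G (t *\<^sub>R c u)" "apply_bcontfun H (t *\<^sub>R c u)"]
            mult_left_mono[OF dist_bounded[of G "t *\<^sub>R c u" H], of "L * norm (c u)"] L
          by (simp add: dist_norm)
        also have "\<dots> \<le> 1/2 * dist G H"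
          using r(2) mult_left_mono[OF c[of u] L] by (intro mult_right_mono) auto
        finally show "norm (?g G t - ?g H t) \<le> 1/2 * dist G H" .
      qed auto
      finally show "dist (apply_bcontfun (Bcontfun (T G)) u) (apply_bcontfun (Bcontfun (T H)) u) \<le> 1/2 * dist G H"
        by (simp add: Bcontfun_inverse T_in dist_norm)
    qed
    then show "dist (Bcontfun (T G)) (Bcontfun (T H)) * 2 \<le> dist G H" by simp
  qed
  then obtain G where "Bcontfun (T G) = G" by blast
  then have G: "apply_bcontfun G u = T G u" for u by (metis Bcontfun_inverse T_in)
  show thesis
  proof (rule that[of "apply_bcontfun G"])
    have "c 0 = 0" using r by (intro c_id) auto
    moreover have "X 0 p = 0" for p using scale[of 0 0] by simp
    ultimately show "apply_bcontfun G 0 = p0" using G[of 0] by (simp add: T_def)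
    fix u :: 'b and s :: real assume u: "u \<in> cball 0 r" and s: "s \<in> {0..1}"
    let ?h = "\<lambda>t. X u (apply_bcontfun G (t *\<^sub>R u))"
    have hc: "continuous_on {0..1} ?h" by (intro cont' G_cont continuous_intros)
    have eq: "apply_bcontfun G (s *\<^sub>R u) = p0 + integral {0..s} ?h" if "s \<in> {0..1}" for s
    proof -
      have "norm (s *\<^sub>R u) \<le> 1 * r" unfolding norm_scaleR
        using u that by (intro mult_mono) auto
      then have "c (s *\<^sub>R u) = s *\<^sub>R u" by (intro c_id) simp
      then have "apply_bcontfun G (s *\<^sub>R u) = p0 + integral {0..1} (\<lambda>t. s *\<^sub>R ?h (t * s))"
        using G[of "s *\<^sub>R u"] by (simp add: T_def scale)
      then show ?thesis using integral_rescale[OF hc that] by simp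
    qed
    have "((\<lambda>s. p0 + integral {0..s} ?h) has_vector_derivative ?h s) (at s within {0..1})"
      using has_vector_derivative_add[OF has_vector_derivative_const integral_has_vector_derivative[OF hc s]]
      by simp
    then show "((\<lambda>s. apply_bcontfun G (s *\<^sub>R u)) has_vector_derivative X u (apply_bcontfun G (s *\<^sub>R u))) (at s within {0..1})"
      by (rule has_vector_derivative_transform[OF s, rotated]) (rule eq)
  qed
qed

text \<open>The radial solution \<open>F\<close> has derivative \<open>X\<close> in all directions: along \<open>t \<mapsto> t (u + h)\<close> it is
  compared with \<open>p t = F (t u) + t X h (F (t u))\<close>, which by commutativity solves the same equation
  up to an error quadratic in \<open>h\<close>.\<close>

lemma commuting_fields_integral:
  fixes Y :: "'b::euclidean_space \<Rightarrow> 'c::euclidean_space \<Rightarrow> 'c"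
  assumes W: "open W" "p0 \<in> W" and Y: "\<And>i. i \<in> Basis \<Longrightarrow> smooth_on W (Y i)"
    and comm: "\<And>i j p. i \<in> Basis \<Longrightarrow> j \<in> Basis \<Longrightarrow> p \<in> W \<Longrightarrow>
      fderiv (Y i) p (Y j p) = fderiv (Y j) p (Y i p)"
  obtains r F where "r > 0" "F 0 = p0" "F ` ball 0 r \<subseteq> W" "smooth_on (ball 0 r) F"
    "\<And>u. u \<in> ball 0 r \<Longrightarrow> (F has_derivative (\<lambda>a. \<Sum>i\<in>Basis. (a \<bullet> i) *\<^sub>R Y i (F u))) (at u)"
proof -
  obtain R where R: "R > 0" "cball p0 R \<subseteq> W" using W open_contains_cball by blast
  let ?B = "cball p0 R"
  let ?D = "\<lambda>i q. fderiv (Y i) q"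
  let ?P = "\<lambda>i C. C \<ge> 0 \<and> (\<forall>q\<in>?B. norm (Y i q) \<le> C \<and> (\<forall>v. norm (?D i q v) \<le> C * norm v) \<and>
      (\<forall>q'\<in>?B. norm (Y i q - Y i q') \<le> C * norm (q - q') \<and>
        norm (Y i q' - Y i q - ?D i q (q' - q)) \<le> C * (norm (q' - q))\<^sup>2))"
  have "\<exists>C. ?P i C" if i: "i \<in> Basis" for i
  proof -
    obtain C1 where C1: "C1 \<ge> 0" "\<And>q. q \<in> ?B \<Longrightarrow> norm (Y i q) \<le> C1"
      "\<And>q v. q \<in> ?B \<Longrightarrow> norm (?D i q v) \<le> C1 * norm v"
      "\<And>q q'. q \<in> ?B \<Longrightarrow> q' \<in> ?B \<Longrightarrow> norm (Y i q - Y i q') \<le> C1 * norm (q - q')"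
      using smooth_on_cball_bounds[OF W(1) R(2) Y[OF i]] by metis
    obtain C2 where C2: "C2 \<ge> 0" "\<And>q q'. q \<in> ?B \<Longrightarrow> q' \<in> ?B \<Longrightarrow>
        norm (Y i q' - Y i q - ?D i q (q' - q)) \<le> C2 * (norm (q' - q))\<^sup>2"
      using smooth_on_cball_taylor[OF W(1) R(2) Y[OF i]] by metis
    have "C1 * t \<le> (C1 + C2) * t" "C2 * t \<le> (C1 + C2) * t" if "t \<ge> 0" for t
      using C1(1) C2(1) that by (auto intro: mult_right_mono)
    then show ?thesis using C1 C2
      by (intro exI[of _ "C1 + C2"]) (smt (verit, best) norm_ge_zero zero_le_power2)
  qed
  then obtain C where "\<And>i. i \<in> Basis \<Longrightarrow> ?P i (C i)" by metis
  then have C: "\<And>i. i \<in> Basis \<Longrightarrow> C i \<ge> 0"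
    "\<And>i q. i \<in> Basis \<Longrightarrow> q \<in> ?B \<Longrightarrow> norm (Y i q) \<le> C i"
    "\<And>i q v. i \<in> Basis \<Longrightarrow> q \<in> ?B \<Longrightarrow> norm (?D i q v) \<le> C i * norm v"
    "\<And>i q q'. i \<in> Basis \<Longrightarrow> q \<in> ?B \<Longrightarrow> q' \<in> ?B \<Longrightarrow> norm (Y i q - Y i q') \<le> C i * norm (q - q')"
    "\<And>i q q'. i \<in> Basis \<Longrightarrow> q \<in> ?B \<Longrightarrow> q' \<in> ?B \<Longrightarrow>
        norm (Y i q' - Y i q - ?D i q (q' - q)) \<le> C i * (norm (q' - q))\<^sup>2"
    by blast+
  define S where "S = (\<Sum>i\<in>Basis. C i)"
  have S: "S \<ge> 0" "\<And>i. i \<in> Basis \<Longrightarrow> C i \<le> S"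
    using C(1) by (auto simp: S_def intro!: sum_nonneg member_le_sum)
  define K where "K = DIM('b) * S"
  have K: "K \<ge> 0" using S by (simp add: K_def)
  define X where "X u p = (\<Sum>i\<in>Basis. (u \<bullet> i) *\<^sub>R Y i p)" for u p
  define DX where "DX u q v = (\<Sum>i\<in>Basis. (u \<bullet> i) *\<^sub>R ?D i q v)" for u q v
  have nsum: "norm (\<Sum>i\<in>Basis. (u \<bullet> i) *\<^sub>R w i) \<le> K * t * norm u"
    if "\<And>i. i \<in> Basis \<Longrightarrow> norm (w i) \<le> C i * t" "t \<ge> 0" for u :: 'b and w :: "'b \<Rightarrow> 'c" and t
  proof -
    have "norm (w i) \<le> S * t" if i: "i \<in> Basis" for i
      using \<open>\<And>i. i \<in> Basis \<Longrightarrow> norm (w i) \<le> C i * t\<close>[OF i] mult_right_mono[OF S(2)[OF i] \<open>t \<ge> 0\<close>] by linarith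
    from norm_basis_sum_le[OF this, of "\<lambda>i. i"] show ?thesis by (simp add: K_def mult.assoc)
  qed
  have X_bound: "norm (X u p) \<le> K * norm u" if "p \<in> ?B" for u p
    using nsum[of "\<lambda>i. Y i p" 1 u] C(2) that by (simp add: X_def)
  have X_lip: "norm (X u p - X u q) \<le> K * norm u * norm (p - q)" if "p \<in> ?B" "q \<in> ?B" for u p q
    using nsum[of "\<lambda>i. Y i p - Y i q" "norm (p - q)" u] C(4)[OF _ that]
    by (simp add: X_def scaleR_diff_right sum_subtractf mult_ac)
  have DX_bound: "norm (DX u q v) \<le> K * norm v * norm u" if "q \<in> ?B" for u q v
    using nsum[of "\<lambda>i. ?D i q v" "norm v" u] C(3) that by (simp add: DX_def)
  have X_taylor: "norm (X u q' - X u q - DX u q (q' - q)) \<le> K * (norm (q' - q))\<^sup>2 * norm u"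
    if "q \<in> ?B" "q' \<in> ?B" for u q q'
    using nsum[of "\<lambda>i. Y i q' - Y i q - ?D i q (q' - q)" "(norm (q' - q))\<^sup>2" u] C(5)[OF _ that]
    by (simp add: X_def DX_def scaleR_diff_right sum_subtractf)
  have Dlin: "linear (?D i q)" if "i \<in> Basis" "q \<in> ?B" for i q
    using smooth_on_has_derivative[OF Y] R(2) that by (blast intro: has_derivative_linear)
  have DX_lin: "linear (DX u q)" if "q \<in> ?B" for u q
    unfolding DX_def
    by (intro linear_compose_sum ballI linear_compose_scale_right Dlin that)
  have DX_comm: "DX u q (X h q) = DX h q (X u q)" if q: "q \<in> ?B" for u h q
  proof -
    have dbl: "DX u q (X h q) = (\<Sum>i\<in>Basis. \<Sum>j\<in>Basis. ((u \<bullet> i) * (h \<bullet> j)) *\<^sub>R ?D i q (Y j q))" for u h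
      unfolding DX_def X_def
      by (intro sum.cong refl)
        (simp add: linear_sum[OF Dlin] linear_scale[OF Dlin] q scaleR_sum_right del: mem_cball)
    have "(\<Sum>i\<in>Basis. \<Sum>j\<in>Basis. ((u \<bullet> i) * (h \<bullet> j)) *\<^sub>R ?D i q (Y j q)) =
      (\<Sum>i\<in>Basis. \<Sum>j\<in>Basis. ((h \<bullet> j) * (u \<bullet> i)) *\<^sub>R ?D j q (Y i q))"
    proof (intro sum.cong refl)
      fix i j :: 'b assume "i \<in> Basis" "j \<in> Basis"
      then have "?D i q (Y j q) = ?D j q (Y i q)" using comm q R(2) by blast
      then show "((u \<bullet> i) * (h \<bullet> j)) *\<^sub>R ?D i q (Y j q) = ((h \<bullet> j) * (u \<bullet> i)) *\<^sub>R ?D j q (Y i q)"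
        by (simp add: mult.commute)
    qed
    also have "\<dots> = (\<Sum>j\<in>Basis. \<Sum>i\<in>Basis. ((h \<bullet> j) * (u \<bullet> i)) *\<^sub>R ?D j q (Y i q))"
      by (rule sum.swap)
    finally show ?thesis by (simp only: dbl)
  qed
  have X_der: "(X u has_derivative DX u q) (at q)" if "q \<in> ?B" for u q
    unfolding X_def DX_def
    by (intro has_derivative_sum has_derivative_scaleR_right smooth_on_has_derivative[OF Y])
      (use that R(2) in auto)
  have X_lin: "linear (\<lambda>u. X u p)" for p
    unfolding X_def by (auto intro!: linearI simp: inner_add_left scaleR_add_left sum.distrib scaleR_sum_right)
  \<comment> \<open>The 1/2 makes the fixed point map a contraction. The R / 3 keeps
    \<open>P t\<close> below in the ball: F moves by at most K r and, since |h| \<le> 2 r, the added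
    term has length at most 2 K r. Adding 1 to K avoids division by 0.\<close>
  define r where "r = min (1/2) (R / 3) / (K + 1)"
  have r: "r > 0" using K R by (simp add: r_def)
  have "(K + 1) * r \<le> 1/2" "(K + 1) * r \<le> R / 3"
    using K by (auto simp: r_def)
  then have Kr: "K * r \<le> 1/2" "3 * (K * r) \<le> R"
    using r K by (auto simp: distrib_right)
  \<comment> \<open>Composition with the nearest point projection makes the fields bounded and
    Lipschitz everywhere; it is dropped once the solution is seen to stay in the ball.\<close>
  define cp where "cp = closest_point ?B"
  have cpB: "cp p \<in> ?B" for p
    unfolding cp_def by (rule closest_point_in_set) (use R in auto)
  have cp_id: "cp p = p" if "p \<in> ?B" for p unfolding cp_def by (rule closest_point_self[OF that])
  have cp_lip: "norm (cp p - cp q) \<le> norm (p - q)" for p q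
    using closest_point_lipschitz[OF convex_cball closed_cball, of p0 R p q] R
    by (simp add: cp_def dist_norm)
  obtain F where F0: "F 0 = p0" and F': "\<And>u s. u \<in> cball 0 r \<Longrightarrow> s \<in> {0..1} \<Longrightarrow>
      ((\<lambda>s. F (s *\<^sub>R u)) has_vector_derivative X u (cp (F (s *\<^sub>R u)))) (at s within {0..1})"
  proof (rule radial_integral_curves[of "\<lambda>u p. X u (cp p)" K K r p0])
    show "norm (X u (cp p)) \<le> K * norm u" for u p by (rule X_bound[OF cpB])
    show "norm (X u (cp p) - X u (cp q)) \<le> K * norm u * norm (p - q)" for u p q
      using X_lip[OF cpB[of p] cpB[of q], of u] mult_left_mono[OF cp_lip[of p q], of "K * norm u"] K by simp
    show "X (s *\<^sub>R u) (cp p) = s *\<^sub>R X u (cp p)" for s u p by (rule linear_scale[OF X_lin])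
    have cpc: "continuous_on UNIV cp"
      unfolding cp_def by (rule continuous_on_closest_point) (use R in auto)
    show "continuous_on UNIV (\<lambda>z. X (fst z) (cp (snd z)))"
      unfolding X_def
    proof (intro continuous_intros)
      fix i :: 'b assume i: "i \<in> Basis"
      show "continuous_on UNIV (\<lambda>z::'b \<times> 'c. Y i (cp (snd z)))"
        by (rule continuous_on_compose2[OF smooth_on_imp_continuous_on[OF Y[OF i]]])
          (use cpB R(2) in \<open>auto intro!: continuous_on_compose2[OF cpc] continuous_intros\<close>)
    qed
  qed (use r Kr K in auto)
  have FB': "norm (F (s *\<^sub>R u) - p0) \<le> K * r" if u: "u \<in> cball 0 r" and s: "s \<in> {0..1}" for u s
  proof -
    have "norm (F (s *\<^sub>R u) - F (0 *\<^sub>R u)) \<le> (K * r) * s"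
    proof (rule mvt_vector_bound)
      fix t assume t: "t \<in> {0..s}"
      show "((\<lambda>s. F (s *\<^sub>R u)) has_vector_derivative X u (cp (F (t *\<^sub>R u)))) (at t within {0..s})"
        by (rule has_vector_derivative_within_subset[OF F'[OF u]]) (use t s in auto)
      show "norm (X u (cp (F (t *\<^sub>R u)))) \<le> K * r"
        using X_bound[OF cpB] u mult_left_mono[OF _ K, of "norm u" r] by (smt (verit) mem_cball_0)
    qed (use s in auto)
    also have "\<dots> \<le> (K * r) * 1" using s K r by (intro mult_left_mono) auto
    finally show ?thesis by (simp add: F0)
  qed
  have FB: "F (s *\<^sub>R u) \<in> ?B" if "u \<in> cball 0 r" "s \<in> {0..1}" for u s
    using FB'[OF that] Kr K r by (simp add: dist_norm norm_minus_commute)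
      (smt (verit) mult_nonneg_nonneg)
  have F1: "F u \<in> ?B" if "u \<in> cball 0 r" for u using FB[OF that, of 1] by simp
  have FX: "((\<lambda>s. F (s *\<^sub>R u)) has_vector_derivative X u (F (s *\<^sub>R u))) (at s within {0..1})"
    if "u \<in> cball 0 r" "s \<in> {0..1}" for u s
    using F'[OF that] cp_id[OF FB[OF that]] by simp
  \<comment> \<open>The coefficients of |h|^2 in the two error terms: the Taylor remainder of
    \<open>X (u + h)\<close> for a displacement k with |k| \<le> K |h|, and
    \<open>DX h q k\<close>.\<close>
  define C0 where "C0 = K * K\<^sup>2 * r + K * K"
  have C0: "C0 \<ge> 0" using K r by (simp add: C0_def)
  have est: "norm (F (u + h) - F u - X h (F u)) \<le> 2 * (C0 * (norm h)\<^sup>2)"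
    if u: "u \<in> cball 0 r" and uh: "u + h \<in> cball 0 r" for u h
  proof -
    have h2r: "norm h \<le> 2 * r"
      using norm_triangle_ineq4[of "u + h" u] u uh by simp
    define P where "P t = F (t *\<^sub>R u) + t *\<^sub>R X h (F (t *\<^sub>R u))" for t
    define P' where "P' t = X u (F (t *\<^sub>R u)) + (X h (F (t *\<^sub>R u)) + t *\<^sub>R DX h (F (t *\<^sub>R u)) (X u (F (t *\<^sub>R u))))" for t
    define E where "E t = F (t *\<^sub>R (u + h)) - P t" for t
    define E' where "E' t = X (u + h) (F (t *\<^sub>R (u + h))) - P' t" for t
    have E_der: "(E has_vector_derivative E' t) (at t within {0..1})" if t: "t \<in> {0..1}" for t
    proof -
      have "((\<lambda>s. X h (F (s *\<^sub>R u))) has_vector_derivative DX h (F (t *\<^sub>R u)) (X u (F (t *\<^sub>R u)))) (at t within {0..1})"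
        using has_derivative_compose[OF FX[OF u t, unfolded has_vector_derivative_def] X_der[OF FB[OF u t], of h]]
          linear_scale[OF DX_lin[OF FB[OF u t]]]
        by (simp add: has_vector_derivative_def)
      from has_vector_derivative_scaleR[OF DERIV_ident this]
      have "((\<lambda>s. s *\<^sub>R X h (F (s *\<^sub>R u))) has_vector_derivative
          t *\<^sub>R DX h (F (t *\<^sub>R u)) (X u (F (t *\<^sub>R u))) + X h (F (t *\<^sub>R u))) (at t within {0..1})" by simp
      from has_vector_derivative_add[OF FX[OF u t] this]
      have "(P has_vector_derivative P' t) (at t within {0..1})"
        unfolding P_def P'_def by (simp add: add.commute)
      from has_vector_derivative_diff[OF FX[OF uh t] this]
      show ?thesis unfolding E_def E'_def .
    qed
    have E'_bound: "norm (E' t) \<le> 1/2 * norm (E t) + C0 * (norm h)\<^sup>2" if t: "t \<in> {0..1}" for t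
    proof -
      define q where "q = F (t *\<^sub>R u)"
      define k where "k = t *\<^sub>R X h q"
      have q: "q \<in> ?B" unfolding q_def by (rule FB[OF u t])
      have k: "norm k \<le> K * norm h"
      proof -
        have "norm k \<le> 1 * (K * norm h)" unfolding k_def norm_scaleR
          using t X_bound[OF q, of h] by (intro mult_mono) auto
        then show ?thesis by simp
      qed
      have "norm (q + k - p0) \<le> K * r + K * (2 * r)"
        using norm_triangle_mono[OF FB'[OF u t, folded q_def] order_trans[OF k mult_left_mono[OF h2r K]]]
        by (simp add: algebra_simps)
      then have qk: "q + k \<in> ?B" using Kr by (simp add: dist_norm norm_minus_commute)
      have P: "P t = q + k" by (simp add: P_def q_def k_def)
      \<comment> \<open>Commutativity enters here: the term t DX h q (X u q) of \<open>P' t\<close>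
        equals \<open>DX u q k\<close>. Thus \<open>P' t\<close> is the linearization of
        \<open>X (u + h)\<close> at q, evaluated at q + k, up to \<open>DX h q k\<close>.\<close>
      have "P' t = X (u + h) q + DX u q k"
        unfolding P'_def k_def using DX_comm[OF q, of u h]
        by (simp add: q_def[symmetric] linear_add[OF X_lin] linear_scale[OF DX_lin[OF q]])
      moreover have "DX (u + h) q k = DX u q k + DX h q k"
        by (simp add: DX_def inner_add_left scaleR_add_left sum.distrib)
      ultimately have E': "E' t = (X (u + h) (F (t *\<^sub>R (u + h))) - X (u + h) (q + k)) +
          ((X (u + h) (q + k) - X (u + h) q - DX (u + h) q (q + k - q)) + DX h q k)"
        unfolding E'_def by simp
      have uh': "norm (u + h) \<le> r" using uh by simp
      have 1: "norm (X (u + h) (F (t *\<^sub>R (u + h))) - X (u + h) (q + k)) \<le> 1/2 * norm (E t)"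
      proof -
        have "K * norm (u + h) \<le> 1/2" using Kr mult_left_mono[OF uh' K] by linarith
        then show ?thesis
          using X_lip[OF FB[OF uh t] qk, of "u + h"]
            mult_right_mono[of "K * norm (u + h)" "1/2" "norm (E t)"] by (simp add: E_def P)
      qed
      have 2: "norm (X (u + h) (q + k) - X (u + h) q - DX (u + h) q (q + k - q)) \<le> K * (K * norm h)\<^sup>2 * r"
      proof -
        have "K * (norm (q + k - q))\<^sup>2 * norm (u + h) \<le> K * (K * norm h)\<^sup>2 * r"
          using k uh' K r by (intro mult_mono power_mono) auto
        then show ?thesis using X_taylor[OF q qk, of "u + h"] by linarith
      qed
      have 3: "norm (DX h q k) \<le> K * (K * norm h) * norm h"
        using DX_bound[OF q, of h k] mult_right_mono[OF mult_left_mono[OF k K], of "norm h"] by simp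
      have "norm (E' t) \<le> 1/2 * norm (E t) + (K * (K * norm h)\<^sup>2 * r + K * (K * norm h) * norm h)"
        unfolding E' by (intro norm_triangle_mono 1 2 3)
      also have "K * (K * norm h)\<^sup>2 * r + K * (K * norm h) * norm h = C0 * (norm h)\<^sup>2"
        by (simp add: C0_def power2_eq_square algebra_simps)
      finally show ?thesis .
    qed
    \<comment> \<open>In place of Gronwall's inequality: at a maximum m of the error the mean value
      bound gives |E m| \<le> |E m| / 2 + C0 |h|^2, and the first summand is absorbed. This is the
      origin of the 2 in \<open>est\<close>.\<close>
    have "continuous_on {0..1} (\<lambda>t. norm (E t))"
      unfolding continuous_on_eq_continuous_within
      by (intro ballI continuous_norm has_vector_derivative_continuous[OF E_der])
    then obtain m where m: "m \<in> {0..1}" "\<And>t. t \<in> {0..1} \<Longrightarrow> norm (E t) \<le> norm (E m)"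
      using continuous_attains_sup[of "{0..1::real}" "\<lambda>t. norm (E t)"] by auto
    define b where "b = 1/2 * norm (E m) + C0 * (norm h)\<^sup>2"
    have "norm (E m - E 0) \<le> b * m"
    proof (rule mvt_vector_bound)
      fix t assume t: "t \<in> {0..m}"
      then have t1: "t \<in> {0..1}" using m(1) by auto
      show "(E has_vector_derivative E' t) (at t within {0..m})"
        by (rule has_vector_derivative_within_subset[OF E_der[OF t1]]) (use m(1) in auto)
      show "norm (E' t) \<le> b" using E'_bound[OF t1] m(2)[OF t1] by (simp add: b_def)
    qed (use m(1) in auto)
    also have "\<dots> \<le> b * 1" using m(1) C0 by (intro mult_left_mono) (auto simp: b_def)
    also have "E 0 = 0" by (simp add: E_def P_def F0)
    finally have "norm (E m) \<le> 2 * (C0 * (norm h)\<^sup>2)" by (simp add: b_def)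
    then have "norm (E 1) \<le> 2 * (C0 * (norm h)\<^sup>2)" using m(2)[of 1] by simp
    then show ?thesis by (simp add: E_def P_def diff_diff_eq)
  qed
  have der: "(F has_derivative (\<lambda>a. X a (F u))) (at u)" if u: "u \<in> ball 0 r" for u
    unfolding has_derivative_at_alt
  proof (intro conjI allI impI)
    show "bounded_linear (\<lambda>a. X a (F u))" using X_lin linear_linear by blast
    fix e :: real assume e: "e > 0"
    define d where "d = min (r - norm u) (e / (2 * C0 + 1))"
    have "norm (F y - F u - X (y - u) (F u)) \<le> e * norm (y - u)" if y: "norm (y - u) < d" for y
    proof -
      have "norm (u + (y - u)) \<le> r"
        using norm_triangle_ineq[of u "y - u"] y by (simp add: d_def)
      then have "norm (F y - F u - X (y - u) (F u)) \<le> 2 * (C0 * (norm (y - u))\<^sup>2)"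
        using est[of u "y - u"] u by simp
      also have "\<dots> = (2 * C0 * norm (y - u)) * norm (y - u)" by (simp add: power2_eq_square)
      also have "\<dots> \<le> e * norm (y - u)"
      proof (rule mult_right_mono)
        have "(2 * C0 + 1) * norm (y - u) \<le> e"
          using y C0 by (simp add: d_def pos_less_divide_eq mult.commute)
        then show "2 * C0 * norm (y - u) \<le> e" by (simp add: distrib_right) (smt (verit) norm_ge_zero)
      qed simp
      finally show ?thesis .
    qed
    moreover have "d > 0" using u e C0 by (simp add: d_def)
    ultimately show "\<exists>d>0. \<forall>y. norm (y - u) < d \<longrightarrow> norm (F y - F u - X (y - u) (F u)) \<le> e * norm (y - u)"
      by blast
  qed
  have FW: "F ` ball 0 r \<subseteq> W" using F1 R(2) by (fastforce simp: subset_iff)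
  \<comment> \<open>Bootstrapping: the partial derivatives of F are \<open>Y i (F u)\<close>, of
    class C^k as soon as F is.\<close>
  have "Ck_on k (ball 0 r) F" for k
  proof (induction k)
    case 0
    then show ?case
      using der by (auto intro!: continuous_at_imp_continuous_on has_derivative_continuous)
  next
    case (Suc k)
    have "Ck_on k (ball 0 r) (\<lambda>u. X i (F u))" if i: "i \<in> Basis" for i
    proof -
      have "X i p = Y i p" for p
      proof -
        have "X i p = (\<Sum>j\<in>Basis. if j = i then Y j p else 0)"
          unfolding X_def by (intro sum.cong refl) (auto simp: inner_Basis i)
        then show ?thesis using i by simp
      qed
      moreover have "Ck_on k (ball 0 r) (\<lambda>u. Y i (F u))"
        using Y[OF i] by (intro Ck_on_compose[OF open_ball W(1) FW _ Suc]) (simp add: smooth_on_def)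
      ultimately show ?thesis by simp
    qed
    then show ?case by (intro Ck_on_SucI[OF open_ball der])
  qed
  then show thesis
    by (intro that[OF r F0 FW]) (use der in \<open>auto simp: smooth_on_def X_def\<close>)
qed

section \<open>Charts and tangent spaces\<close>

locale smooth_manifold =
  fixes A :: "('a::{t2_space, second_countable_topology}, 'e::euclidean_space) chart set"
  assumes atlas: "smooth_atlas A"
begin

abbreviation cimg :: "('a, 'e) chart \<Rightarrow> 'e set"
  where "cimg c \<equiv> cmap c ` cdom c"

lemma
  assumes "c \<in> A"
  shows open_cdom: "open (cdom c)" and open_cimg: "open (cimg c)"
    and homeo: "homeomorphism (cdom c) (cimg c) (cmap c) (cinv c)"
  using atlas assms unfolding smooth_atlas_def is_chart_def by blast+

lemma chart_at: obtains c where "c \<in> A" "z \<in> cdom c"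
  using atlas unfolding smooth_atlas_def by blast

lemma cinv_cmap: "c \<in> A \<Longrightarrow> z \<in> cdom c \<Longrightarrow> cinv c (cmap c z) = z"
  using homeo[of c] homeomorphism_apply1 by blast

lemma cmap_cinv: "c \<in> A \<Longrightarrow> x \<in> cimg c \<Longrightarrow> cmap c (cinv c x) = x"
  using homeo[of c] homeomorphism_apply2 by blast

lemma cinv_in: "c \<in> A \<Longrightarrow> x \<in> cimg c \<Longrightarrow> cinv c x \<in> cdom c"
  using cinv_cmap[of c] by auto

lemma open_cmap_image:
  assumes "c \<in> A" "open W" shows "open (cmap c ` (cdom c \<inter> W))"
proof -
  have "open (cimg c \<inter> cinv c -` W)"
    using homeo[OF assms(1)] open_cimg[OF assms(1)] assms(2)
    by (intro continuous_open_preimage) (auto simp: homeomorphism_def)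
  also have "cimg c \<inter> cinv c -` W = cmap c ` (cdom c \<inter> W)"
    using cinv_cmap[OF assms(1)] by auto
  finally show ?thesis .
qed

abbreviation TM :: "'a \<Rightarrow> ('a, 'e) tvec set"
  where "TM z \<equiv> tangent_space A z"

abbreviation coord :: "('a, 'e) chart \<Rightarrow> 'e \<Rightarrow> 'e \<Rightarrow> ('a, 'e) tvec"
  where "coord \<equiv> coord_field A"

section \<open>Transition Jacobians and tangent vectors\<close>

definition jac :: "('a, 'e) chart \<Rightarrow> ('a, 'e) chart \<Rightarrow> 'a \<Rightarrow> 'e \<Rightarrow> 'e"
  where "jac c d z = fderiv (cmap d \<circ> cinv c) (cmap c z)"

lemma transition_smooth:
  "c \<in> A \<Longrightarrow> d \<in> A \<Longrightarrow> smooth_on (cmap c ` (cdom c \<inter> cdom d)) (cmap d \<circ> cinv c)"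
  using atlas unfolding smooth_atlas_def by blast

lemma jac_has_derivative:
  "c \<in> A \<Longrightarrow> d \<in> A \<Longrightarrow> z \<in> cdom c \<inter> cdom d \<Longrightarrow>
    (cmap d \<circ> cinv c has_derivative jac c d z) (at (cmap c z))"
  unfolding jac_def by (rule smooth_on_has_derivative[OF transition_smooth]) auto

lemma jac_linear: "c \<in> A \<Longrightarrow> d \<in> A \<Longrightarrow> z \<in> cdom c \<inter> cdom d \<Longrightarrow> linear (jac c d z)"
  using jac_has_derivative has_derivative_linear by blast

lemma jac_trans:
  assumes "c \<in> A" "d \<in> A" "e \<in> A" "z \<in> cdom c" "z \<in> cdom d" "z \<in> cdom e"
  shows "jac d e z (jac c d z v) = jac c e z v"
proof -
  have "(cmap e \<circ> cinv d has_derivative jac d e z) (at ((cmap d \<circ> cinv c) (cmap c z)))"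
    using jac_has_derivative[of d e z] assms by (simp add: cinv_cmap)
  from diff_chain_at[OF jac_has_derivative this] assms
  have "(((cmap e \<circ> cinv d) \<circ> (cmap d \<circ> cinv c)) has_derivative (jac d e z \<circ> jac c d z)) (at (cmap c z))"
    by (simp add: comp_def)
  then have "((cmap e \<circ> cinv c) has_derivative (jac d e z \<circ> jac c d z)) (at (cmap c z))"
    by (rule has_derivative_transform_within_open[OF _ open_cmap_image[OF assms(1) open_cdom[OF assms(2)]]])
      (use assms in \<open>auto simp: cinv_cmap\<close>)
  from has_derivative_unique[OF this jac_has_derivative[of c e z]]
  show ?thesis using assms by (auto simp: fun_eq_iff)
qed

lemma jac_self:
  assumes "c \<in> A" "z \<in> cdom c" shows "jac c c z v = v"
proof -
  have "((\<lambda>x. x) has_derivative (\<lambda>v. v)) (at (cmap c z))" by simp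
  then have "((cmap c \<circ> cinv c) has_derivative (\<lambda>v. v)) (at (cmap c z))"
    by (rule has_derivative_transform_within_open[OF _ open_cimg[OF assms(1)]])
      (use assms in \<open>auto simp: cinv_cmap\<close>)
  from has_derivative_unique[OF this jac_has_derivative[of c c z]]
  show ?thesis using assms by (metis IntI)
qed

lemma tangent_space_iff:
  "v \<in> TM z \<longleftrightarrow> (\<forall>c. \<not> (c \<in> A \<and> z \<in> cdom c) \<longrightarrow> v c = 0) \<and>
    (\<forall>c\<in>A. \<forall>d\<in>A. z \<in> cdom c \<inter> cdom d \<longrightarrow> v d = jac c d z (v c))"
  by (simp add: tangent_space_def jac_def)

lemma tangentI:
  assumes "\<And>c. \<not> (c \<in> A \<and> z \<in> cdom c) \<Longrightarrow> v c = 0"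
    and "\<And>c d. c \<in> A \<Longrightarrow> d \<in> A \<Longrightarrow> z \<in> cdom c \<Longrightarrow> z \<in> cdom d \<Longrightarrow> v d = jac c d z (v c)"
  shows "v \<in> TM z"
  unfolding tangent_space_iff using assms by blast

lemma tangent_eq_0: "v \<in> TM z \<Longrightarrow> \<not> (c \<in> A \<and> z \<in> cdom c) \<Longrightarrow> v c = 0"
  unfolding tangent_space_iff by blast

lemma tangent_jac:
  "v \<in> TM z \<Longrightarrow> c \<in> A \<Longrightarrow> d \<in> A \<Longrightarrow> z \<in> cdom c \<Longrightarrow> z \<in> cdom d \<Longrightarrow> jac c d z (v c) = v d"
  unfolding tangent_space_iff by (metis IntI)

lemmas tangentD = tangent_eq_0 tangent_jac

lemma subspace_tangent_space: "subspace (TM z)"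
proof (rule subspaceI)
  show "0 \<in> TM z"
    by (rule tangentI) (simp_all add: linear_0[OF jac_linear])
  show "v + w \<in> TM z" if "v \<in> TM z" "w \<in> TM z" for v w
    by (rule tangentI) (simp_all add: linear_add[OF jac_linear] tangentD[OF that(1)] tangentD[OF that(2)])
  show "r *\<^sub>R v \<in> TM z" if "v \<in> TM z" for v r
    by (rule tangentI) (simp_all add: scaleR_fun_def linear_scale[OF jac_linear] tangentD[OF that])
qed

lemma coord_field_eq:
  assumes "c \<in> A" "z \<in> cdom c"
  shows "coord c a (cmap c z) = (\<lambda>d. if d \<in> A \<and> z \<in> cdom d then jac c d z a else 0)"
  unfolding coord_field_def differential_def cinv_cmap[OF assms] jac_def ..

lemma coord_field_self: "c \<in> A \<Longrightarrow> z \<in> cdom c \<Longrightarrow> coord c a (cmap c z) c = a"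
  by (simp add: coord_field_eq jac_self)

lemma coord_field_in:
  assumes "c \<in> A" "z \<in> cdom c" shows "coord c a (cmap c z) \<in> TM z"
  unfolding coord_field_eq[OF assms]
  by (rule tangentI) (use assms in \<open>auto simp: jac_trans\<close>)

lemma coord_field_in':
  "c \<in> A \<Longrightarrow> x \<in> cimg c \<Longrightarrow> coord c a x \<in> TM (cinv c x)"
  using coord_field_in[of c] cinv_cmap[of c] by auto

lemma coord_field_self': "c \<in> A \<Longrightarrow> x \<in> cimg c \<Longrightarrow> coord c a x c = a"
  using coord_field_self[of c] by auto

lemma tangent_eqI:
  assumes "c \<in> A" "z \<in> cdom c" "v \<in> TM z" "w \<in> TM z" "v c = w c"
  shows "v = w"
proof
  fix d show "v d = w d"
    using tangentD[OF assms(3)] tangentD[OF assms(4)] assms(1,2,5)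
    by (cases "d \<in> A \<and> z \<in> cdom d") metis+
qed

lemma coord_field_of:
  assumes "c \<in> A" "z \<in> cdom c" "v \<in> TM z"
  shows "coord c (v c) (cmap c z) = v"
  by (rule tangent_eqI[OF assms(1,2) coord_field_in assms(3)]) (use assms in \<open>auto simp: coord_field_self\<close>)

lemma coord_field_linear:
  assumes "c \<in> A" "x \<in> cimg c" shows "linear (\<lambda>a. coord c a x)"
proof -
  obtain z where z: "z \<in> cdom c" "x = cmap c z" using assms by blast
  note T = coord_field_in[OF assms(1) z(1)] and S = subspace_tangent_space[of z]
  show ?thesis unfolding z(2)
  proof (rule linearI; rule tangent_eqI[OF assms(1) z(1) T])
    show "coord c a (cmap c z) + coord c b (cmap c z) \<in> TM z" for a b
      by (intro subspace_add[OF S] T)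
    show "r *\<^sub>R coord c b (cmap c z) \<in> TM z" for r b
      by (intro subspace_scale[OF S] T)
  qed (use assms z(1) in \<open>simp_all add: coord_field_self scaleR_fun_def\<close>)
qed

lemma dim_tangent_space: "dim (TM z) = DIM('e)"
proof -
  obtain c where c: "c \<in> A" "z \<in> cdom c" by (rule chart_at)
  let ?L = "\<lambda>a. coord c a (cmap c z)"
  have L: "linear ?L" using c by (intro coord_field_linear) auto
  have "inj ?L" by (rule inj_on_inverseI[of _ "\<lambda>v. v c"]) (rule coord_field_self[OF c])
  then have "dim (range ?L) = dim (UNIV :: 'e set)"
    using L by (intro dim_image_eq) (auto simp: inj_on_def)
  moreover have "range ?L = TM z"
  proof
    show "range ?L \<subseteq> TM z" using coord_field_in[OF c] by blast
    show "TM z \<subseteq> range ?L" 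
    proof
      fix v assume "v \<in> TM z"
      then show "v \<in> range ?L" using rangeI[of ?L "v c"] coord_field_of[OF c] by simp
    qed
  qed
  ultimately show ?thesis by simp
qed

section \<open>Bilinear fields, vector fields and maps in charts\<close>

definition bilinear_field :: "('a \<Rightarrow> ('a, 'e) bilin) \<Rightarrow> bool"
  where "bilinear_field B \<longleftrightarrow>
    (\<forall>z. \<forall>u\<in>TM z. \<forall>v\<in>TM z. \<forall>w\<in>TM z. \<forall>r s.
      B z (r *\<^sub>R u + s *\<^sub>R v) w = r * B z u w + s * B z v w \<and>
      B z w (r *\<^sub>R u + s *\<^sub>R v) = r * B z w u + s * B z w v)"

lemma smooth_bilinear_field_iff:
  "smooth_bilinear_field A B \<longleftrightarrow> bilinear_field B \<and>
    (\<forall>c\<in>A. \<forall>i\<in>Basis. \<forall>j\<in>Basis. smooth_on (cimg c) (component A B c i j))"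
  by (simp add: smooth_bilinear_field_def bilinear_field_def)

lemma component_bilinear:
  assumes "bilinear_field B" "c \<in> A" "x \<in> cimg c"
  shows "bilinear (\<lambda>i j. component A B c i j x)"
proof -
  have in_T: "coord c a x \<in> TM (cinv c x)" for a
    by (rule coord_field_in'[OF assms(2,3)])
  note lin = coord_field_linear[OF assms(2,3)]
  have B: "B (cinv c x) (r *\<^sub>R u + s *\<^sub>R v) w = r * B (cinv c x) u w + s * B (cinv c x) v w"
    "B (cinv c x) w (r *\<^sub>R u + s *\<^sub>R v) = r * B (cinv c x) w u + s * B (cinv c x) w v"
    if "u \<in> TM (cinv c x)" "v \<in> TM (cinv c x)" "w \<in> TM (cinv c x)"
    for u v w r s
    using assms(1) that unfolding bilinear_field_def by blast+
  have B1: "B (cinv c x) (coord c (r *\<^sub>R a + s *\<^sub>R b) x) w = 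
      r * B (cinv c x) (coord c a x) w + s * B (cinv c x) (coord c b x) w"
    "B (cinv c x) w (coord c (r *\<^sub>R a + s *\<^sub>R b) x) = 
      r * B (cinv c x) w (coord c a x) + s * B (cinv c x) w (coord c b x)"
    if "w \<in> TM (cinv c x)" for w r s a b
    using B[OF in_T in_T that] by (simp_all add: linear_add[OF lin] linear_scale[OF lin])
  show ?thesis
    unfolding bilinear_def component_def
    using B1[of _ 1 _ 1, OF in_T] B1[of _ _ _ 0 0, OF in_T]
    by (auto intro!: linearI)
qed

lemma bilin_eq_component:
  assumes "c \<in> A" "z \<in> cdom c" "v \<in> TM z" "w \<in> TM z"
  shows "B z v w = component A B c (v c) (w c) (cmap c z)"
  by (simp add: component_def coord_field_of assms cinv_cmap)

text \<open>The definition gives smoothness for constant basis arguments; bilinear expansion extends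
  it to arguments that vary smoothly, such as J applied to a coordinate field.\<close>

lemma component_smooth:
  assumes "smooth_bilinear_field A B" "c \<in> A" "open S" "S \<subseteq> cimg c" "smooth_on S v" "smooth_on S w"
  shows "smooth_on S (\<lambda>x. component A B c (v x) (w x) x)"
proof -
  have B: "bilinear_field B" "\<And>i j. i \<in> Basis \<Longrightarrow> j \<in> Basis \<Longrightarrow> smooth_on (cimg c) (component A B c i j)"
    using assms(1,2) by (auto simp: smooth_bilinear_field_iff)
  have eq: "component A B c (v x) (w x) x =
     (\<Sum>i\<in>Basis. \<Sum>j\<in>Basis. (v x \<bullet> i) * (w x \<bullet> j) * component A B c i j x)" if "x \<in> S" for x
  proof -
    interpret bl: bounded_bilinear "\<lambda>i j. component A B c i j x"
      using component_bilinear[OF B(1) assms(2)] that assms(4) bilinear_conv_bounded_bilinear by blast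
    have "component A B c (v x) (w x) x =
      component A B c (\<Sum>i\<in>Basis. (v x \<bullet> i) *\<^sub>R i) (\<Sum>j\<in>Basis. (w x \<bullet> j) *\<^sub>R j) x"
      by (simp add: euclidean_representation)
    also have "\<dots> = (\<Sum>i\<in>Basis. \<Sum>j\<in>Basis. (v x \<bullet> i) * (w x \<bullet> j) * component A B c i j x)"
      by (simp only: bl.sum_left bl.sum_right bl.scaleR_left bl.scaleR_right)
        (subst sum.swap, simp add: sum_distrib_left mult_ac)
    finally show ?thesis .
  qed
  have "smooth_on S (\<lambda>x. \<Sum>i\<in>Basis. \<Sum>j\<in>Basis. (v x \<bullet> i) * (w x \<bullet> j) * component A B c i j x)"
    by (intro smooth_on_sum smooth_on_mult smooth_on_inner smooth_on_const assms)
      (use smooth_on_subset[OF B(2) assms(4)] in simp)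
  then show ?thesis by (rule smooth_on_cong[OF assms(3), rotated]) (simp add: eq)
qed

lemma component_smooth_const:
  assumes "smooth_bilinear_field A B" "c \<in> A"
  shows "smooth_on (cimg c) (component A B c i j)"
  using component_smooth[OF assms open_cimg[OF assms(2)] subset_refl smooth_on_const smooth_on_const] .

text \<open>In another chart the components are the transition Jacobian applied to \<xi>; expanded
  in the basis, this is a sum of products of smooth functions composed with the transition
  map.\<close>

lemma smooth_vector_field_of_chart:
  assumes c: "c \<in> A" and W: "open W" "W \<subseteq> cdom c" and \<xi>: "smooth_on (cmap c ` W) \<xi>"
  shows "smooth_vector_field_on A W (\<lambda>z. coord c (\<xi> (cmap c z)) (cmap c z))"
  unfolding smooth_vector_field_on_def
proof (intro conjI ballI)
  show "coord c (\<xi> (cmap c z)) (cmap c z) \<in> TM z" if "z \<in> W" for z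
    using that W by (intro coord_field_in c) auto
  fix d assume d: "d \<in> A"
  let ?S = "cmap d ` (cdom d \<inter> W)" and ?\<tau> = "cmap c \<circ> cinv d"
  let ?D = "\<lambda>x b. fderiv (cmap d \<circ> cinv c) x b"
  have S: "open ?S" by (rule open_cmap_image[OF d W(1)])
  have \<tau>: "smooth_on ?S ?\<tau>"
    by (rule smooth_on_subset[OF transition_smooth[OF d c]]) (use W in auto)
  have oW: "open (cmap c ` W)" using open_cmap_image[OF c W(1)] W(2) by (simp add: Int_absorb1)
  have Dsm: "smooth_on (cmap c ` (cdom c \<inter> cdom d)) (\<lambda>x. ?D x b)" for b
    by (intro smooth_on_frechet_derivative transition_smooth open_cmap_image open_cdom c d)
  have "smooth_on ?S (\<lambda>y. \<Sum>b\<in>Basis. (\<xi> (?\<tau> y) \<bullet> b) *\<^sub>R ?D (?\<tau> y) b)"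
  proof (intro smooth_on_sum S smooth_on_scaleR smooth_on_inner smooth_on_const)
    show "smooth_on ?S (\<lambda>y. \<xi> (?\<tau> y))"
      by (rule smooth_on_compose[OF S oW _ \<xi> \<tau>]) (use W d in \<open>auto simp: cinv_cmap\<close>)
    show "smooth_on ?S (\<lambda>y. ?D (?\<tau> y) b)" for b
      by (rule smooth_on_compose[OF S open_cmap_image[OF c open_cdom[OF d]] _ Dsm \<tau>])
        (use W d in \<open>auto simp: cinv_cmap\<close>)
  qed
  then show "smooth_on ?S (\<lambda>x. coord c (\<xi> (cmap c (cinv d x))) (cmap c (cinv d x)) d)"
  proof (rule smooth_on_cong[OF S, rotated])
    fix y assume "y \<in> ?S"
    then obtain z where z: "z \<in> cdom d" "z \<in> cdom c" "y = cmap d z" using W by auto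
    have "jac c d z (\<xi> (cmap c z)) = (\<Sum>b\<in>Basis. (\<xi> (cmap c z) \<bullet> b) *\<^sub>R jac c d z b)"
      by (rule has_derivative_basis_sum[OF jac_has_derivative]) (use z c d in auto)
    then show "(\<Sum>b\<in>Basis. (\<xi> (?\<tau> y) \<bullet> b) *\<^sub>R ?D (?\<tau> y) b) =
        coord c (\<xi> (cmap c (cinv d y))) (cmap c (cinv d y)) d"
      using z c d by (simp add: cinv_cmap coord_field_eq jac_def)
  qed
qed

lemma smooth_map_into_of_chart:
  fixes F :: "'b::euclidean_space \<Rightarrow> 'e"
  assumes c: "c \<in> A" and U: "open U" and F: "smooth_on U F" "F ` U \<subseteq> cimg c"
  shows "smooth_map_into A U (cinv c \<circ> F)"
    and "u \<in> U \<Longrightarrow> differential A (cinv c \<circ> F) u a = coord c (fderiv F u a) (F u)"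
proof -
  note Fc = smooth_on_imp_continuous_on[OF F(1)]
  have cont: "continuous_on U (cinv c \<circ> F)"
    using homeo[OF c] F(2) by (intro continuous_on_compose Fc) (auto simp: homeomorphism_def intro: continuous_on_subset)
  have "smooth_on (U \<inter> (cinv c \<circ> F) -` cdom d) (cmap d \<circ> (cinv c \<circ> F))" if d: "d \<in> A" for d
  proof -
    have "smooth_on (U \<inter> (cinv c \<circ> F) -` cdom d) (\<lambda>x. (cmap d \<circ> cinv c) (F x))"
    proof (rule smooth_on_compose[OF _ open_cmap_image[OF c open_cdom[OF d]] _ transition_smooth[OF c d]])
      show "open (U \<inter> (cinv c \<circ> F) -` cdom d)"
        by (rule continuous_open_preimage[OF cont U open_cdom[OF d]])
      show "F ` (U \<inter> (cinv c \<circ> F) -` cdom d) \<subseteq> cmap c ` (cdom c \<inter> cdom d)"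
        using F(2) by (fastforce simp: cinv_cmap c)
      show "smooth_on (U \<inter> (cinv c \<circ> F) -` cdom d) F" by (rule smooth_on_subset[OF F(1)]) auto
    qed
    then show ?thesis by (simp add: comp_def)
  qed
  with cont show "smooth_map_into A U (cinv c \<circ> F)" unfolding smooth_map_into_def by blast
  assume u: "u \<in> U"
  then obtain z where z: "z \<in> cdom c" "F u = cmap c z" using F(2) by blast
  show "differential A (cinv c \<circ> F) u a = coord c (fderiv F u a) (F u)"
  proof
    fix d
    have "fderiv (cmap d \<circ> (cinv c \<circ> F)) u a = jac c d z (fderiv F u a)"
      if d: "d \<in> A" "z \<in> cdom d"
    proof -
      have "((cmap d \<circ> cinv c) has_derivative jac c d z) (at (F u))"
        unfolding z(2) by (rule jac_has_derivative) (use c d z in auto)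
      from diff_chain_at[OF smooth_on_has_derivative[OF F(1) u] this]
      have "((cmap d \<circ> (cinv c \<circ> F)) has_derivative (jac c d z \<circ> fderiv F u)) (at u)"
        by (simp add: comp_def)
      from frechet_derivative_at[OF this] show ?thesis by (metis comp_apply)
    qed
    then show "differential A (cinv c \<circ> F) u a d = coord c (fderiv F u a) (F u) d"
      by (simp add: differential_def z(2) coord_field_eq c z(1) cinv_cmap)
  qed
qed

end

section \<open>Linear algebra of Hermitian spaces of real dimension four\<close>

text \<open>An infinite basis has \<open>card\<close> 0, so \<open>dim V > 0\<close> makes V
  finite-dimensional inside a space that may be infinite-dimensional; a vector outside the span
  would then enlarge B beyond \<open>dim V\<close>.\<close>

lemma subspace_subset_span:
  fixes V :: "'v::real_vector set"
  assumes "independent B" "B \<subseteq> V" "card B = dim V" "dim V > 0"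
  shows "V \<subseteq> span B"
proof
  fix v assume v: "v \<in> V"
  show "v \<in> span B"
  proof (rule ccontr)
    assume n: "v \<notin> span B"
    then have i: "independent (insert v B)" using assms(1) by (simp add: independent_insert)
    obtain C where C: "independent C" "V \<subseteq> span C" "card C = dim V" by (rule basis_exists[of V])
    have "finite C" using C(3) assms(4) card.infinite by fastforce
    then have "card (insert v B) \<le> dim V"
      using independent_span_bound[OF _ i, of C] C assms(2) v by auto
    moreover have "v \<notin> B" using n span_base by blast
    moreover have "finite B" using assms(3,4) card.infinite by fastforce
    ultimately show False using assms(3) by simp
  qed
qed

lemma linear_range_span:
  fixes M :: "'b::euclidean_space \<Rightarrow> 'v::real_vector"
  assumes "linear M" "inj M"
  shows "range M = span (M ` Basis)" "independent (M ` Basis)" "card (M ` Basis) = DIM('b)"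
proof -
  show "range M = span (M ` Basis)" using linear_span_image[OF assms(1), of Basis] by simp
  show "independent (M ` Basis)"
    by (rule linear_independent_injective_image[OF assms(1) independent_Basis])
      (use assms(2) in \<open>auto intro: inj_on_subset\<close>)
  show "card (M ` Basis) = DIM('b)" by (rule card_image) (use assms(2) in \<open>auto intro: inj_on_subset\<close>)
qed

lemma Basis_real_2: "Basis = {axis 1 1, axis 2 (1::real) :: real^2}"
  unfolding Basis_vec_def UNIV_2 by auto

lemma det_4:
  "det (A::real^4^4) =
    A$1$1 * (A$2$2 * (A$3$3 * A$4$4 - A$3$4 * A$4$3) - A$2$3 * (A$3$2 * A$4$4 - A$3$4 * A$4$2) + A$2$4 * (A$3$2 * A$4$3 - A$3$3 * A$4$2))
    - A$1$2 * (A$2$1 * (A$3$3 * A$4$4 - A$3$4 * A$4$3) - A$2$3 * (A$3$1 * A$4$4 - A$3$4 * A$4$1) + A$2$4 * (A$3$1 * A$4$3 - A$3$3 * A$4$1))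
    + A$1$3 * (A$2$1 * (A$3$2 * A$4$4 - A$3$4 * A$4$2) - A$2$2 * (A$3$1 * A$4$4 - A$3$4 * A$4$1) + A$2$4 * (A$3$1 * A$4$2 - A$3$2 * A$4$1))
    - A$1$4 * (A$2$1 * (A$3$2 * A$4$3 - A$3$3 * A$4$2) - A$2$2 * (A$3$1 * A$4$3 - A$3$3 * A$4$1) + A$2$3 * (A$3$1 * A$4$2 - A$3$2 * A$4$1))"
proof -
  have f: "finite {2::4, 3, 4}" "1 \<notin> {2::4, 3, 4}" "finite {3::4, 4}" "2 \<notin> {3::4, 4}"
    "finite {4::4}" "3 \<notin> {4::4}" by auto
  show ?thesis
    unfolding det_def UNIV_4 sum_over_permutations_insert[OF f(1,2)]
      sum_over_permutations_insert[OF f(3,4)] sum_over_permutations_insert[OF f(5,6)] permutes_sing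
    by (simp add: sign_swap_id permutation_swap_id permutation_compose sign_compose sign_id swap_id_eq algebra_simps)
qed

lemma vector_4 [simp]:
  "(vector [x,y,z,w] :: ('a::zero)^4)$1 = x" "(vector [x,y,z,w] :: ('a::zero)^4)$2 = y"
  "(vector [x,y,z,w] :: ('a::zero)^4)$3 = z" "(vector [x,y,z,w] :: ('a::zero)^4)$4 = w"
  unfolding vector_def by simp_all

lemma span_4E:
  assumes "x \<in> span {a, b, c, d}"
  obtains k1 k2 k3 k4 where "x = k1 *\<^sub>R a + k2 *\<^sub>R b + k3 *\<^sub>R c + k4 *\<^sub>R d"
proof -
  obtain k1 k2 k3 where "x - k1 *\<^sub>R a - k2 *\<^sub>R b - k3 *\<^sub>R c \<in> span {d}"
    using assms unfolding span_insert[of a] span_insert[of b] span_insert[of c] by blast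
  then obtain k4 where "x - k1 *\<^sub>R a - k2 *\<^sub>R b - k3 *\<^sub>R c = k4 *\<^sub>R d"
    by (auto simp: span_singleton)
  then show thesis by (intro that[of k1 k2 k3 k4]) (simp add: algebra_simps)
qed

section \<open>Inner products and complex structures on subspaces\<close>

definition bilinear_over :: "'v::real_vector set \<Rightarrow> ('v \<Rightarrow> 'v \<Rightarrow> real) \<Rightarrow> bool"
  where "bilinear_over T B \<longleftrightarrow> (\<forall>u\<in>T. \<forall>v\<in>T. \<forall>w\<in>T. \<forall>r s.
    B (r *\<^sub>R u + s *\<^sub>R v) w = r * B u w + s * B v w \<and>
    B w (r *\<^sub>R u + s *\<^sub>R v) = r * B w u + s * B w v)"

lemma bilinear_over_add:
  assumes "bilinear_over T B" "u \<in> T" "v \<in> T" "w \<in> T"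
  shows "B (u + v) w = B u w + B v w" "B w (u + v) = B w u + B w v"
proof -
  have "B (1 *\<^sub>R u + 1 *\<^sub>R v) w = 1 * B u w + 1 * B v w \<and> B w (1 *\<^sub>R u + 1 *\<^sub>R v) = 1 * B w u + 1 * B w v"
    using assms unfolding bilinear_over_def by blast
  then show "B (u + v) w = B u w + B v w" "B w (u + v) = B w u + B w v" by simp_all
qed

lemma bilinear_over_scale:
  assumes "bilinear_over T B" "u \<in> T" "w \<in> T"
  shows "B (r *\<^sub>R u) w = r * B u w" "B w (r *\<^sub>R u) = r * B w u"
proof -
  have "B (r *\<^sub>R u + 0 *\<^sub>R u) w = r * B u w + 0 * B u w \<and> B w (r *\<^sub>R u + 0 *\<^sub>R u) = r * B w u + 0 * B w u"
    using assms unfolding bilinear_over_def by blast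
  then show "B (r *\<^sub>R u) w = r * B u w" "B w (r *\<^sub>R u) = r * B w u" by simp_all
qed

lemmas bilinear_overD = bilinear_over_add bilinear_over_scale

locale inner_subspace =
  fixes T :: "'v::real_vector set" and g :: "'v \<Rightarrow> 'v \<Rightarrow> real"
  assumes subspace_T: "subspace T" and g_bilinear: "bilinear_over T g"
    and g_sym: "v \<in> T \<Longrightarrow> w \<in> T \<Longrightarrow> g v w = g w v"
    and g_pos: "v \<in> T \<Longrightarrow> v \<noteq> 0 \<Longrightarrow> g v v > 0"
begin

lemmas T_closed = subspace_0[OF subspace_T] subspace_add[OF subspace_T] subspace_scale[OF subspace_T]
  subspace_diff[OF subspace_T]

lemma sum_in_T: "(\<And>i. i \<in> I \<Longrightarrow> f i \<in> T) \<Longrightarrow> sum f I \<in> T"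
  by (rule subspace_sum[OF subspace_T])

lemma bilinear_0:
  assumes "bilinear_over T B" "w \<in> T" shows "B 0 w = 0" "B w 0 = 0"
  using bilinear_over_scale[OF assms(1) T_closed(1) assms(2), of 0] by simp_all

lemma bilinear_diff:
  assumes "bilinear_over T B" "u \<in> T" "v \<in> T" "w \<in> T"
  shows "B (u - v) w = B u w - B v w" "B w (u - v) = B w u - B w v"
proof -
  have "- v \<in> T" using T_closed(3)[OF assms(3), of "-1"] by simp
  then show "B (u - v) w = B u w - B v w" "B w (u - v) = B w u - B w v"
    using bilinear_overD(1,2)[OF assms(1,2) _ assms(4), of "- v"]
      bilinear_over_scale[OF assms(1,3,4), of "-1"] by simp_all
qed

lemma bilinear_sum_left:
  assumes "bilinear_over T B" "finite I" "\<And>i. i \<in> I \<Longrightarrow> f i \<in> T" "w \<in> T"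
  shows "B (\<Sum>i\<in>I. r i *\<^sub>R f i) w = (\<Sum>i\<in>I. r i * B (f i) w)"
  using assms(2,3)
proof (induction I rule: finite_induct)
  case empty
  show ?case by (simp add: bilinear_0[OF assms(1,4)])
next
  case (insert i I)
  then have "(\<Sum>i\<in>I. r i *\<^sub>R f i) \<in> T" "r i *\<^sub>R f i \<in> T" by (auto intro!: sum_in_T T_closed)
  then show ?case
    using insert bilinear_overD(1)[OF assms(1), of "r i *\<^sub>R f i" "\<Sum>i\<in>I. r i *\<^sub>R f i" w]
      bilinear_over_scale(1)[OF assms(1), of "f i" w] assms(4) by simp
qed

lemma bilinear_sum_right:
  assumes "bilinear_over T B" "finite I" "\<And>i. i \<in> I \<Longrightarrow> f i \<in> T" "w \<in> T"
  shows "B w (\<Sum>i\<in>I. r i *\<^sub>R f i) = (\<Sum>i\<in>I. r i * B w (f i))"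
proof -
  have "bilinear_over T (\<lambda>x y. B y x)" using assms(1) by (auto simp: bilinear_over_def)
  from bilinear_sum_left[OF this assms(2-4)] show ?thesis .
qed

lemma g_definite: "v \<in> T \<Longrightarrow> g v v = 0 \<longleftrightarrow> v = 0"
  using g_pos[of v] bilinear_0(1)[OF g_bilinear T_closed(1)] by fastforce

lemma orthogonal_independent:
  assumes "finite S" "S \<subseteq> T" "0 \<notin> S" "\<And>v w. v \<in> S \<Longrightarrow> w \<in> S \<Longrightarrow> v \<noteq> w \<Longrightarrow> g v w = 0"
  shows "independent S"
proof
  assume "dependent S"
  then obtain u v where u: "v \<in> S" "u v \<noteq> 0" "(\<Sum>v\<in>S. u v *\<^sub>R v) = 0"
    unfolding dependent_finite[OF assms(1)] by blast
  then have "0 = g (\<Sum>v\<in>S. u v *\<^sub>R v) v" using assms(2) bilinear_0(1)[OF g_bilinear] by auto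
  also have "\<dots> = (\<Sum>w\<in>S. u w * g w v)"
    using u assms(1,2) by (intro bilinear_sum_left g_bilinear) auto
  also have "\<dots> = (\<Sum>w\<in>S. if w = v then u v * g v v else 0)"
    using assms(4) u(1) by (intro sum.cong) auto
  also have "\<dots> = u v * g v v" using assms(1) u(1) by simp
  finally show False using u assms(2,3) g_definite[of v] by auto
qed

text \<open>A nonzero remainder would be orthogonal to the whole frame and hence yield one
  independent vector too many.\<close>

lemma orthonormal_expansion:
  fixes e :: "'v ^ 'n"
  assumes e: "\<And>i. e $ i \<in> T" "\<And>i j. g (e $ i) (e $ j) = (if i = j then 1 else 0)"
    and dim: "dim T = CARD('n)" and v: "v \<in> T"
  shows "v = (\<Sum>i\<in>UNIV. g v (e $ i) *\<^sub>R e $ i)"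
proof (rule ccontr)
  define w where "w = v - (\<Sum>i\<in>UNIV. g v (e $ i) *\<^sub>R e $ i)"
  assume "v \<noteq> (\<Sum>i\<in>UNIV. g v (e $ i) *\<^sub>R e $ i)"
  then have w0: "w \<noteq> 0" by (simp add: w_def)
  have s: "(\<Sum>i\<in>UNIV. g v (e $ i) *\<^sub>R e $ i) \<in> T" by (intro sum_in_T T_closed e)
  have wT: "w \<in> T" unfolding w_def by (intro T_closed v s)
  have we: "g w (e $ j) = 0" for j
  proof -
    have "g (\<Sum>i\<in>UNIV. g v (e $ i) *\<^sub>R e $ i) (e $ j) = (\<Sum>i\<in>UNIV. g v (e $ i) * g (e $ i) (e $ j))"
      by (intro bilinear_sum_left g_bilinear e) auto
    also have "\<dots> = (\<Sum>i\<in>UNIV. if i = j then g v (e $ j) else 0)"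
      by (intro sum.cong) (auto simp: e(2))
    finally show ?thesis unfolding w_def by (simp add: bilinear_diff[OF g_bilinear v s e(1)])
  qed
  have e0: "e $ i \<noteq> 0" for i using e(2)[of i i] bilinear_0(1)[OF g_bilinear T_closed(1)] by auto
  have inj: "inj (($) e)" by (rule injI) (metis e(2) zero_neq_one)
  have wn: "w \<notin> range (($) e)" using we e(2) by (metis imageE zero_neq_one)
  have "independent (insert w (range (($) e)))"
  proof (rule orthogonal_independent)
    fix a b assume "a \<in> insert w (range (($) e))" "b \<in> insert w (range (($) e))" "a \<noteq> b"
    then show "g a b = 0" using we e(2) g_sym[OF wT e(1)] by (auto split: if_splits)
  qed (use e(1) e0 w0 wT in auto)
  moreover obtain B where B: "independent B" "T \<subseteq> span B" "card B = dim T"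
    by (rule basis_exists[of T])
  moreover have "finite B" using B(3) dim card.infinite by fastforce
  ultimately have "card (insert w (range (($) e))) \<le> CARD('n)"
    using independent_span_bound[of B "insert w (range (($) e))"] e(1) wT dim by auto
  moreover have "card (insert w (range (($) e))) = Suc CARD('n)"
    using wn inj by (simp add: card_image)
  ultimately show False by simp
qed

lemma normalize:
  assumes "v \<in> T" "v \<noteq> 0"
  shows "g ((1 / sqrt (g v v)) *\<^sub>R v) ((1 / sqrt (g v v)) *\<^sub>R v) = 1"
  using g_pos[OF assms] assms(1)
  by (simp add: bilinear_over_scale[OF g_bilinear] T_closed field_simps)

lemma mono: "P \<subseteq> T \<Longrightarrow> subspace P \<Longrightarrow> inner_subspace P g"
  using g_bilinear g_sym g_pos by unfold_locales (auto simp: bilinear_over_def subset_iff)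

end

locale hermitian_subspace = inner_subspace T g
  for T :: "'v::real_vector set" and g +
  fixes J :: "'v \<Rightarrow> 'v"
  assumes J_in: "v \<in> T \<Longrightarrow> J v \<in> T" and J_J: "v \<in> T \<Longrightarrow> J (J v) = - v"
    and J_linear: "v \<in> T \<Longrightarrow> w \<in> T \<Longrightarrow> J (r *\<^sub>R v + s *\<^sub>R w) = r *\<^sub>R J v + s *\<^sub>R J w"
    and J_skew: "v \<in> T \<Longrightarrow> w \<in> T \<Longrightarrow> g (J v) w = - g (J w) v"
begin

lemma g_J: "v \<in> T \<Longrightarrow> w \<in> T \<Longrightarrow> g (J v) w = - g v (J w)"
  using J_skew[of v w] g_sym[of "J w" v] J_in by simp

lemma g_neg:
  assumes "v \<in> T" "w \<in> T" shows "g (- v) w = - g v w" "g v (- w) = - g v w"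
  using bilinear_over_scale(1)[OF g_bilinear assms, of "-1"]
    bilinear_over_scale(2)[OF g_bilinear assms(2,1), of "-1"] by simp_all

lemma g_J_J: "v \<in> T \<Longrightarrow> w \<in> T \<Longrightarrow> g (J v) (J w) = g v w"
  using g_J[of v "J w"] J_in J_J[of w] g_neg(2) by simp

lemma g_J_self: "v \<in> T \<Longrightarrow> g (J v) v = 0" "v \<in> T \<Longrightarrow> g v (J v) = 0"
  using J_skew[of v v] g_sym[of v "J v"] J_in by auto

lemma kahler_bilinear: "bilinear_over T (\<lambda>v w. g (J v) w)"
  using g_bilinear unfolding bilinear_over_def by (simp add: J_in J_linear)

lemma J_simple: "v \<in> T \<Longrightarrow> w \<in> T \<Longrightarrow> J (v + w) = J v + J w" "v \<in> T \<Longrightarrow> J (r *\<^sub>R v) = r *\<^sub>R J v"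
  using J_linear[of v w 1 1] J_linear[of v v r 0] by simp_all

lemma mono_J: "P \<subseteq> T \<Longrightarrow> subspace P \<Longrightarrow> J ` P \<subseteq> P \<Longrightarrow> hermitian_subspace P g J"
  unfolding hermitian_subspace_def hermitian_subspace_axioms_def
  by (meson mono J_J J_linear J_skew subsetD image_subset_iff)

end

section \<open>Complex lines and their area forms\<close>

locale hermitian_plane = hermitian_subspace P g J for P :: "('a, 'e::euclidean_space) tvec set" and g J +
  assumes dim_P: "dim P = 2"
begin

lemma unit_vector: obtains p where "p \<in> P" "g p p = 1"
proof -
  have "P \<noteq> {0}" using dim_P dim_le_card[of P "{}"] by auto
  then obtain v where v: "v \<in> P" "v \<noteq> 0" using T_closed(1) by blast
  show thesis by (rule that[OF _ normalize[OF v]]) (intro T_closed v)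
qed

lemma orthonormal_pair:
  assumes "p \<in> P" "g p p = 1"
  shows "(vector [p, J p] :: _ ^ 2) $ i \<in> P"
    "g ((vector [p, J p] :: _ ^ 2) $ i) ((vector [p, J p] :: _ ^ 2) $ j) = (if i = j then 1 else 0)"
proof -
  have "\<forall>i. (vector [p, J p] :: _ ^ 2) $ i \<in> P" 
    "\<forall>i j. g ((vector [p, J p] :: _ ^ 2) $ i) ((vector [p, J p] :: _ ^ 2) $ j) = (if i = j then 1 else 0)"
    using assms by (simp_all add: forall_2 J_in g_J_J g_J_self)
  then show "(vector [p, J p] :: _ ^ 2) $ i \<in> P"
    "g ((vector [p, J p] :: _ ^ 2) $ i) ((vector [p, J p] :: _ ^ 2) $ j) = (if i = j then 1 else 0)"
    by blast+
qed

lemma plane_expansion: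
  assumes "p \<in> P" "g p p = 1" "v \<in> P"
  shows "v = g v p *\<^sub>R p + g v (J p) *\<^sub>R J p"
  using orthonormal_expansion[OF orthonormal_pair[OF assms(1,2)] _ assms(3)] dim_P by (simp add: sum_2)

lemma frame_det_pair:
  assumes p: "p \<in> P" "g p p = 1" and vw: "v \<in> P" "w \<in> P"
  shows "frame_det g (vector [v, w]) (vector [p, J p] :: _ ^ 2) = g (J v) w"
proof -
  have "g (J v) w = g w p * g (J v) p + g w (J p) * g (J v) (J p)"
    by (subst plane_expansion[OF p vw(2)])
      (simp add: bilinear_overD[OF g_bilinear] T_closed J_in p vw)
  also have "\<dots> = g v p * g w (J p) - g v (J p) * g w p"
    by (simp add: g_J[OF vw(1) p(1)] g_J_J[OF vw(1) p(1)])
  finally show ?thesis by (simp add: frame_det_def det_2)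
qed

text \<open>The area form refers to an unknown oriented frame e. In a complex line its second vector
  is a multiple c of J applied to the first by orthogonality, with c^2 = 1 by length and c > 0 by
  orientation, so the frame has the shape to which \<open>frame_det_pair\<close> applies.\<close>

lemma area_form_eq_kahler:
  assumes vw: "v \<in> P" "w \<in> P"
  shows "area_form g J P v w = g (J v) w"
proof -
  obtain p where p: "p \<in> P" "g p p = 1" by (rule unit_vector)
  have "oriented_plane_frame g J P (vector [p, J p])"
    unfolding oriented_plane_frame_def
    using orthonormal_pair[OF p] frame_det_pair[OF p] g_J_J g_pos by (simp add: J_in)
  then have e': "oriented_plane_frame g J P (SOME e. oriented_plane_frame g J P e)" by (rule someI)
  define e where "e = (SOME e. oriented_plane_frame g J P e)"
  have e: "oriented_plane_frame g J P e" using e' by (simp only: e_def)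
  have eP: "e $ i \<in> P" and eg: "g (e $ i) (e $ j) = (if i = j then 1 else 0)"
    and ed: "v \<in> P \<Longrightarrow> v \<noteq> 0 \<Longrightarrow> frame_det g (vector [v, J v]) e > 0" for i j v
    using e unfolding oriented_plane_frame_def by blast+
  have e1: "e $ 1 \<noteq> 0" using eg[of 1 1] bilinear_0(1)[OF g_bilinear T_closed(1)] by auto
  have c: "g (J (e $ 1)) (e $ 2) > 0"
    using ed[OF eP e1] eg by (simp add: frame_det_def det_2)
  have "e $ 2 = g (e $ 2) (J (e $ 1)) *\<^sub>R J (e $ 1)"
    using plane_expansion[OF eP _ eP, of 1 2] eg by simp
  moreover define c where "c = g (e $ 2) (J (e $ 1))"
  ultimately have ce: "e $ 2 = c *\<^sub>R J (e $ 1)" by simp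
  have "c * c = 1"
    using eg[of 2 2] eg[of 1 1] unfolding ce
    by (simp add: bilinear_over_scale[OF g_bilinear] T_closed J_in eP g_J_J)
  moreover have "c > 0" using c g_sym[OF eP J_in[OF eP], of 2 1] by (simp add: c_def)
  ultimately have "c = 1" by (metis abs_of_pos abs_mult_self_eq mult.left_neutral power2_eq_1_iff power2_eq_square zero_less_one less_asym neg_0_less_iff_less)
  then have e2: "e $ 2 = J (e $ 1)" using ce by simp
  have "e = vector [e $ 1, J (e $ 1)]" by (simp add: vec_eq_iff forall_2 e2)
  then have "frame_det g (vector [v, w]) e = g (J v) w"
    using frame_det_pair[OF eP _ vw, of 1] eg by simp
  then show ?thesis by (simp add: area_form_def e_def)
qed

end

section \<open>Unitary frames, orientation and the Hodge star in dimension four\<close>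

locale hermitian_4space = hermitian_subspace T g J for T :: "('a, real^4) tvec set" and g J +
  assumes dim_T: "dim T = 4"
begin

text \<open>An orthonormal basis of T as a Hermitian complex plane: the last two conditions are the
  vanishing of the real and the imaginary part of the Hermitian product of p and q.\<close>

definition unitary :: "('a, real^4) tvec \<Rightarrow> ('a, real^4) tvec \<Rightarrow> bool"
  where "unitary p q \<longleftrightarrow> p \<in> T \<and> q \<in> T \<and> g p p = 1 \<and> g q q = 1 \<and> g p q = 0 \<and> g (J p) q = 0"

lemma unitaryD:
  assumes "unitary p q"
  shows "p \<in> T" "q \<in> T" "J p \<in> T" "J q \<in> T"
    "g p p = 1" "g q q = 1" "g p q = 0" "g q p = 0" "g (J p) q = 0" "g q (J p) = 0"
    "g p (J q) = 0" "g (J q) p = 0" "g p (J p) = 0" "g (J p) p = 0" "g q (J q) = 0" "g (J q) q = 0"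
    "g (J p) (J p) = 1" "g (J q) (J q) = 1" "g (J p) (J q) = 0" "g (J q) (J p) = 0"
proof -
  show T: "p \<in> T" "q \<in> T" "J p \<in> T" "J q \<in> T" using assms J_in by (auto simp: unitary_def)
  show 1: "g p p = 1" "g q q = 1" "g p q = 0" "g (J p) q = 0" using assms by (auto simp: unitary_def)
  show 2: "g q p = 0" "g q (J p) = 0" "g p (J q) = 0"
    using 1 g_sym[OF T(1,2)] g_sym[OF T(3,2)] g_J[OF T(1,2)] by auto
  then show "g (J q) p = 0" using g_sym[OF T(4,1)] by simp
  show "g p (J p) = 0" "g (J p) p = 0" "g q (J q) = 0" "g (J q) q = 0" using g_J_self T by auto
  show "g (J p) (J p) = 1" "g (J q) (J q) = 1" "g (J p) (J q) = 0" "g (J q) (J p) = 0"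
    using g_J_J T 1 2 by auto
qed

lemma unitary_swap:
  assumes "unitary p q" shows "unitary q p"
  unfolding unitary_def by (intro conjI unitaryD[OF assms])

abbreviation uframe :: "('a, real^4) tvec \<Rightarrow> ('a, real^4) tvec \<Rightarrow> ('a, real^4) tvec ^ 4"
  where "uframe p q \<equiv> vector [p, J p, q, J q]"

lemma uframe_orthonormal:
  assumes "unitary p q"
  shows "uframe p q $ i \<in> T" "g (uframe p q $ i) (uframe p q $ j) = (if i = j then 1 else 0)"
proof -
  have "\<forall>i. uframe p q $ i \<in> T" "\<forall>i j. g (uframe p q $ i) (uframe p q $ j) = (if i = j then 1 else 0)"
    using unitaryD[OF assms] by (simp_all add: forall_4)
  then show "uframe p q $ i \<in> T" "g (uframe p q $ i) (uframe p q $ j) = (if i = j then 1 else 0)" by blast+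
qed

lemma unitary_expansion:
  assumes "unitary p q" "v \<in> T"
  shows "v = g v p *\<^sub>R p + g v (J p) *\<^sub>R J p + g v q *\<^sub>R q + g v (J q) *\<^sub>R J q"
  using orthonormal_expansion[OF uframe_orthonormal[OF assms(1)] _ assms(2)] dim_T by (simp add: sum_4)

lemma unitary_extend:
  assumes "p \<in> T" "g p p = 1" obtains q where "unitary p q"
proof -
  have "\<not> T \<subseteq> span {p, J p}"
  proof
    assume "T \<subseteq> span {p, J p}"
    from dim_le_card[OF this] have "dim T \<le> card {p, J p}" by simp
    also have "\<dots> \<le> 2" by (simp add: card_insert_if)
    finally show False using dim_T by simp
  qed
  then obtain w where w: "w \<in> T" "w \<notin> span {p, J p}" by blast
  define v where "v = w - (g w p *\<^sub>R p + g w (J p) *\<^sub>R J p)"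
  have vT: "v \<in> T" unfolding v_def by (intro T_closed w assms J_in)
  have "g w p *\<^sub>R p + g w (J p) *\<^sub>R J p \<in> span {p, J p}"
    by (intro span_add span_scale span_base) auto
  then have v0: "v \<noteq> 0" using w(2) unfolding v_def by (metis eq_iff_diff_eq_0)
  have "g p v = 0" "g (J p) v = 0"
    unfolding v_def using assms w
    by (simp_all add: bilinear_diff[OF g_bilinear] bilinear_overD[OF g_bilinear] T_closed J_in g_J_self g_J_J
        g_sym[of w])
  then have "unitary p ((1 / sqrt (g v v)) *\<^sub>R v)"
    unfolding unitary_def using normalize[OF vT v0] assms vT
    by (simp add: T_closed bilinear_overD[OF g_bilinear] J_in)
  then show thesis by (rule that)
qed

lemma unitary_exists: obtains p q where "unitary p q"
proof -
  have "T \<noteq> {0}" using dim_T dim_le_card[of T "{}"] by auto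
  then obtain v where v: "v \<in> T" "v \<noteq> 0" using T_closed(1) by blast
  then show thesis using unitary_extend[OF _ normalize[OF v]] T_closed(3) that by metis
qed

lemma inner_coordinates:
  assumes "unitary p q" "v \<in> T" "w \<in> T"
  shows "g v w = g v p * g w p + g v (J p) * g w (J p) + g v q * g w q + g v (J q) * g w (J q)"
  by (subst unitary_expansion[OF assms(1,3)])
    (simp add: bilinear_overD[OF g_bilinear] T_closed unitaryD[OF assms(1)] assms algebra_simps)

lemma J_coordinates:
  assumes "unitary p q" "v \<in> T"
  shows "g (J v) p = - g v (J p)" "g (J v) (J p) = g v p" "g (J v) q = - g v (J q)" "g (J v) (J q) = g v q"
  by (rule g_J g_J_J, rule assms, rule unitaryD[OF assms(1)])+

abbreviation minor :: "('a, real^4) tvec \<Rightarrow> ('a, real^4) tvec \<Rightarrow> ('a, real^4) bilin"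
  where "minor a b v w \<equiv> g v a * g w b - g v b * g w a"

definition skew_over :: "(('a, real^4) tvec \<Rightarrow> ('a, real^4) tvec \<Rightarrow> real) \<Rightarrow> bool"
  where "skew_over B \<longleftrightarrow> bilinear_over T B \<and> (\<forall>v\<in>T. \<forall>w\<in>T. B v w = - B w v)"

lemma skew_frame:
  assumes B: "skew_over B" and u: "unitary p q"
  shows "bilinear_over T B" "B (J p) p = - B p (J p)" "B q p = - B p q" "B (J q) p = - B p (J q)"
    "B q (J p) = - B (J p) q" "B (J q) (J p) = - B (J p) (J q)" "B (J q) q = - B q (J q)"
    "B p p = 0" "B q q = 0" "B (J p) (J p) = 0" "B (J q) (J q) = 0"
proof -
  note D = unitaryD[OF u]
  have sk: "\<And>v w. v \<in> T \<Longrightarrow> w \<in> T \<Longrightarrow> B v w = - B w v" and "bilinear_over T B"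
    using B unfolding skew_over_def by blast+
  then show "bilinear_over T B" by blast
  show "B (J p) p = - B p (J p)" "B q p = - B p q" "B (J q) p = - B p (J q)"
    "B q (J p) = - B (J p) q" "B (J q) (J p) = - B (J p) (J q)" "B (J q) q = - B q (J q)"
    by (rule sk; rule D)+
  show "B p p = 0" "B q q = 0" "B (J p) (J p) = 0" "B (J q) (J q) = 0"
    using sk[OF D(1,1)] sk[OF D(2,2)] sk[OF D(3,3)] sk[OF D(4,4)] by simp_all
qed

lemma skew_coordinates:
  assumes B: "skew_over B" and u: "unitary p q" and vw: "v \<in> T" "w \<in> T"
  shows "B v w = B p (J p) * minor p (J p) v w
     + B p q * minor p q v w
     + B p (J q) * minor p (J q) v w
     + B (J p) q * minor (J p) q v w
     + B (J p) (J q) * minor (J p) (J q) v w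
     + B q (J q) * minor q (J q) v w"
proof -
  note D = unitaryD[OF u]
  note sk = skew_frame[OF B u]
  have r: "B x w = g w p * B x p + g w (J p) * B x (J p) + g w q * B x q + g w (J q) * B x (J q)" if "x \<in> T" for x
    by (subst unitary_expansion[OF u vw(2)]) (simp add: bilinear_overD[OF sk(1)] T_closed D that)
  have "B v w = g v p * B p w + g v (J p) * B (J p) w + g v q * B q w + g v (J q) * B (J q) w"
    by (subst unitary_expansion[OF u vw(1)]) (simp add: bilinear_overD[OF sk(1)] T_closed D vw)
  then show ?thesis
    unfolding r[OF D(1)] r[OF D(2)] r[OF D(3)] r[OF D(4)] sk(2-11)
    by algebra
qed

lemma kahler_coordinates:
  assumes "unitary p q" "v \<in> T" "w \<in> T"
  shows "g (J v) w = minor p (J p) v w + minor q (J q) v w"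
  using inner_coordinates[OF assms(1) J_in[OF assms(2)] assms(3)] J_coordinates[OF assms(1,2)] by simp

text \<open>\<open>oriented\<close> and \<open>hodge\<close> are \<open>oriented_frame\<close> and
  \<open>hodge_star\<close> at one point, with an arbitrary frame in place of
  \<open>some_frame\<close>.\<close>

definition oriented :: "('a, real^4) tvec ^ 4 \<Rightarrow> bool"
  where "oriented e \<longleftrightarrow> (\<forall>i. e $ i \<in> T) \<and> (\<forall>i j. g (e $ i) (e $ j) = (if i = j then 1 else 0)) \<and>
    (\<forall>v\<in>T. \<forall>w\<in>T. span {v, J v, w, J w} = T \<longrightarrow> frame_det g (vector [v, J v, w, J w]) e > 0)"

definition hodge :: "('a, real^4) tvec ^ 4 \<Rightarrow> ('a, real^4) bilin \<Rightarrow> ('a, real^4) bilin"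
  where "hodge e B v w = 1/2 * (\<Sum>i\<in>UNIV. \<Sum>j\<in>UNIV.
      B (e $ i) (e $ j) * frame_det g (vector [e $ i, e $ j, v, w]) e)"

lemma frame_change:
  fixes e e' v :: "('a, real^4) tvec ^ 4"
  assumes e: "\<And>i. e $ i \<in> T" "\<And>i j. g (e $ i) (e $ j) = (if i = j then 1 else 0)"
    and v: "\<And>i. v $ i \<in> T" and e': "\<And>i. e' $ i \<in> T"
  shows "frame_det g v e' = frame_det g v e * frame_det g e e'"
proof -
  have "g (v $ i) (e' $ j) = (\<Sum>k\<in>UNIV. g (v $ i) (e $ k) * g (e $ k) (e' $ j))" for i j
    by (subst orthonormal_expansion[OF e _ v]) (simp_all add: dim_T bilinear_sum_left[OF g_bilinear] e e')
  then have "(\<chi> i j. g (v $ i) (e' $ j)) = (\<chi> i j. g (v $ i) (e $ j)) ** (\<chi> i j. g (e $ i) (e' $ j))"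
    by (simp add: matrix_matrix_mult_def vec_eq_iff)
  then show ?thesis unfolding frame_det_def by (simp add: det_mul)
qed

lemma frame_det_self:
  assumes "\<And>i j. g (e $ i) (e $ j) = (if i = j then 1 else 0)"
  shows "frame_det g e e = 1"
proof -
  have "(\<chi> i j. g (e $ i) (e $ j)) = mat 1" by (simp add: vec_eq_iff mat_def assms)
  then show ?thesis by (simp add: frame_det_def)
qed

lemma uframe_oriented:
  assumes u: "unitary p q" shows "oriented (uframe p q)"
  unfolding oriented_def
proof (intro conjI allI ballI impI)
  show "uframe p q $ i \<in> T" for i by (rule uframe_orthonormal(1)[OF u])
  show "g (uframe p q $ i) (uframe p q $ j) = (if i = j then 1 else 0)" for i j
    by (rule uframe_orthonormal(2)[OF u])
  fix v w assume vw: "v \<in> T" "w \<in> T" and span: "span {v, J v, w, J w} = T"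
  let ?x1 = "g v p" and ?x2 = "g v (J p)" and ?x3 = "g v q" and ?x4 = "g v (J q)"
  let ?y1 = "g w p" and ?y2 = "g w (J p)" and ?y3 = "g w q" and ?y4 = "g w (J q)"
  \<comment> \<open>The real determinant of a complex-linear map is the squared modulus of its
    complex determinant, here of the 2 by 2 matrix with rows (x1 + i x2, x3 + i x4) and (y1 + i y2,
    y3 + i y4).\<close>
  have "frame_det g (uframe v w) (uframe p q) =
      (?x1 * ?y3 - ?x2 * ?y4 - ?x3 * ?y1 + ?x4 * ?y2)\<^sup>2 + (?x1 * ?y4 + ?x2 * ?y3 - ?x3 * ?y2 - ?x4 * ?y1)\<^sup>2"
    using J_coordinates[OF u vw(1)] J_coordinates[OF u vw(2)]
    by (simp add: frame_det_def det_4 power2_eq_square algebra_simps)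
  then have nn: "frame_det g (uframe v w) (uframe p q) \<ge> 0" by simp
  have "\<exists>k1 k2 k3 k4. uframe p q $ i = k1 *\<^sub>R v + k2 *\<^sub>R J v + k3 *\<^sub>R w + k4 *\<^sub>R J w" for i
    using span_4E[of "uframe p q $ i" v "J v" w "J w"] uframe_orthonormal(1)[OF u, of i] span by metis
  then obtain k1 k2 k3 k4 where k: "\<And>i. uframe p q $ i = k1 i *\<^sub>R v + k2 i *\<^sub>R J v + k3 i *\<^sub>R w + k4 i *\<^sub>R J w"
    by metis
  \<comment> \<open>C expresses the unitary frame in terms of v, J v, w, J w; multiplicativity of
    the determinant then excludes the value 0.\<close>
  define C :: "real^4^4" where "C = (\<chi> i. vector [k1 i, k2 i, k3 i, k4 i])"
  have "(\<chi> i j. g (uframe p q $ i) (uframe p q $ j)) = C ** (\<chi> i j. g (uframe v w $ i) (uframe p q $ j))"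
  proof -
    have "g (uframe p q $ i) (uframe p q $ j) = (\<Sum>k\<in>UNIV. C $ i $ k * g (uframe v w $ k) (uframe p q $ j))" for i j
      unfolding C_def by (subst k, simp add: sum_4 bilinear_overD[OF g_bilinear] T_closed J_in vw uframe_orthonormal(1)[OF u])
    then show ?thesis by (simp add: matrix_matrix_mult_def vec_eq_iff)
  qed
  then have "det C * frame_det g (uframe v w) (uframe p q) = 1"
    using frame_det_self[OF uframe_orthonormal(2)[OF u]] unfolding frame_det_def by (simp add: det_mul)
  then have "frame_det g (uframe v w) (uframe p q) \<noteq> 0" by auto
  with nn show "frame_det g (uframe v w) (uframe p q) > 0" by simp
qed

lemma unitary_span:
  assumes u: "unitary p q" shows "span {p, J p, q, J q} = T"
proof
  show "span {p, J p, q, J q} \<subseteq> T"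
    using unitaryD[OF u] subspace_T by (intro span_minimal) auto
  show "T \<subseteq> span {p, J p, q, J q}"
  proof
    fix v assume "v \<in> T"
    show "v \<in> span {p, J p, q, J q}"
      by (subst unitary_expansion[OF u \<open>v \<in> T\<close>]) (intro span_add span_scale span_base; simp)
  qed
qed

text \<open>The determinant of a change between orthonormal frames squares to 1, as the inverse
  matrix is the transpose; the orientation condition on e, applied to p and q, selects the value
  1.\<close>

lemma oriented_frame_change:
  assumes u: "unitary p q" and e: "oriented e"
  shows "frame_det g (uframe p q) e = 1" "(\<And>i. v $ i \<in> T) \<Longrightarrow> frame_det g v e = frame_det g v (uframe p q)"
proof -
  have eT: "\<And>i. e $ i \<in> T" and eg: "\<And>i j. g (e $ i) (e $ j) = (if i = j then 1 else 0)"
    using e by (auto simp: oriented_def)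
  have pos: "frame_det g (uframe p q) e > 0"
    using e u unitary_span[OF u] unfolding oriented_def by (auto simp: unitary_def)
  have "frame_det g (uframe p q) (uframe p q) = frame_det g (uframe p q) e * frame_det g e (uframe p q)"
    by (rule frame_change[OF eT eg]) (rule uframe_orthonormal(1)[OF u])+
  moreover have "frame_det g e (uframe p q) = frame_det g (uframe p q) e"
  proof -
    have "(\<chi> i j. g (e $ i) (uframe p q $ j)) = transpose (\<chi> i j. g (uframe p q $ i) (e $ j))"
      using g_sym eT uframe_orthonormal(1)[OF u] by (simp add: transpose_def)
    then show ?thesis by (simp add: frame_det_def det_transpose)
  qed
  ultimately have "(frame_det g (uframe p q) e)\<^sup>2 = 1"
    using frame_det_self[OF uframe_orthonormal(2)[OF u]] by (simp add: power2_eq_square)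
  then show 1: "frame_det g (uframe p q) e = 1" using pos by (simp add: power2_eq_1_iff)
  show "frame_det g v e = frame_det g v (uframe p q)" if "\<And>i. v $ i \<in> T"
    using frame_change[OF uframe_orthonormal[OF u] that eT] 1 by simp
qed

text \<open>The full contraction of two bilinear forms depends only on the metric. The frame is
  exchanged one index at a time: in \<open>key\<close> one factor is expanded in the new frame, and
  the other is reassembled from the old one.\<close>

lemma contraction_frame_independent:
  assumes u: "unitary p q" and e: "oriented e"
    and B: "bilinear_over T B" and C: "bilinear_over T C"
  shows "(\<Sum>i\<in>UNIV. \<Sum>j\<in>UNIV. B (e $ i) (e $ j) * C (e $ i) (e $ j)) =
    (\<Sum>i\<in>UNIV. \<Sum>j\<in>UNIV. B (uframe p q $ i) (uframe p q $ j) * C (uframe p q $ i) (uframe p q $ j))"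
proof -
  let ?f = "uframe p q"
  have eT: "\<And>i. e $ i \<in> T" and eg: "\<And>i j. g (e $ i) (e $ j) = (if i = j then 1 else 0)"
    using e by (auto simp: oriented_def)
  note f = uframe_orthonormal[OF u]
  have key: "(\<Sum>i\<in>UNIV. L (e $ i) * M (e $ i)) = (\<Sum>k\<in>UNIV. L (?f $ k) * M (?f $ k))"
    if L: "\<And>x. x \<in> T \<Longrightarrow> L x = (\<Sum>k\<in>UNIV. g x (?f $ k) * L (?f $ k))"
      and M: "\<And>x. x \<in> T \<Longrightarrow> M x = (\<Sum>i\<in>UNIV. g x (e $ i) * M (e $ i))" for L M :: "('a, real^4) tvec \<Rightarrow> real"
  proof -
    have "(\<Sum>i\<in>UNIV. L (e $ i) * M (e $ i)) = (\<Sum>i\<in>UNIV. \<Sum>k\<in>UNIV. g (e $ i) (?f $ k) * L (?f $ k) * M (e $ i))"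
      by (simp add: L[OF eT] sum_distrib_right)
    also have "\<dots> = (\<Sum>k\<in>UNIV. L (?f $ k) * (\<Sum>i\<in>UNIV. g (?f $ k) (e $ i) * M (e $ i)))"
      by (subst sum.swap) (simp add: sum_distrib_left g_sym[OF eT f(1)] mult_ac)
    also have "\<dots> = (\<Sum>k\<in>UNIV. L (?f $ k) * M (?f $ k))" by (simp add: M[OF f(1)])
    finally show ?thesis .
  qed
  have exp: "D x y = (\<Sum>k\<in>UNIV. g x (e' $ k) * D (e' $ k) y)" "D y x = (\<Sum>k\<in>UNIV. g x (e' $ k) * D y (e' $ k))"
    if "bilinear_over T D" "x \<in> T" "y \<in> T" "\<And>i. e' $ i \<in> T" "\<And>i j. g (e' $ i) (e' $ j) = (if i = j then 1 else 0)"
    for D x y and e' :: "('a, real^4) tvec ^ 4"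
    by (subst orthonormal_expansion[OF that(4,5) _ that(2)],
        simp_all add: dim_T bilinear_sum_left[OF that(1)] bilinear_sum_right[OF that(1)] that(3,4))+
  have "(\<Sum>i\<in>UNIV. \<Sum>j\<in>UNIV. B (e $ i) (e $ j) * C (e $ i) (e $ j)) =
      (\<Sum>i\<in>UNIV. \<Sum>j\<in>UNIV. B (e $ i) (?f $ j) * C (e $ i) (?f $ j))"
    by (intro sum.cong refl key exp B C eT eg f) auto
  also have "\<dots> = (\<Sum>j\<in>UNIV. \<Sum>i\<in>UNIV. B (e $ i) (?f $ j) * C (e $ i) (?f $ j))" by (rule sum.swap)
  also have "\<dots> = (\<Sum>j\<in>UNIV. \<Sum>i\<in>UNIV. B (?f $ i) (?f $ j) * C (?f $ i) (?f $ j))"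
    by (intro sum.cong refl key exp B C eT eg f) auto
  also have "\<dots> = (\<Sum>i\<in>UNIV. \<Sum>j\<in>UNIV. B (?f $ i) (?f $ j) * C (?f $ i) (?f $ j))" by (rule sum.swap)
  finally show ?thesis .
qed

lemma frame_det_bilinear:
  assumes f: "\<And>i. f $ i \<in> T"
  shows "bilinear_over T (\<lambda>x y. frame_det g (vector [x, y, v, w]) (f :: ('a, real^4) tvec ^ 4))"
proof -
  have lin: "g (r *\<^sub>R x + s *\<^sub>R y) (f $ k) = r * g x (f $ k) + s * g y (f $ k)" if "x \<in> T" "y \<in> T" for r s x y k
    using that f[of k] by (simp add: bilinear_overD[OF g_bilinear] T_closed)
  show ?thesis
    unfolding bilinear_over_def frame_det_def det_4
    by (simp add: lin) (simp add: algebra_simps)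
qed

text \<open>The unknown oriented frame e is replaced by the unitary one, in the determinants by
  \<open>oriented_frame_change\<close> and in the double sum by
  \<open>contraction_frame_independent\<close>. In the unitary frame the star exchanges
  complementary index pairs: 12 with 34, 13 with minus 24, 14 with 23.\<close>

lemma hodge_coordinates:
  assumes u: "unitary p q" and e: "oriented e" and B: "skew_over B" and vw: "v \<in> T" "w \<in> T"
  shows "hodge e B v w =
      B p (J p) * minor q (J q) v w
    - B p q * minor (J p) (J q) v w
    + B p (J q) * minor (J p) q v w
    + B (J p) q * minor p (J q) v w
    - B (J p) (J q) * minor p q v w
    + B q (J q) * minor p (J p) v w" (is "_ = ?R")
proof -
  note D = unitaryD[OF u]
  let ?f = "uframe p q"
  note sk = skew_frame[OF B u]
  have eT: "e $ i \<in> T" for i using e by (simp add: oriented_def)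
  have "frame_det g (vector [e $ i, e $ j, v, w]) e = frame_det g (vector [e $ i, e $ j, v, w]) ?f" for i j
  proof (rule oriented_frame_change(2)[OF u e])
    have "\<forall>k. (vector [e $ i, e $ j, v, w] :: _ ^ 4) $ k \<in> T" by (simp add: forall_4 eT vw)
    then show "(vector [e $ i, e $ j, v, w] :: _ ^ 4) $ k \<in> T" for k by blast
  qed
  then have "hodge e B v w = 1/2 * (\<Sum>i\<in>UNIV. \<Sum>j\<in>UNIV.
      B (e $ i) (e $ j) * frame_det g (vector [e $ i, e $ j, v, w]) ?f)"
    by (simp add: hodge_def)
  also have "\<dots> = 1/2 * (\<Sum>i\<in>UNIV. \<Sum>j\<in>UNIV.
      B (?f $ i) (?f $ j) * frame_det g (vector [?f $ i, ?f $ j, v, w]) ?f)"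
    using contraction_frame_independent[OF u e sk(1) frame_det_bilinear[OF uframe_orthonormal(1)[OF u], of v w]] by simp
  also have "\<dots> = ?R"
    by (simp add: sum_4 frame_det_def det_4 D sk(2-7)) (simp add: algebra_simps)
  finally show ?thesis .
qed

lemma norm_coordinates:
  assumes u: "unitary p q" and e: "oriented e" and B: "skew_over B"
  shows "(\<Sum>i\<in>UNIV. \<Sum>j\<in>UNIV. (B (e $ i) (e $ j))\<^sup>2) =
    2 * ((B p (J p))\<^sup>2 + (B p q)\<^sup>2 + (B p (J q))\<^sup>2 + (B (J p) q)\<^sup>2 + (B (J p) (J q))\<^sup>2 + (B q (J q))\<^sup>2)"
proof -
  note sk = skew_frame[OF B u]
  show ?thesis
    using contraction_frame_independent[OF u e sk(1,1)]
    by (simp add: power2_eq_square sum_4 sk(2-11))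
qed

text \<open>In terms of the dual frame \<open>f\<close> of \<open>(p, J p, q, J q)\<close> this is the normal form
  \<open>\<surd>2 B = - f1 \<and> f2 + f3 \<and> f4\<close>, while the Kaehler form is \<open>f1 \<and> f2 + f3 \<and> f4\<close>.\<close>

definition split_form :: "('a, real^4) tvec \<Rightarrow> ('a, real^4) tvec \<Rightarrow> ('a, real^4) bilin \<Rightarrow> bool"
  where "split_form p q B \<longleftrightarrow> unitary p q \<and> (\<forall>v\<in>T. \<forall>w\<in>T. sqrt 2 * B v w =
    - minor p (J p) v w + minor q (J q) v w)"

lemma split_formI:
  assumes u: "unitary p q" and B: "skew_over B"
    and "sqrt 2 * B p (J p) = -1" "sqrt 2 * B q (J q) = 1" "B p q = 0" "B p (J q) = 0" "B (J p) q = 0" "B (J p) (J q) = 0"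
  shows "split_form p q B"
  unfolding split_form_def
proof (intro conjI ballI u)
  fix v w assume vw: "v \<in> T" "w \<in> T"
  have "sqrt 2 * B v w = (sqrt 2 * B p (J p)) * minor p (J p) v w
      + (sqrt 2 * B q (J q)) * minor q (J q) v w"
    unfolding skew_coordinates[OF B u vw] using assms(5-8) by (simp add: distrib_left)
  then show "sqrt 2 * B v w = - minor p (J p) v w + minor q (J q) v w"
    using assms(3,4) by simp
qed

text \<open>By anti-self-duality \<open>\<surd>2 B\<close> has the coefficients \<open>(a, b, c, - c, b, - a)\<close> on the index pairs
  12, 13, 14, 23, 24, 34 of a unitary frame, and \<open>a\<^sup>2 + b\<^sup>2 + c\<^sup>2 = 1\<close>. The vector \<open>v\<close> of the proof solves
  \<open>\<omega> v w + \<surd>2 B v w = 0\<close> for all \<open>w\<close>; normalized, it starts the required frame.\<close>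

lemma split_form_exists:
  assumes e: "oriented e" and B: "skew_over B"
    and asd: "\<And>v w. v \<in> T \<Longrightarrow> w \<in> T \<Longrightarrow> hodge e B v w = - B v w"
    and norm: "sqrt (1/2 * (\<Sum>i\<in>UNIV. \<Sum>j\<in>UNIV. (B (e $ i) (e $ j))\<^sup>2)) = 1"
  obtains p q where "split_form p q B"
proof -
  \<comment> \<open>Stated for all unitary frames because it serves the initial one and again the
    final one.\<close>
  have asd': "B q (J q) = - B p (J p)" "B (J p) (J q) = B p q" "B (J p) q = - B p (J q)" if u: "unitary p q" for p q
  proof -
    note D = unitaryD[OF u]
    show "B q (J q) = - B p (J p)"
      using asd[OF D(1,3)] hodge_coordinates[OF u e B D(1,3)] by (simp add: D)
    show "B (J p) (J q) = B p q"
      using asd[OF D(1,2)] hodge_coordinates[OF u e B D(1,2)] by (simp add: D)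
    show "B (J p) q = - B p (J q)"
      using asd[OF D(1,4)] hodge_coordinates[OF u e B D(1,4)] by (simp add: D)
  qed
  have bl: "bilinear_over T B" using B unfolding skew_over_def by blast
  obtain p0 q0 where u0: "unitary p0 q0" by (rule unitary_exists)
  note D0 = unitaryD[OF u0]
  define a b c where "a = sqrt 2 * B p0 (J p0)" "b = sqrt 2 * B p0 q0" "c = sqrt 2 * B p0 (J q0)"
  have n1: "a\<^sup>2 + b\<^sup>2 + c\<^sup>2 = 1"
    using norm norm_coordinates[OF u0 e B] asd'[OF u0] by (simp add: a_b_c_def power_mult_distrib)
  \<comment> \<open>In coordinates x1, ..., x4 of v the kernel equations for w = p0 and w = J p0 are
    (1 + a) x2 + b x3 + c x4 = 0 and (1 + a) x1 + c x3 - b x4 = 0, solved by x3 = 1 + a and x4 = 0.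
    Of the other two equations one is then automatic, and one is the vanishing of the Pfaffian 1 -
    (a^2 + b^2 + c^2). If 1 + a = 0, then b = c = 0 and p0 itself is in the kernel.\<close>
  define v where "v = (if 1 + a = 0 then p0 else (- c) *\<^sub>R p0 + (- b) *\<^sub>R J p0 + (1 + a) *\<^sub>R q0)"
  have vT: "v \<in> T" using D0 unfolding v_def by (simp add: T_closed del: scaleR_minus_left)
  have comb: "g (k1 *\<^sub>R p0 + k2 *\<^sub>R J p0 + k3 *\<^sub>R q0) p0 = k1" 
    "g (k1 *\<^sub>R p0 + k2 *\<^sub>R J p0 + k3 *\<^sub>R q0) (J p0) = k2"
    "g (k1 *\<^sub>R p0 + k2 *\<^sub>R J p0 + k3 *\<^sub>R q0) q0 = k3"
    "g (k1 *\<^sub>R p0 + k2 *\<^sub>R J p0 + k3 *\<^sub>R q0) (J q0) = 0" for k1 k2 k3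
    by (simp_all add: bilinear_overD[OF g_bilinear] T_closed D0)
  have ker: "g (J v) w + sqrt 2 * B v w = 0" if w: "w \<in> T" for w
  proof -
    have "sqrt 2 * B v w = a * minor p0 (J p0) v w
     + b * minor p0 q0 v w
     + c * minor p0 (J q0) v w
     - c * minor (J p0) q0 v w
     + b * minor (J p0) (J q0) v w
     - a * minor q0 (J q0) v w"
      unfolding skew_coordinates[OF B u0 vT w] a_b_c_def asd'[OF u0] by (simp add: algebra_simps)
    moreover have "g v p0 = (if 1 + a = 0 then 1 else - c)" "g v (J p0) = (if 1 + a = 0 then 0 else - b)"
      "g v q0 = (if 1 + a = 0 then 0 else 1 + a)" "g v (J q0) = 0"
      unfolding v_def by (simp_all only: comb D0 split: if_split) simp_all
    ultimately have eq: "g (J v) w + sqrt 2 * B v w = (if 1 + a = 0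
        then b * g w q0 + c * g w (J q0)
        else (1 - (a\<^sup>2 + b\<^sup>2 + c\<^sup>2)) * g w (J q0))"
      unfolding kahler_coordinates[OF u0 vT w]
      by (cases "a = -1") (simp_all add: algebra_simps power2_eq_square add_eq_0_iff)
    show ?thesis
    proof (cases "1 + a = 0")
      case True
      then have "a = -1" by simp
      then have "b = 0 \<and> c = 0" using n1 by (simp add: sum_power2_eq_zero_iff)
      then show ?thesis using eq True by simp
    qed (use eq n1 in simp)
  qed
  have "v \<noteq> 0"
  proof
    assume "v = 0"
    then have "g v p0 = 0" "g v q0 = 0" using bilinear_0(1)[OF g_bilinear] D0 by auto
    then show False unfolding v_def using D0(5) by (simp only: comb split: if_splits)
  qed
  define p where "p = (1 / sqrt (g v v)) *\<^sub>R v"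
  have p: "p \<in> T" "g p p = 1" using normalize[OF vT \<open>v \<noteq> 0\<close>] vT by (auto simp: p_def intro: T_closed)
  have ker': "sqrt 2 * B p w = - g (J p) w" if w: "w \<in> T" for w
  proof -
    have "g (J p) w + sqrt 2 * B p w = (1 / sqrt (g v v)) * (g (J v) w + sqrt 2 * B v w)"
      unfolding p_def by (simp add: J_simple bilinear_overD[OF g_bilinear] bilinear_overD[OF bl] T_closed J_in vT w distrib_left)
    then show ?thesis using ker[OF w] by simp
  qed
  \<comment> \<open>Any completion serves: \<open>ker'\<close> determines the three coefficients
    involving p, and anti-self-duality the complementary three.\<close>
  obtain q where u: "unitary p q" by (rule unitary_extend[OF p])
  note D = unitaryD[OF u]
  have "sqrt 2 * B p (J p) = -1" "B p q = 0" "B p (J q) = 0"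
    using ker'[OF D(3)] ker'[OF D(2)] ker'[OF D(4)] D by auto
  then have "split_form p q B" using asd'[OF u] by (intro split_formI[OF u B]) auto
  then show thesis by (rule that)
qed

lemma split_form_coeffs:
  assumes "split_form p q B"
  shows "sqrt 2 * B p (J p) = -1" "sqrt 2 * B q (J q) = 1" "B p q = 0" "B p (J q) = 0" "B (J p) q = 0" "B (J p) (J q) = 0"
proof -
  have u: "unitary p q" and B: "\<And>v w. v \<in> T \<Longrightarrow> w \<in> T \<Longrightarrow> sqrt 2 * B v w =
    - minor p (J p) v w + minor q (J q) v w"
    using assms unfolding split_form_def by blast+
  note D = unitaryD[OF u]
  show "sqrt 2 * B p (J p) = -1" "sqrt 2 * B q (J q) = 1" "B p q = 0" "B p (J q) = 0" "B (J p) q = 0" "B (J p) (J q) = 0"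
    using B[OF D(1,3)] B[OF D(2,4)] B[OF D(1,2)] B[OF D(1,4)] B[OF D(3,2)] B[OF D(3,4)] by (simp_all add: D)
qed

lemma split_form_unitary: "split_form p q B \<Longrightarrow> unitary p q"
  by (simp add: split_form_def)

text \<open>The reason why it suffices to study kernels of \<omega> + \<surd>2 \<zeta>: the other
  plane is the kernel belonging to - \<zeta>.\<close>

lemma split_form_swap: "split_form p q B \<Longrightarrow> split_form q p (\<lambda>v w. - B v w)"
  unfolding split_form_def using unitary_swap by (auto simp: algebra_simps)

lemma split_form_asd:
  assumes s: "split_form p q B" and e: "oriented e" and B: "skew_over B"
  shows "v \<in> T \<Longrightarrow> w \<in> T \<Longrightarrow> hodge e B v w = - B v w"
    and "sqrt (1/2 * (\<Sum>i\<in>UNIV. \<Sum>j\<in>UNIV. (B (e $ i) (e $ j))\<^sup>2)) = 1"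
proof -
  note u = split_form_unitary[OF s] and c = split_form_coeffs[OF s]
  have B12: "B q (J q) = - B p (J p)"
  proof -
    have "sqrt 2 * (B q (J q) + B p (J p)) = 0" using c(1,2) by (simp add: distrib_left)
    then show ?thesis by simp
  qed
  show "hodge e B v w = - B v w" if "v \<in> T" "w \<in> T"
    unfolding hodge_coordinates[OF u e B that] skew_coordinates[OF B u that] using c(3-6) B12
    by (simp add: algebra_simps)
  have "(sqrt 2 * B p (J p))\<^sup>2 = 1" using c(1) by simp
  then have "2 * (B p (J p))\<^sup>2 = 1" by (simp add: power_mult_distrib)
  then show "sqrt (1/2 * (\<Sum>i\<in>UNIV. \<Sum>j\<in>UNIV. (B (e $ i) (e $ j))\<^sup>2)) = 1"
    unfolding norm_coordinates[OF u e B] using c(3-6) B12 by simp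
qed

lemma unitary_span_pair:
  assumes u: "unitary p q"
  shows "span {p, J p} = {v \<in> T. g v q = 0 \<and> g v (J q) = 0}"
proof
  note D = unitaryD[OF u]
  have "subspace {v \<in> T. g v q = 0 \<and> g v (J q) = 0}"
    by (rule subspaceI) (use D in \<open>auto simp: T_closed bilinear_0[OF g_bilinear] bilinear_overD[OF g_bilinear]\<close>)
  then show "span {p, J p} \<subseteq> {v \<in> T. g v q = 0 \<and> g v (J q) = 0}"
    by (rule span_minimal[rotated]) (use D in auto)
  show "{v \<in> T. g v q = 0 \<and> g v (J q) = 0} \<subseteq> span {p, J p}"
  proof
    fix v assume "v \<in> {v \<in> T. g v q = 0 \<and> g v (J q) = 0}"
    then have "v = g v p *\<^sub>R p + g v (J p) *\<^sub>R J p" using unitary_expansion[OF u, of v] by simp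
    then show "v \<in> span {p, J p}" by (metis span_add span_scale span_base insertI1 insertI2)
  qed
qed

lemma unitary_span_dim:
  assumes u: "unitary p q" shows "dim (span {p, J p}) = 2"
proof -
  note D = unitaryD[OF u]
  have "p \<noteq> J p" using D by auto
  moreover have "p \<noteq> 0" "J p \<noteq> 0" using D bilinear_0(1)[OF g_bilinear] T_closed(1) by auto
  ultimately have "independent {p, J p}" using D by (intro orthogonal_independent) auto
  then show ?thesis using \<open>p \<noteq> J p\<close> by (simp add: dim_eq_card_independent)
qed

lemma unitary_span_J:
  assumes u: "unitary p q" shows "J ` span {p, J p} \<subseteq> span {p, J p}"
  unfolding unitary_span_pair[OF u] using J_coordinates[OF u] J_in by auto

definition kernel :: "('a, real^4) bilin \<Rightarrow> ('a, real^4) tvec set"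
  where "kernel B = {v \<in> T. \<forall>w\<in>T. g (J v) w + sqrt 2 * B v w = 0}"

text \<open>The terms of p and J p cancel, which is what the factor \<surd>2 is for; the remaining
  decomposable form has the span of p and J p as its kernel.\<close>

lemma split_form_sum:
  assumes s: "split_form p q B" and vw: "v \<in> T" "w \<in> T"
  shows "g (J v) w + sqrt 2 * B v w = 2 * minor q (J q) v w"
  using s vw kahler_coordinates[OF split_form_unitary[OF s] vw] unfolding split_form_def by simp

lemma kernel_split_form:
  assumes s: "split_form p q B" shows "kernel B = span {p, J p}"
proof -
  note u = split_form_unitary[OF s]
  note D = unitaryD[OF u]
  have "g v q = 0 \<and> g v (J q) = 0" if v: "v \<in> T" and k: "\<And>w. w \<in> T \<Longrightarrow> g (J v) w + sqrt 2 * B v w = 0" for v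
    using split_form_sum[OF s v D(4)] k[OF D(4)] split_form_sum[OF s v D(2)] k[OF D(2)] D by simp
  then show ?thesis unfolding unitary_span_pair[OF u] kernel_def using split_form_sum[OF s] by auto
qed

text \<open>The Pluecker relation is decomposability expressed without the factors. The frame (p, q)
  is chosen pointwise and need not vary smoothly, but a relation between values of the form passes
  to its components in a chart.\<close>

lemma split_form_pluecker:
  assumes s: "split_form p q B" and T: "u \<in> T" "w \<in> T" "a \<in> T" "b \<in> T"
  defines "\<beta> \<equiv> \<lambda>v w. g (J v) w + sqrt 2 * B v w"
  shows "\<beta> u w * \<beta> a b = \<beta> u a * \<beta> w b - \<beta> u b * \<beta> w a"
  unfolding \<beta>_def split_form_sum[OF s T(1,2)] split_form_sum[OF s T(3,4)] split_form_sum[OF s T(1,3)]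
    split_form_sum[OF s T(2,4)] split_form_sum[OF s T(1,4)] split_form_sum[OF s T(2,3)]
  by algebra

text \<open>The pointwise content of \<open>corresponding_form\<close>, with the Kaehler form in
  place of the area forms.\<close>

definition adapted :: "('a, real^4) tvec set \<Rightarrow> ('a, real^4) tvec set \<Rightarrow> ('a, real^4) bilin \<Rightarrow> bool"
  where "adapted H V B \<longleftrightarrow> (\<forall>v\<in>H. \<forall>w\<in>V. B v w = 0) \<and>
    (\<forall>v\<in>H. \<forall>w\<in>H. B v w = (- 1 / sqrt 2) * g (J v) w) \<and> (\<forall>v\<in>V. \<forall>w\<in>V. B v w = (1 / sqrt 2) * g (J v) w)"

lemma adapted_unique:
  assumes T: "{v + w | v w. v \<in> H \<and> w \<in> V} = T" "H \<subseteq> T" "V \<subseteq> T"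
    and B: "skew_over B" "adapted H V B" and C: "skew_over C" "adapted H V C" and vw: "v \<in> T" "w \<in> T"
  shows "B v w = C v w"
proof -
  obtain v1 v2 w1 w2 where d: "v = v1 + v2" "w = w1 + w2" "v1 \<in> H" "v2 \<in> V" "w1 \<in> H" "w2 \<in> V"
    using vw T(1) by blast
  then have dT: "v1 \<in> T" "v2 \<in> T" "w1 \<in> T" "w2 \<in> T" using T by auto
  have "D v w = (- 1 / sqrt 2) * g (J v1) w1 + (1 / sqrt 2) * g (J v2) w2"
    if "skew_over D" "adapted H V D" for D
  proof -
    have bl: "bilinear_over T D" using that(1) unfolding skew_over_def by blast
    have "D v w = D v1 w1 + D v1 w2 + (D v2 w1 + D v2 w2)"
      unfolding d(1,2) by (simp add: bilinear_overD[OF bl] dT T_closed)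
    moreover have "D v2 w1 = - D w1 v2"
      using that(1) dT unfolding skew_over_def by blast
    moreover have "D v1 w2 = 0" "D w1 v2 = 0" "D v1 w1 = (- 1 / sqrt 2) * g (J v1) w1" "D v2 w2 = (1 / sqrt 2) * g (J v2) w2"
      using that(2) d unfolding adapted_def by blast+
    ultimately show ?thesis by simp
  qed
  then show ?thesis using B C by metis
qed

text \<open>The first vector is prescribed up to normalization, so that h may be the value of a
  smooth section of H; any unit vector of V serves as q.\<close>

lemma decomposition_unitary:
  assumes H: "subspace H" "H \<subseteq> T" "J ` H \<subseteq> H" "dim H = 2"
    and V: "subspace V" "V \<subseteq> T" "J ` V \<subseteq> V" "dim V = 2"
    and orth: "\<And>v w. v \<in> H \<Longrightarrow> w \<in> V \<Longrightarrow> g v w = 0" and h: "h \<in> H" "h \<noteq> 0"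
  obtains q where "unitary ((1 / sqrt (g h h)) *\<^sub>R h) q"
    "H = span {(1 / sqrt (g h h)) *\<^sub>R h, J ((1 / sqrt (g h h)) *\<^sub>R h)}" "V = span {q, J q}"
proof -
  interpret H: hermitian_plane H g J
    using mono_J[OF H(2,1,3)] H(4) by (simp add: hermitian_plane_def hermitian_plane_axioms_def)
  interpret V: hermitian_plane V g J
    using mono_J[OF V(2,1,3)] V(4) by (simp add: hermitian_plane_def hermitian_plane_axioms_def)
  define p where "p = (1 / sqrt (g h h)) *\<^sub>R h"
  have p: "p \<in> H" "g p p = 1" unfolding p_def using H.normalize[OF h] h by (auto intro: H.T_closed)
  obtain q where q: "q \<in> V" "g q q = 1" by (rule V.unit_vector)
  have u: "unitary p q" unfolding unitary_def using p q orth H V by blast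
  have span_eq: "P = span {x, J x}" if "hermitian_plane P g J" "x \<in> P" "g x x = 1" for P x
  proof -
    interpret P: hermitian_plane P g J by (rule that)
    show ?thesis
    proof
      show "P \<subseteq> span {x, J x}"
      proof
        fix v assume "v \<in> P"
        from P.plane_expansion[OF that(2,3) this] show "v \<in> span {x, J x}"
          by (metis span_add span_scale span_base insertI1 insertI2)
      qed
      show "span {x, J x} \<subseteq> P" using that P.J_in by (intro span_minimal P.subspace_T) auto
    qed
  qed
  show thesis
    using that[OF u[unfolded p_def]] span_eq[OF H.hermitian_plane_axioms p] span_eq[OF V.hermitian_plane_axioms q]
    by (simp add: p_def)
qed

lemma adapted_split_form:
  assumes u: "unitary p q" and B: "skew_over B"
  shows "split_form p q B \<longleftrightarrow> adapted (span {p, J p}) (span {q, J q}) B"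
proof
  note D = unitaryD[OF u]
  have mem: "p \<in> span {p, J p}" "J p \<in> span {p, J p}" "q \<in> span {q, J q}" "J q \<in> span {q, J q}"
    by (auto intro: span_base)
  show "split_form p q B" if "adapted (span {p, J p}) (span {q, J q}) B"
    using that mem D unfolding adapted_def by (intro split_formI[OF u B]) simp_all
  assume s: "split_form p q B"
  have sB: "B v w = (1 / sqrt 2) * (- minor p (J p) v w + minor q (J q) v w)"
    if "v \<in> T" "w \<in> T" for v w
  proof -
    have "sqrt 2 * B v w = - minor p (J p) v w + minor q (J q) v w"
      using s that unfolding split_form_def by blast
    then show ?thesis by (simp add: field_simps)
  qed
  show "adapted (span {p, J p}) (span {q, J q}) B"
    unfolding adapted_def unitary_span_pair[OF u] unitary_span_pair[OF unitary_swap[OF u]]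
    using sB kahler_coordinates[OF u] by (simp add: diff_divide_distrib)
qed

text \<open>This is \<omega> - 2 f1 \<and> f2, divided by \<surd>2, where f1 and f2 are dual to h /
  |h| and J h / |h|. With \<open>g h h\<close> instead of its square root and without reference to
  V, it depends visibly smoothly on h.\<close>

definition adapted_form :: "('a, real^4) tvec \<Rightarrow> ('a, real^4) bilin"
  where "adapted_form h v w =
    (g (J v) w - 2 * ((g h v * g (J h) w - g h w * g (J h) v) / g h h)) / sqrt 2"

lemma adapted_form_split:
  assumes u: "unitary ((1 / sqrt (g h h)) *\<^sub>R h) q" and h: "h \<in> T" "h \<noteq> 0"
  shows "split_form ((1 / sqrt (g h h)) *\<^sub>R h) q (adapted_form h)"
  unfolding split_form_def
proof (intro conjI ballI u)
  fix v w assume vw: "v \<in> T" "w \<in> T"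
  let ?p = "(1 / sqrt (g h h)) *\<^sub>R h"
  have "g v ?p * g w (J ?p) - g v (J ?p) * g w ?p = (g h v * g (J h) w - g h w * g (J h) v) / g h h"
    using vw h g_pos[OF h]
    by (simp add: J_simple bilinear_overD[OF g_bilinear] J_in g_sym[OF vw(1)] g_sym[OF vw(2)] diff_divide_distrib)
  then show "sqrt 2 * adapted_form h v w =
      - (g v ?p * g w (J ?p) - g v (J ?p) * g w ?p) + minor q (J q) v w"
    unfolding adapted_form_def kahler_coordinates[OF u vw] by simp
qed

lemma adapted_form_skew:
  assumes "h \<in> T" shows "skew_over (adapted_form h)"
  unfolding skew_over_def
proof (intro conjI ballI)
  show "bilinear_over T (adapted_form h)"
    unfolding bilinear_over_def adapted_form_def
    using assms by (simp add: J_linear bilinear_overD[OF g_bilinear] J_in T_closed)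
      (simp add: algebra_simps add_divide_distrib diff_divide_distrib)
  show "adapted_form h v w = - adapted_form h w v" if "v \<in> T" "w \<in> T" for v w
  proof -
    have "(g h w * g (J h) v - g h v * g (J h) w) / g h h = - ((g h v * g (J h) w - g h w * g (J h) v) / g h h)"
      by (simp add: diff_divide_distrib)
    then show ?thesis unfolding adapted_form_def J_skew[OF that] by (simp add: add_divide_distrib diff_divide_distrib)
  qed
qed

end

section \<open>Kernels of closed forms\<close>

lemma has_derivative_imp_frechet: "(f has_derivative f') (at x) \<Longrightarrow> fderiv f x = f'"
  using frechet_derivative_at by metis

text \<open>The argument order is that of \<open>component A \<zeta> c\<close>, the intended
  instance: two constant vectors, then the point.\<close>

locale smooth_form_on =
  fixes S :: "'e::euclidean_space set" and \<beta> :: "'e \<Rightarrow> 'e \<Rightarrow> 'e \<Rightarrow> real"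
  assumes open_S: "open S" and bilinear: "x \<in> S \<Longrightarrow> bilinear (\<lambda>i j. \<beta> i j x)"
    and smooth: "smooth_on S (\<beta> i j)" and skew: "x \<in> S \<Longrightarrow> \<beta> i j x = - \<beta> j i x"
begin

abbreviation D :: "'e \<Rightarrow> 'e \<Rightarrow> 'e \<Rightarrow> 'e \<Rightarrow> real"
  where "D i j x \<equiv> fderiv (\<beta> i j) x"

definition ext :: "'e \<Rightarrow> 'e \<Rightarrow> 'e \<Rightarrow> 'e \<Rightarrow> real"
  where "ext i j k x = D j k x i + D k i x j + D i j x k"

lemma linear_left: "x \<in> S \<Longrightarrow> linear (\<lambda>i. \<beta> i j x)"
  using bilinear unfolding bilinear_def by auto

lemma \<beta>_derivative: "x \<in> S \<Longrightarrow> (\<beta> i j has_derivative D i j x) (at x)"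
  by (rule smooth_on_has_derivative[OF smooth])

lemma D_linear: "x \<in> S \<Longrightarrow> linear (D i j x)"
  using \<beta>_derivative has_derivative_linear by blast

lemma D_skew:
  assumes "x \<in> S" shows "D i j x v = - D j i x v"
proof -
  have "((\<lambda>y. - \<beta> j i y) has_derivative (\<lambda>v. - D j i x v)) (at x)"
    by (intro has_derivative_minus \<beta>_derivative assms)
  then have "(\<beta> i j has_derivative (\<lambda>v. - D j i x v)) (at x)"
    by (rule has_derivative_transform_within_open[OF _ open_S assms]) (rule skew[symmetric])
  then show ?thesis by (simp add: has_derivative_imp_frechet)
qed

lemma D_linear_left:
  assumes "x \<in> S" shows "linear (\<lambda>i. D i j x v)"
proof (rule linearI)
  fix a b :: 'e and r :: real
  have "((\<lambda>y. \<beta> a j y + \<beta> b j y) has_derivative (\<lambda>v. D a j x v + D b j x v)) (at x)"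
    by (intro has_derivative_add \<beta>_derivative assms)
  then have "(\<beta> (a + b) j has_derivative (\<lambda>v. D a j x v + D b j x v)) (at x)"
    by (rule has_derivative_transform_within_open[OF _ open_S assms]) (simp add: linear_add[OF linear_left])
  then show "D (a + b) j x v = D a j x v + D b j x v" by (simp add: has_derivative_imp_frechet)
  have "((\<lambda>y. r *\<^sub>R \<beta> b j y) has_derivative (\<lambda>v. r *\<^sub>R D b j x v)) (at x)"
    by (intro has_derivative_scaleR_right \<beta>_derivative assms)
  then have "(\<beta> (r *\<^sub>R b) j has_derivative (\<lambda>v. r *\<^sub>R D b j x v)) (at x)"
    by (rule has_derivative_transform_within_open[OF _ open_S assms]) (simp add: linear_scale[OF linear_left])
  then show "D (r *\<^sub>R b) j x v = r *\<^sub>R D b j x v" by (simp add: has_derivative_imp_frechet)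
qed

lemma D_linear_right:
  assumes "x \<in> S" shows "linear (\<lambda>j. D i j x v)"
proof -
  have "(\<lambda>j. D i j x v) = (\<lambda>j. - D j i x v)" using D_skew[OF assms] by blast
  then show ?thesis using linear_compose_neg[OF D_linear_left[OF assms, of i v]] by simp
qed

lemma ext_linear:
  assumes "x \<in> S"
  shows "linear (\<lambda>i. ext i j k x)" "linear (\<lambda>j. ext i j k x)" "linear (\<lambda>k. ext i j k x)"
  unfolding ext_def
  by (intro linear_compose_add D_linear D_linear_left D_linear_right assms)+

lemma ext_cyclic: "ext i j k x = ext j k i x"
  by (simp add: ext_def)

lemma ext_eq_0_of_Basis:
  assumes x: "x \<in> S" and 0: "\<And>i j k. i \<in> Basis \<Longrightarrow> j \<in> Basis \<Longrightarrow> k \<in> Basis \<Longrightarrow> ext i j k x = 0"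
  shows "ext i j k x = 0"
proof -
  have rep: "f v = 0" if "linear f" "\<And>b. b \<in> Basis \<Longrightarrow> f b = 0" for f :: "'e \<Rightarrow> real" and v
    using that linear_eq_0_on_span[of f Basis v] by simp
  have 1: "ext i j k x = 0" if "i \<in> Basis" "j \<in> Basis" for i j k
    by (rule rep[OF ext_linear(3)[OF x, of i j]]) (rule 0[OF that])
  have 2: "ext i j k x = 0" if "i \<in> Basis" for i j k
    by (rule rep[OF ext_linear(2)[OF x, of i k]]) (rule 1[OF that])
  show ?thesis
    by (rule rep[OF ext_linear(1)[OF x, of j k]]) (rule 2)
qed

lemma section_derivative:
  fixes \<phi> X :: "'b::real_normed_vector \<Rightarrow> 'e"
  assumes \<phi>: "(\<phi> has_derivative \<phi>') (at u)" and X: "(X has_derivative X') (at u)" and u: "\<phi> u \<in> S"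
    and N: "open N" "u \<in> N" "\<And>t. t \<in> N \<Longrightarrow> \<phi> t \<in> S"
  shows "((\<lambda>t. \<beta> (X t) w (\<phi> t)) has_derivative (\<lambda>a. \<beta> (X' a) w (\<phi> u) + D (X u) w (\<phi> u) (\<phi>' a))) (at u)"
proof -
  have rep: "f v = (\<Sum>b\<in>Basis. (v \<bullet> b) * f b)" if "linear f" for f :: "'e \<Rightarrow> real" and v
    using linear_sum[OF that, of "\<lambda>b. (v \<bullet> b) *\<^sub>R b" Basis] linear_scale[OF that]
    by (simp add: euclidean_representation)
  have "((\<lambda>t. \<Sum>b\<in>Basis. (X t \<bullet> b) * \<beta> b w (\<phi> t)) has_derivative
      (\<lambda>a. \<Sum>b\<in>Basis. (X u \<bullet> b) * D b w (\<phi> u) (\<phi>' a) + (X' a \<bullet> b) * \<beta> b w (\<phi> u))) (at u)"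
    by (intro has_derivative_sum has_derivative_mult has_derivative_inner_left X
        has_derivative_compose[OF \<phi> \<beta>_derivative[OF u]])
  then have "((\<lambda>t. \<beta> (X t) w (\<phi> t)) has_derivative
      (\<lambda>a. \<Sum>b\<in>Basis. (X u \<bullet> b) * D b w (\<phi> u) (\<phi>' a) + (X' a \<bullet> b) * \<beta> b w (\<phi> u))) (at u)"
    by (rule has_derivative_transform_within_open[OF _ N(1,2)]) (rule rep[OF linear_left[OF N(3)], symmetric])
  moreover have "(\<Sum>b\<in>Basis. (X u \<bullet> b) * D b w (\<phi> u) (\<phi>' a) + (X' a \<bullet> b) * \<beta> b w (\<phi> u)) =
      \<beta> (X' a) w (\<phi> u) + D (X u) w (\<phi> u) (\<phi>' a)" for a
    using rep[OF linear_left[OF u], of "X' a" w] rep[OF D_linear_left[OF u], of "X u" w "\<phi>' a"]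
    by (simp add: sum.distrib)
  ultimately show ?thesis by simp
qed

text \<open>Differentiating \<open>\<beta> (X t) w (\<phi> t) = 0\<close> trades the derivative of
  \<beta> along \<phi> for the derivative of the kernel section X.\<close>

lemma kernel_section_derivative:
  fixes \<phi> X :: "'b::real_normed_vector \<Rightarrow> 'e"
  assumes \<phi>: "(\<phi> has_derivative \<phi>') (at u)" and X: "(X has_derivative X') (at u)"
    and N: "open N" "u \<in> N" "\<And>t. t \<in> N \<Longrightarrow> \<phi> t \<in> S" and ker: "\<And>t. t \<in> N \<Longrightarrow> \<beta> (X t) w (\<phi> t) = 0"
  shows "D (X u) w (\<phi> u) (\<phi>' a) = - \<beta> (X' a) w (\<phi> u)"
proof -
  have "((\<lambda>t. 0) has_derivative (\<lambda>a. 0)) (at u)" by simp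
  then have "((\<lambda>t. \<beta> (X t) w (\<phi> t)) has_derivative (\<lambda>a. 0)) (at u)"
    by (rule has_derivative_transform_within_open[OF _ N(1,2)]) (use ker in simp)
  from has_derivative_unique[OF this section_derivative[OF \<phi> X N(3)[OF N(2)] N]]
  have "0 = \<beta> (X' a) w (\<phi> u) + D (X u) w (\<phi> u) (\<phi>' a)" by metis
  then show ?thesis by simp
qed

text \<open>The derivative of Y ends up paired with h, which lies in the kernel at x. This disposes
  of derivatives of \<beta> in directions w transversal to the kernel.\<close>

lemma kernel_pair_derivative:
  assumes Y: "(Y has_derivative Y') (at x)" and N: "open N" "x \<in> N" "N \<subseteq> S"
    and ker: "\<And>y w. y \<in> N \<Longrightarrow> \<beta> (Y y) w y = 0" and h: "\<And>w. \<beta> h w x = 0"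
  shows "D (Y x) h x w = 0"
proof -
  have "D (Y x) h x w = - \<beta> (Y' w) h x"
    using kernel_section_derivative[OF has_derivative_ident Y N(1,2), of h w] N(3) ker by auto
  also have "\<dots> = \<beta> h (Y' w) x" using skew[of x "Y' w" h] N by auto
  finally show ?thesis by (simp add: h)
qed

text \<open>Cartan's formula for d \<beta> on two kernel fields: only the bracket term survives, and
  \<open>Y' (Z x) - Z' (Y x)\<close> is minus the bracket of Y and Z.\<close>

lemma ext_kernel_fields:
  assumes Y: "(Y has_derivative Y') (at x)" and Z: "(Z has_derivative Z') (at x)"
    and N: "open N" "x \<in> N" "N \<subseteq> S"
    and kerY: "\<And>y w. y \<in> N \<Longrightarrow> \<beta> (Y y) w y = 0" and kerZ: "\<And>y w. y \<in> N \<Longrightarrow> \<beta> (Z y) w y = 0"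
  shows "ext (Y x) (Z x) w x = \<beta> (Y' (Z x) - Z' (Y x)) w x"
proof -
  have x: "x \<in> S" using N by blast
  have "D (Z x) w x (Y x) = - \<beta> (Z' (Y x)) w x"
    using kernel_section_derivative[OF has_derivative_ident Z N(1,2), of w "Y x"] N(3) kerZ by auto
  moreover have "D (Y x) w x (Z x) = - \<beta> (Y' (Z x)) w x"
    using kernel_section_derivative[OF has_derivative_ident Y N(1,2), of w "Z x"] N(3) kerY by auto
  moreover have "D (Y x) (Z x) x w = 0"
    by (rule kernel_pair_derivative[OF Y N kerY kerZ[OF N(2)]])
  ultimately show ?thesis
    unfolding ext_def using D_skew[OF x, of w "Y x" "Z x"] by (simp add: linear_diff[OF linear_left[OF x]])
qed

text \<open>The coordinate fields of a patch replace kernel fields: their bracket is a difference of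
  mixed second derivatives and vanishes. The field Y extends one tangent vector off the patch,
  because the third argument w may be transversal to it.\<close>

lemma ext_tangent_to_patch:
  fixes \<phi> :: "'b::euclidean_space \<Rightarrow> 'e"
  assumes U: "open U" "u \<in> U" "\<phi> ` U \<subseteq> S" and \<phi>: "smooth_on U \<phi>"
    and ker: "\<And>t a w. t \<in> U \<Longrightarrow> \<beta> (fderiv \<phi> t a) w (\<phi> t) = 0"
    and Y: "(Y has_derivative Y') (at (\<phi> u))" "Y (\<phi> u) = fderiv \<phi> u a"
    and N: "open N" "\<phi> u \<in> N" "N \<subseteq> S" "\<And>y w. y \<in> N \<Longrightarrow> \<beta> (Y y) w y = 0"
  shows "ext (fderiv \<phi> u a) (fderiv \<phi> u b) w (\<phi> u) = 0"
proof -
  let ?d = "\<lambda>t a. fderiv \<phi> t a"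
  have x: "\<phi> u \<in> S" using U by blast
  have d: "D (?d u a) w (\<phi> u) (?d u b) = - \<beta> (fderiv (\<lambda>t. ?d t a) u b) w (\<phi> u)" for a b
  proof -
    note X = smooth_on_has_derivative[OF smooth_on_frechet_derivative[OF U(1) \<phi>, of a] U(2)]
    show ?thesis
      by (rule kernel_section_derivative[OF smooth_on_has_derivative[OF \<phi> U(2)] X U(1,2)])
        (use U(3) ker in blast)+
  qed
  have "D (?d u a) (?d u b) (\<phi> u) w = 0"
    using kernel_pair_derivative[OF Y(1) N ker[OF U(2)]] by (simp add: Y(2))
  then show ?thesis
    unfolding ext_def using d[of a b] d[of b a] D_skew[OF x, of w "?d u a" "?d u b"]
      second_derivative_symmetric[OF U(1) \<phi> U(2), of a b] by simp
qed

end

text \<open>For a decomposable form with \<open>\<beta> p q \<noteq> 0\<close> the kernel is a complement of the span of \<open>p\<close> and \<open>q\<close>,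
  and \<open>kproj\<close> is the projection onto it. The brackets of the fields \<open>kproj v\<close> lie in that span, so they
  vanish as soon as they lie in the kernel, which is what closedness gives.\<close>

locale closed_decomposable_form = smooth_form_on +
  fixes p q :: 'a
  assumes pluecker: "x \<in> S \<Longrightarrow> \<beta> u w x * \<beta> a b x = \<beta> u a x * \<beta> w b x - \<beta> u b x * \<beta> w a x"
    and closed: "x \<in> S \<Longrightarrow> ext i j k x = 0"
begin

definition W :: "'a set" where "W = {x \<in> S. \<beta> p q x \<noteq> 0}"

definition kproj :: "'a \<Rightarrow> 'a \<Rightarrow> 'a"
  where "kproj v x = v - (\<beta> v q x / \<beta> p q x) *\<^sub>R p + (\<beta> v p x / \<beta> p q x) *\<^sub>R q"

lemma open_W: "open W"
proof -
  have "W = S \<inter> \<beta> p q -` (- {0})" by (auto simp: W_def)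
  then show ?thesis
    using continuous_open_preimage[OF smooth_on_imp_continuous_on[OF smooth] open_S open_Compl[OF closed_singleton], of p q 0] by simp
qed

lemma W_S: "W \<subseteq> S"
  by (auto simp: W_def)

lemma self_0: "x \<in> S \<Longrightarrow> \<beta> v v x = 0"
  using skew[of x v v] by simp

lemma kproj_smooth: "smooth_on W (kproj v)"
  unfolding kproj_def
  by (intro smooth_on_add smooth_on_diff smooth_on_scaleR smooth_on_divide smooth_on_const open_W
      smooth_on_subset[OF smooth W_S]) (auto simp: W_def)

lemma kproj_linear: "x \<in> W \<Longrightarrow> linear (\<lambda>v. kproj v x)"
  unfolding kproj_def using W_S
  by (intro linearI) (auto simp: linear_add[OF linear_left] linear_scale[OF linear_left] algebra_simps add_divide_distrib)

lemma kproj_p: "x \<in> W \<Longrightarrow> kproj p x = 0" and kproj_q: "x \<in> W \<Longrightarrow> kproj q x = 0"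
  using skew[of x q p] by (auto simp: kproj_def self_0 W_def)

text \<open>Since \<open>\<beta> p q x\<close> is nonzero, the Pluecker relation shows that a vector
  pairing to zero with p and q pairs to zero with everything; the coefficients in
  \<open>kproj\<close> are made for the former.\<close>

lemma kproj_kernel:
  assumes "x \<in> W" shows "\<beta> (kproj v x) w x = 0"
proof -
  have x: "x \<in> S" and n: "\<beta> p q x \<noteq> 0" using assms by (auto simp: W_def)
  have "\<beta> (kproj v x) p x = 0" "\<beta> (kproj v x) q x = 0"
    unfolding kproj_def using n skew[OF x, of q p]
    by (simp_all add: linear_add[OF linear_left[OF x]] linear_diff[OF linear_left[OF x]] linear_scale[OF linear_left[OF x]] self_0[OF x])
  then show ?thesis using pluecker[OF x, of "kproj v x" w p q] n by simp
qed

lemma kproj_fixes: "(\<And>w. \<beta> v w x = 0) \<Longrightarrow> kproj v x = v"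
  by (simp add: kproj_def)

text \<open>All projections, at whatever point, are along the same plane of constant vectors, so an
  earlier projection at y changes a vector only by what the projection at x annihilates.\<close>

lemma kproj_kproj:
  assumes "x \<in> W" shows "kproj (kproj v y) x = kproj v x"
proof -
  have "kproj (kproj v y) x = kproj v x - (\<beta> v q y / \<beta> p q y) *\<^sub>R kproj p x + (\<beta> v p y / \<beta> p q y) *\<^sub>R kproj q x"
    unfolding kproj_def[of v y]
    by (simp only: linear_add[OF kproj_linear[OF assms]] linear_diff[OF kproj_linear[OF assms]] linear_scale[OF kproj_linear[OF assms]])
  then show ?thesis by (simp add: kproj_p kproj_q assms)
qed

text \<open>\<open>kproj_kproj\<close> is differentiated in the point of the inner projection:
  \<open>kproj v\<close> varies only within the span of p and q.\<close>

lemma kproj_derivative: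
  assumes "x \<in> W" "y \<in> W" shows "kproj (fderiv (kproj v) x a) y = 0"
proof -
  note der = smooth_on_has_derivative[OF kproj_smooth assms(1), of v]
  have "((\<lambda>z. kproj (kproj v z) y) has_derivative (\<lambda>a. kproj (fderiv (kproj v) x a) y)) (at x)"
    using bounded_linear.has_derivative[OF _ der] kproj_linear[OF assms(2)] linear_conv_bounded_linear by blast
  moreover have "(\<lambda>z. kproj (kproj v z) y) = (\<lambda>z. kproj v y)" using kproj_kproj[OF assms(2)] by simp
  ultimately have "((\<lambda>z. kproj v y) has_derivative (\<lambda>a. kproj (fderiv (kproj v) x a) y)) (at x)" by simp
  from has_derivative_unique[OF this has_derivative_const] show ?thesis by metis
qed

lemma kproj_commute:
  assumes x: "x \<in> W"
  shows "fderiv (kproj v) x (kproj w x) = fderiv (kproj w) x (kproj v x)"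
proof -
  let ?z = "fderiv (kproj v) x (kproj w x) - fderiv (kproj w) x (kproj v x)"
  have "\<beta> ?z t x = 0" for t
    using ext_kernel_fields[OF smooth_on_has_derivative[OF kproj_smooth x] smooth_on_has_derivative[OF kproj_smooth x]
        open_W x W_S kproj_kernel kproj_kernel, of v w t] closed x W_S by auto
  then have "kproj ?z x = ?z" by (rule kproj_fixes)
  moreover have "kproj ?z x = 0"
    using kproj_derivative[OF x x] by (simp add: linear_diff[OF kproj_linear[OF x]])
  ultimately show ?thesis by simp
qed

text \<open>Projecting once more at x0 recovers \<open>L a\<close>, which lies in the kernel
  there.\<close>

lemma kproj_inj:
  assumes "x0 \<in> W" "x \<in> W" "linear L" "inj L" "\<And>a w. \<beta> (L a) w x0 = 0"
  shows "inj (\<lambda>a. kproj (L a) x)"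
proof (rule injI)
  fix a b assume "kproj (L a) x = kproj (L b) x"
  then have "kproj (L a) x0 = kproj (L b) x0" using kproj_kproj[OF assms(1)] by metis
  then show "a = b" using kproj_fixes assms(4,5) by (metis injD)
qed

lemma kernel_integral_surface:
  fixes L :: "'b::euclidean_space \<Rightarrow> 'a"
  assumes x0: "x0 \<in> W" and L: "linear L" "inj L" "\<And>a w. \<beta> (L a) w x0 = 0"
  obtains r F where "r > 0" "F 0 = x0" "F ` ball 0 r \<subseteq> W" "smooth_on (ball 0 r) F" "inj_on F (ball 0 r)"
    "\<And>u. u \<in> ball 0 r \<Longrightarrow> (F has_derivative (\<lambda>a. kproj (L a) (F u))) (at u)"
proof -
  obtain r F where F: "r > 0" "F 0 = x0" "F ` ball 0 r \<subseteq> W" "smooth_on (ball 0 r) F"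
    "\<And>u. u \<in> ball 0 r \<Longrightarrow> (F has_derivative (\<lambda>a. \<Sum>i\<in>Basis. (a \<bullet> i) *\<^sub>R kproj (L i) (F u))) (at u)"
    by (rule commuting_fields_integral[OF open_W x0, of "\<lambda>i :: 'b. kproj (L i)"])
      (use kproj_smooth kproj_commute in auto)
  have "(\<Sum>i\<in>Basis. (a \<bullet> i) *\<^sub>R kproj (L i) x) = kproj (L a) x" if x: "x \<in> W" for a x
  proof -
    have "linear (\<lambda>a. kproj (L a) x)" using linear_compose[OF L(1) kproj_linear[OF x]] by (simp add: comp_def)
    from linear_sum[OF this, of "\<lambda>i. (a \<bullet> i) *\<^sub>R i" Basis] linear_scale[OF this]
    show ?thesis by (simp add: euclidean_representation)
  qed
  then have F': "(F has_derivative (\<lambda>a. kproj (L a) (F u))) (at u)" if "u \<in> ball 0 r" for u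
    using F(5)[OF that] F(3) that by (auto simp: image_subset_iff)
  \<comment> \<open>The surface is a graph: projected to the kernel at x0 along the span of p and q,
    F becomes L plus a constant. This gives injectivity on the whole ball.\<close>
  have "((\<lambda>u. kproj (F u) x0 - L u) has_derivative (\<lambda>a. 0)) (at u)" if u: "u \<in> ball 0 r" for u
  proof -
    have "((\<lambda>u. kproj (F u) x0) has_derivative (\<lambda>a. kproj (kproj (L a) (F u)) x0)) (at u)"
      using bounded_linear.has_derivative[OF _ F'[OF u]] kproj_linear[OF x0] linear_conv_bounded_linear by blast
    moreover have "kproj (kproj (L a) (F u)) x0 = L a" for a
      using kproj_kproj[OF x0] kproj_fixes[OF L(3)] by simp
    ultimately have "((\<lambda>u. kproj (F u) x0) has_derivative L) (at u)" by simp
    from has_derivative_diff[OF this linear_imp_has_derivative[OF L(1)]] show ?thesis by simp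
  qed
  then obtain k where k: "\<And>u. u \<in> ball 0 r \<Longrightarrow> kproj (F u) x0 - L u = k"
    using has_derivative_zero_constant[OF convex_ball, of 0 r "\<lambda>u. kproj (F u) x0 - L u"]
      has_derivative_at_withinI by blast
  have "inj_on F (ball 0 r)"
  proof (rule inj_onI)
    fix u t assume "u \<in> ball 0 r" "t \<in> ball 0 r" "F u = F t"
    then have "kproj (F u) x0 - L u = kproj (F u) x0 - L t" using k[of u] k[of t] by simp
    then have "L u = L t" by (simp only: diff_left_imp_eq)
    then show "u = t" by (rule injD[OF L(2)])
  qed
  then show thesis by (rule that[OF F(1-4) _ F'])
qed

end

section \<open>Almost-Kaehler surfaces\<close>

locale almost_kahler =
  fixes A :: "('a::{t2_space, second_countable_topology}, real^4) chart set" and g J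
  assumes almost_kahler: "almost_kahler_surface A g J"

sublocale almost_kahler \<subseteq> smooth_manifold A
  using almost_kahler unfolding almost_kahler_surface_def by unfold_locales blast

context almost_kahler begin

abbreviation \<omega> :: "'a \<Rightarrow> ('a, real^4) bilin" where "\<omega> \<equiv> kahler_form A g J"

lemma
  shows metric_smooth: "smooth_bilinear_field A g"
    and kahler_skew: "skew_symmetric A \<omega>" and kahler_closed: "closed_form A \<omega>"
    and complex_structure: "almost_complex A J" and riemannian: "riemannian_metric A g"
  using almost_kahler unfolding almost_kahler_surface_def riemannian_metric_def by blast+

lemma kahler_eq: "v \<in> TM z \<Longrightarrow> w \<in> TM z \<Longrightarrow> \<omega> z v w = g z (J z v) w"
  by (simp add: kahler_form_def)

lemma bilinear_field_iff: "bilinear_field B \<longleftrightarrow> (\<forall>z. bilinear_over (TM z) (B z))"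
  unfolding bilinear_field_def bilinear_over_def by blast

lemma hermitian_4space: "hermitian_4space (TM z) (g z) (J z)"
proof
  show "subspace (TM z)" by (rule subspace_tangent_space)
  show "bilinear_over (TM z) (g z)"
    using metric_smooth unfolding smooth_bilinear_field_iff bilinear_field_iff by blast
  show "dim (TM z) = 4" by (simp add: dim_tangent_space)
  show "g z v w = g z w v" if "v \<in> TM z" "w \<in> TM z" for v w
    using riemannian that unfolding riemannian_metric_def by blast
  show "0 < g z v v" if "v \<in> TM z" "v \<noteq> 0" for v
    using riemannian that unfolding riemannian_metric_def by blast
  show "J z v \<in> TM z" "J z (J z v) = - v" if "v \<in> TM z" for v
    using complex_structure that unfolding almost_complex_def by blast+
  show "J z (r *\<^sub>R v + s *\<^sub>R w) = r *\<^sub>R J z v + s *\<^sub>R J z w"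
    if "v \<in> TM z" "w \<in> TM z" for v w r s
    using complex_structure that unfolding almost_complex_def by blast
  show "g z (J z v) w = - g z (J z w) v" if "v \<in> TM z" "w \<in> TM z" for v w
    using kahler_skew kahler_eq[OF that] kahler_eq[OF that(2,1)] that unfolding skew_symmetric_def by metis
qed

end

sublocale almost_kahler \<subseteq> pt: hermitian_4space "TM z" "g z" "J z" for z
  by (rule hermitian_4space)

context almost_kahler begin

section \<open>Two-forms and their exterior derivatives\<close>

lemma two_formD:
  assumes "two_form A \<zeta>"
  shows "smooth_bilinear_field A \<zeta>" "pt.skew_over z (\<zeta> z)"
    "\<not> (v \<in> TM z \<and> w \<in> TM z) \<Longrightarrow> \<zeta> z v w = 0"
  using assms unfolding two_form_def pt.skew_over_def skew_symmetric_def smooth_bilinear_field_iff bilinear_field_iff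
  by blast+

lemma two_formI:
  assumes "\<And>z. pt.skew_over z (\<zeta> z)"
    and "\<And>z v w. \<not> (v \<in> TM z \<and> w \<in> TM z) \<Longrightarrow> \<zeta> z v w = 0"
    and "\<And>c i j. c \<in> A \<Longrightarrow> smooth_on (cimg c) (component A \<zeta> c i j)"
  shows "two_form A \<zeta>"
  using assms unfolding two_form_def pt.skew_over_def skew_symmetric_def smooth_bilinear_field_iff bilinear_field_iff
  by blast

lemma kahler_two_form: "two_form A \<omega>"
proof (rule two_formI)
  have eq: "\<omega> z v w = g z (J z v) w" if "v \<in> TM z" "w \<in> TM z" for z v w
    by (rule kahler_eq[OF that])
  show "pt.skew_over z (\<omega> z)" for z
    unfolding pt.skew_over_def
  proof (intro conjI ballI)
    show "bilinear_over (TM z) (\<omega> z)"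
      using pt.kahler_bilinear[of z] pt.T_closed
      unfolding bilinear_over_def by (simp add: eq)
    show "\<omega> z v w = - \<omega> z w v" if "v \<in> TM z" "w \<in> TM z" for v w
      using kahler_skew that unfolding skew_symmetric_def by blast
  qed
  show "\<omega> z v w = 0" if "\<not> (v \<in> TM z \<and> w \<in> TM z)" for z v w
    using that by (auto simp: kahler_form_def)
  fix c i j assume c: "c \<in> A"
  have J: "smooth_on (cimg c) (\<lambda>x. J (cinv c x) (coord c i x) c)" for i
  proof -
    have "smooth_on (cimg c) (\<lambda>x. \<Sum>b\<in>Basis. (i \<bullet> b) *\<^sub>R J (cinv c x) (coord c b x) c)"
      using complex_structure c unfolding almost_complex_def
      by (intro smooth_on_sum open_cimg smooth_on_scaleR smooth_on_const) auto
    then show ?thesis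
    proof (rule smooth_on_cong[OF open_cimg[OF c], rotated])
      fix x assume x: "x \<in> cimg c"
      note T = coord_field_in'[OF c x] and lin = coord_field_linear[OF c x]
      have "linear (\<lambda>i. J (cinv c x) (coord c i x) c)"
        by (rule linearI) (simp_all add: linear_add[OF lin] linear_scale[OF lin] pt.J_simple T, simp add: scaleR_fun_def)
      from linear_sum[OF this, of "\<lambda>b. (i \<bullet> b) *\<^sub>R b" Basis] linear_scale[OF this]
      show "(\<Sum>b\<in>Basis. (i \<bullet> b) *\<^sub>R J (cinv c x) (coord c b x) c) = J (cinv c x) (coord c i x) c"
        by (simp add: euclidean_representation)
    qed
  qed
  \<comment> \<open>A component of \<omega> is a component of g whose first argument is J of a
    coordinate field, a smooth function of the coordinates.\<close>
  show "smooth_on (cimg c) (component A \<omega> c i j)"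
  proof (rule smooth_on_cong[OF open_cimg[OF c]])
    show "smooth_on (cimg c) (\<lambda>x. component A g c (J (cinv c x) (coord c i x) c) j x)"
      by (rule component_smooth[OF metric_smooth c open_cimg[OF c] subset_refl J smooth_on_const])
    fix x assume x: "x \<in> cimg c"
    note T = coord_field_in'[OF c x]
    show "component A g c (J (cinv c x) (coord c i x) c) j x = component A \<omega> c i j x"
      using coord_field_of[OF c cinv_in[OF c x] pt.J_in[OF T]] cmap_cinv[OF c x]
      unfolding component_def by (simp add: eq T)
  qed
qed

lemma two_form_chart:
  assumes \<zeta>: "two_form A \<zeta>" and c: "c \<in> A"
  shows "smooth_form_on (cimg c) (component A \<zeta> c)"
proof
  show "open (cimg c)" by (rule open_cimg[OF c])
  have bf: "bilinear_field \<zeta>" using two_formD(1)[OF \<zeta>] unfolding smooth_bilinear_field_iff by blast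
  show "bilinear (\<lambda>i j. component A \<zeta> c i j x)" if "x \<in> cimg c" for x
    by (rule component_bilinear[OF bf c that])
  show "smooth_on (cimg c) (component A \<zeta> c i j)" for i j
    by (rule component_smooth_const[OF two_formD(1)[OF \<zeta>] c])
  show "component A \<zeta> c i j x = - component A \<zeta> c j i x" if "x \<in> cimg c" for i j x
    using two_formD(2)[OF \<zeta>] coord_field_in'[OF c that] unfolding pt.skew_over_def component_def by blast
qed

lemma ext_eq_ext_deriv:
  assumes "two_form A \<zeta>" "c \<in> A"
  shows "smooth_form_on.ext (component A \<zeta> c) i j k x = ext_deriv A \<zeta> c i j k x"
  unfolding smooth_form_on.ext_def[OF two_form_chart[OF assms]] ext_deriv_def by simp

text \<open>Trilinearity of \<open>ext\<close> passes from basis vectors to arbitrary ones, so that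
  vectors of a kernel may be inserted.\<close>

lemma closed_form_iff:
  assumes "two_form A \<zeta>"
  shows "closed_form A \<zeta> \<longleftrightarrow> (\<forall>c\<in>A. \<forall>x\<in>cimg c. \<forall>i j k. ext_deriv A \<zeta> c i j k x = 0)"
  unfolding closed_form_def
  using smooth_form_on.ext_eq_0_of_Basis[OF two_form_chart[OF assms]] ext_eq_ext_deriv[OF assms] by metis

lemma two_form_combination:
  assumes "two_form A \<zeta>" "two_form A \<eta>"
  shows "two_form A (\<lambda>z v w. \<zeta> z v w + s * \<eta> z v w)"
    and "c \<in> A \<Longrightarrow> x \<in> cimg c \<Longrightarrow> ext_deriv A (\<lambda>z v w. \<zeta> z v w + s * \<eta> z v w) c i j k x =
      ext_deriv A \<zeta> c i j k x + s * ext_deriv A \<eta> c i j k x"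
proof -
  let ?B = "\<lambda>z v w. \<zeta> z v w + s * \<eta> z v w"
  have comp: "component A ?B c i j = (\<lambda>x. component A \<zeta> c i j x + s * component A \<eta> c i j x)" for c i j
    by (simp add: component_def fun_eq_iff)
  show "two_form A ?B"
  proof (rule two_formI)
    fix z
    have 1: "bilinear_over (TM z) (\<zeta> z)" "bilinear_over (TM z) (\<eta> z)"
      and 2: "\<And>v w. v \<in> TM z \<Longrightarrow> w \<in> TM z \<Longrightarrow> \<zeta> z v w = - \<zeta> z w v"
       "\<And>v w. v \<in> TM z \<Longrightarrow> w \<in> TM z \<Longrightarrow> \<eta> z v w = - \<eta> z w v"
      using two_formD(2)[OF assms(1), of z] two_formD(2)[OF assms(2), of z] unfolding pt.skew_over_def by blast+
    show "pt.skew_over z (?B z)"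
      unfolding pt.skew_over_def
    proof (intro conjI ballI)
      show "bilinear_over (TM z) (?B z)"
        unfolding bilinear_over_def
        by (simp add: bilinear_overD[OF 1(1)] bilinear_overD[OF 1(2)] pt.T_closed algebra_simps)
      show "?B z v w = - ?B z w v" if "v \<in> TM z" "w \<in> TM z" for v w
        unfolding 2(1)[OF that] 2(2)[OF that] by simp
    qed
    show "?B z v w = 0" if "\<not> (v \<in> TM z \<and> w \<in> TM z)" for v w
      using two_formD(3)[OF assms(1) that] two_formD(3)[OF assms(2) that] by simp
  next
    fix c i j assume "c \<in> A"
    then show "smooth_on (cimg c) (component A ?B c i j)"
      unfolding comp
      by (intro smooth_on_add smooth_on_mult smooth_on_const open_cimg component_smooth_const two_formD(1) assms)
  qed
  assume c: "c \<in> A" "x \<in> cimg c"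
  have "fderiv (component A ?B c i j) x =
     (\<lambda>v. fderiv (component A \<zeta> c i j) x v + s * fderiv (component A \<eta> c i j) x v)" for i j
    unfolding comp
    by (intro has_derivative_imp_frechet has_derivative_add has_derivative_mult_right
        smooth_on_has_derivative[OF component_smooth_const[OF _ c(1)] c(2)] two_formD(1) assms)
  then show "ext_deriv A ?B c i j k x = ext_deriv A \<zeta> c i j k x + s * ext_deriv A \<eta> c i j k x"
    unfolding ext_deriv_def by (simp add: algebra_simps)
qed

text \<open>The starting point for negation, as - \<zeta> is 0 + (-1) \<zeta> in
  \<open>two_form_combination\<close>.\<close>

lemma zero_two_form: "two_form A (\<lambda>z v w. 0)"
proof (rule two_formI)
  show "pt.skew_over z (\<lambda>v w. 0)" for z by (simp add: pt.skew_over_def bilinear_over_def)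
  show "smooth_on (cimg c) (component A (\<lambda>z v w. 0) c i j)" for c i j
    unfolding component_def by (rule smooth_on_const)
qed simp

lemma two_form_minus:
  assumes "two_form A \<zeta>"
  shows "two_form A (\<lambda>z v w. - \<zeta> z v w)" "closed_form A \<zeta> \<Longrightarrow> closed_form A (\<lambda>z v w. - \<zeta> z v w)"
proof -
  show 1: "two_form A (\<lambda>z v w. - \<zeta> z v w)"
    using two_form_combination(1)[OF zero_two_form assms, of "-1"] by simp
  have "ext_deriv A (\<lambda>z v w. 0) c i j k x = 0" for c i j k x
    by (simp add: ext_deriv_def component_def[abs_def])
  then show "closed_form A (\<lambda>z v w. - \<zeta> z v w)" if "closed_form A \<zeta>"
    using that two_form_combination(2)[OF zero_two_form assms, of _ _ "-1"]
    unfolding closed_form_iff[OF 1] closed_form_iff[OF assms] by simp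
qed

section \<open>Reduction to pointwise conditions: normal forms and area forms of leaves\<close>

lemma some_frame_oriented: "pt.oriented z (some_frame A g J z)"
proof -
  obtain p q where "pt.unitary z p q" by (rule pt.unitary_exists)
  from pt.uframe_oriented[OF this] have "oriented_frame A g J z (pt.uframe z p q)"
    unfolding pt.oriented_def oriented_frame_def .
  then have "oriented_frame A g J z (some_frame A g J z)" unfolding some_frame_def by (rule someI)
  then show ?thesis unfolding pt.oriented_def oriented_frame_def .
qed

lemma hodge_star_eq: "hodge_star A g J \<zeta> z v w = pt.hodge z (some_frame A g J z) (\<zeta> z) v w"
  by (simp add: hodge_star_def pt.hodge_def volume_form_def Let_def)

text \<open>Removes the Hodge star, the norm and the chosen frame from the problem; what remains is
  a normal form at every point.\<close>

lemma unit_asd_iff: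
  assumes "two_form A \<zeta>"
  shows "anti_self_dual A g J \<zeta> \<and> (\<forall>z. form_norm A g J \<zeta> z = 1) \<longleftrightarrow>
    (\<forall>z. \<exists>p q. pt.split_form z p q (\<zeta> z))"
proof
  assume asd: "anti_self_dual A g J \<zeta> \<and> (\<forall>z. form_norm A g J \<zeta> z = 1)"
  show "\<forall>z. \<exists>p q. pt.split_form z p q (\<zeta> z)"
  proof
    fix z
    show "\<exists>p q. pt.split_form z p q (\<zeta> z)"
      using pt.split_form_exists[OF some_frame_oriented two_formD(2)[OF assms], of z] asd
      unfolding anti_self_dual_def hodge_star_eq form_norm_def Let_def by metis
  qed
next
  assume s: "\<forall>z. \<exists>p q. pt.split_form z p q (\<zeta> z)"
  show "anti_self_dual A g J \<zeta> \<and> (\<forall>z. form_norm A g J \<zeta> z = 1)"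
    unfolding anti_self_dual_def hodge_star_eq form_norm_def Let_def
    using s pt.split_form_asd[OF _ some_frame_oriented two_formD(2)[OF assms]] by metis
qed

lemma complex_line_subbundleD:
  assumes "complex_line_subbundle A J D"
  shows "subspace (D z)" "D z \<subseteq> TM z" "dim (D z) = 2" "J z ` D z \<subseteq> D z"
  using assms unfolding complex_line_subbundle_def subbundle_def by blast+

text \<open>The condition on leaves is pointwise: the tangent planes of patches are the planes of D,
  each point lies on a patch, and the area form of \<open>D z\<close> is the Kaehler form.\<close>

lemma restricts_iff:
  assumes D: "complex_line_subbundle A J D" and int: "integrable_distribution A D"
  shows "(\<forall>L\<in>leaves A D. restricts_to_area_multiple A g J D L \<zeta> r) \<longleftrightarrow>
    (\<forall>z. \<forall>v\<in>D z. \<forall>w\<in>D z. \<zeta> z v w = r * g z (J z v) w)"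
proof
  note D' = complex_line_subbundleD[OF D]
  have area: "area_form (g z) (J z) (D z) v w = g z (J z v) w" if "v \<in> D z" "w \<in> D z" for z v w
  proof -
    interpret P: hermitian_plane "D z" "g z" "J z"
      using pt.mono_J[OF D'(2,1,4)] D'(3) by (simp add: hermitian_plane_def hermitian_plane_axioms_def)
    show ?thesis by (rule P.area_form_eq_kahler[OF that])
  qed
  show "\<forall>L\<in>leaves A D. restricts_to_area_multiple A g J D L \<zeta> r"
    if "\<forall>z. \<forall>v\<in>D z. \<forall>w\<in>D z. \<zeta> z v w = r * g z (J z v) w"
    unfolding restricts_to_area_multiple_def Let_def
  proof (intro ballI allI impI)
    fix L U \<phi> u a b assume "integral_patch A D U \<phi> \<and> \<phi> ` U \<subseteq> L" "u \<in> U"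
    then have r: "range (differential A \<phi> u) = D (\<phi> u)" unfolding integral_patch_def by blast
    then have "differential A \<phi> u a \<in> D (\<phi> u)" "differential A \<phi> u b \<in> D (\<phi> u)" by blast+
    then show "\<zeta> (\<phi> u) (differential A \<phi> u a) (differential A \<phi> u b) =
        r * area_form (g (\<phi> u)) (J (\<phi> u)) (range (differential A \<phi> u)) (differential A \<phi> u a) (differential A \<phi> u b)"
      unfolding r using that area by simp
  qed
  assume rest: "\<forall>L\<in>leaves A D. restricts_to_area_multiple A g J D L \<zeta> r"
  show "\<forall>z. \<forall>v\<in>D z. \<forall>w\<in>D z. \<zeta> z v w = r * g z (J z v) w"
  proof (intro allI ballI)
    fix z v w assume vw: "v \<in> D z" "w \<in> D z"
    obtain U \<phi> u where p: "integral_patch A D U \<phi>" "u \<in> U" "z = \<phi> u"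
      using int unfolding integrable_distribution_def by blast
    let ?R = "\<lambda>p q. \<exists>U \<phi>. integral_patch A D U \<phi> \<and> p \<in> \<phi> ` U \<and> q \<in> \<phi> ` U"
    \<comment> \<open>The leaf of z; it contains the patch through z, by chains of length
      one.\<close>
    define L where "L = {y. ?R\<^sup>*\<^sup>* z y}"
    have "L \<in> leaves A D" unfolding leaves_def L_def by blast
    moreover have "\<phi> ` U \<subseteq> L"
    proof
      fix y assume "y \<in> \<phi> ` U"
      then have "?R z y" using p by blast
      then show "y \<in> L" unfolding L_def by blast
    qed
    ultimately have *: "\<zeta> (\<phi> u) (differential A \<phi> u a) (differential A \<phi> u b) = r * area_form (g (\<phi> u)) (J (\<phi> u))
       (range (differential A \<phi> u)) (differential A \<phi> u a) (differential A \<phi> u b)" for a b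
      using rest p(1,2) unfolding restricts_to_area_multiple_def Let_def by blast
    have r: "range (differential A \<phi> u) = D z" using p unfolding integral_patch_def by blast
    obtain a b where "v = differential A \<phi> u a" "w = differential A \<phi> u b" using vw r by blast
    then show "\<zeta> z v w = r * g z (J z v) w" using *[of a b] area[OF vw] r p(3) by simp
  qed
qed

abbreviation "\<D> \<equiv> orthogonal_decompositions A g J"

lemma corresponding_form_iff:
  assumes "(H, V) \<in> \<D>"
  shows "corresponding_form A g J H V \<zeta> \<longleftrightarrow> two_form A \<zeta> \<and> (\<forall>z. pt.adapted z (H z) (V z) (\<zeta> z))"
proof -
  have HV: "complex_line_subbundle A J H" "integrable_distribution A H"
    "complex_line_subbundle A J V" "integrable_distribution A V"
    using assms unfolding orthogonal_decompositions_def by auto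
  show ?thesis
    unfolding corresponding_form_def pt.adapted_def restricts_iff[OF HV(1,2)] restricts_iff[OF HV(3,4)]
    by blast
qed

section \<open>Integrable subbundles from closed forms\<close>

definition kernel_dist :: "('a \<Rightarrow> ('a, real^4) bilin) \<Rightarrow> 'a \<Rightarrow> ('a, real^4) tvec set"
  where "kernel_dist \<zeta> z = pt.kernel z (\<zeta> z)"

definition plus_kahler :: "('a \<Rightarrow> ('a, real^4) bilin) \<Rightarrow> 'a \<Rightarrow> ('a, real^4) bilin"
  where "plus_kahler \<zeta> = (\<lambda>z v w. \<omega> z v w + sqrt 2 * \<zeta> z v w)"

text \<open>Here d \<omega> = 0 is used: closedness passes between \<zeta> and \<omega> + \<surd>2
  \<zeta>.\<close>

lemma plus_kahler_two_form:
  assumes "two_form A \<zeta>" shows "two_form A (plus_kahler \<zeta>)"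
    "c \<in> A \<Longrightarrow> x \<in> cimg c \<Longrightarrow> ext_deriv A (plus_kahler \<zeta>) c i j k x = sqrt 2 * ext_deriv A \<zeta> c i j k x"
proof -
  show "two_form A (plus_kahler \<zeta>)"
    unfolding plus_kahler_def by (rule two_form_combination(1)[OF kahler_two_form assms])
  show "ext_deriv A (plus_kahler \<zeta>) c i j k x = sqrt 2 * ext_deriv A \<zeta> c i j k x" if "c \<in> A" "x \<in> cimg c"
    using two_form_combination(2)[OF kahler_two_form assms that] kahler_closed that
    unfolding plus_kahler_def closed_form_iff[OF kahler_two_form] by simp
qed

lemma plus_kahler_eq:
  "v \<in> TM z \<Longrightarrow> w \<in> TM z \<Longrightarrow> plus_kahler \<zeta> z v w = g z (J z v) w + sqrt 2 * \<zeta> z v w"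
  by (simp add: plus_kahler_def kahler_eq)

lemma kernel_dist_component:
  assumes "c \<in> A" "x \<in> cimg c"
  shows "coord c a x \<in> kernel_dist \<zeta> (cinv c x) \<longleftrightarrow> (\<forall>w. component A (plus_kahler \<zeta>) c a w x = 0)"
proof -
  note T = coord_field_in'[OF assms]
  have ex: "\<exists>b. w = coord c b x" if "w \<in> TM (cinv c x)" for w
    using coord_field_of[OF assms(1) cinv_in[OF assms] that] cmap_cinv[OF assms] by metis
  have "coord c a x \<in> kernel_dist \<zeta> (cinv c x) \<longleftrightarrow>
      (\<forall>w\<in>TM (cinv c x). plus_kahler \<zeta> (cinv c x) (coord c a x) w = 0)"
    unfolding kernel_dist_def pt.kernel_def using T plus_kahler_eq[OF T] by simp
  also have "\<dots> \<longleftrightarrow> (\<forall>b. plus_kahler \<zeta> (cinv c x) (coord c a x) (coord c b x) = 0)"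
    using ex T by metis
  finally show ?thesis unfolding component_def .
qed

lemma kernel_distI: "c \<in> A \<Longrightarrow> z \<in> cdom c \<Longrightarrow> v \<in> kernel_dist \<zeta> z \<Longrightarrow> component A (plus_kahler \<zeta>) c (v c) w (cmap c z) = 0"
  using kernel_dist_component[of c "cmap c z" "v c" \<zeta>] coord_field_of[of c z v] cinv_cmap[of c z]
  unfolding kernel_dist_def pt.kernel_def by auto

lemma kernel_dist_split:
  assumes "pt.split_form z p q (\<zeta> z)"
  shows "kernel_dist \<zeta> z = span {p, J z p}" "subspace (kernel_dist \<zeta> z)" "kernel_dist \<zeta> z \<subseteq> TM z"
    "dim (kernel_dist \<zeta> z) = 2" "J z ` kernel_dist \<zeta> z \<subseteq> kernel_dist \<zeta> z"
proof -
  show eq: "kernel_dist \<zeta> z = span {p, J z p}"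
    unfolding kernel_dist_def by (rule pt.kernel_split_form[OF assms])
  note u = pt.split_form_unitary[OF assms]
  show "subspace (kernel_dist \<zeta> z)" "dim (kernel_dist \<zeta> z) = 2" "J z ` kernel_dist \<zeta> z \<subseteq> kernel_dist \<zeta> z"
    unfolding eq using pt.unitary_span_dim[OF u] pt.unitary_span_J[OF u] by auto
  show "kernel_dist \<zeta> z \<subseteq> TM z" unfolding kernel_dist_def pt.kernel_def by blast
qed

text \<open>One construction in a chart yields both claims. The components of q and J q at z, frozen
  as constant vectors, span the complement for \<open>kproj\<close>; projecting the constant vectors
  \<open>L a\<close> gives both a smooth frame of the kernel and the commuting fields that integrate
  to a patch.\<close>

lemma kernel_dist_local:
  assumes \<zeta>: "two_form A \<zeta>" and cl: "closed_form A \<zeta>" and s: "\<And>z. \<exists>p q. pt.split_form z p q (\<zeta> z)"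
  shows "\<exists>W X. open W \<and> z \<in> W \<and> (\<forall>m<2. smooth_vector_field_on A W (X m)) \<and>
      (\<forall>y\<in>W. kernel_dist \<zeta> y = span ((\<lambda>m. X m y) ` {..<2::nat}))"
    and "\<exists>U \<phi>. integral_patch A (kernel_dist \<zeta>) U \<phi> \<and> z \<in> \<phi> ` U"
proof -
  obtain c where c: "c \<in> A" "z \<in> cdom c" by (rule chart_at)
  let ?x0 = "cmap c z" and ?\<beta> = "component A (plus_kahler \<zeta>) c"
  have x0: "?x0 \<in> cimg c" using c by blast
  obtain p q where pq: "pt.split_form z p q (\<zeta> z)" using s by blast
  note u = pt.split_form_unitary[OF pq]
  note D = pt.unitaryD[OF u]
  interpret smooth_form_on "cimg c" ?\<beta>
    by (rule two_form_chart[OF plus_kahler_two_form(1)[OF \<zeta>] c(1)])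
  interpret closed_decomposable_form "cimg c" ?\<beta> "q c" "J z q c"
  proof
    fix x v w a b assume x: "x \<in> cimg c"
    obtain p' q' where s': "pt.split_form (cinv c x) p' q' (\<zeta> (cinv c x))" using s by blast
    note T = coord_field_in'[OF c(1) x]
    show "?\<beta> v w x * ?\<beta> a b x = ?\<beta> v a x * ?\<beta> w b x - ?\<beta> v b x * ?\<beta> w a x"
      using pt.split_form_pluecker[OF s' T T T T, of v w a b]
      unfolding component_def plus_kahler_eq[OF T T] .
    fix i j k
    show "ext i j k x = 0"
      using ext_eq_ext_deriv[OF plus_kahler_two_form(1)[OF \<zeta>] c(1), of i j k x]
        plus_kahler_two_form(2)[OF \<zeta> c(1) x] cl c(1) x unfolding closed_form_iff[OF \<zeta>] by simp
  qed
  have "?\<beta> (q c) (J z q c) ?x0 = 2"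
    using pt.split_form_sum[OF pq D(2,4)] D plus_kahler_eq[OF D(2,4), of \<zeta>]
      bilin_eq_component[OF c D(2,4), of "plus_kahler \<zeta>"] by simp
  then have W0: "?x0 \<in> W" using x0 by (simp add: W_def)
  \<comment> \<open>Parametrizes the kernel at z by the plane, with basis vectors sent to the
    components of p and J p.\<close>
  define L :: "real^2 \<Rightarrow> real^4" where "L a = (a $ 1) *\<^sub>R p c + (a $ 2) *\<^sub>R J z p c" for a
  have L_lin: "linear L" unfolding L_def by (rule linearI) (simp_all add: algebra_simps)
  have L_tan: "coord c (L a) ?x0 = (a $ 1) *\<^sub>R p + (a $ 2) *\<^sub>R J z p" for a
    unfolding L_def linear_add[OF coord_field_linear[OF c(1) x0]] linear_scale[OF coord_field_linear[OF c(1) x0]]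
      coord_field_of[OF c D(1)] coord_field_of[OF c D(3)] ..
  have L_inj: "inj L"
  proof (rule injI)
    fix a b assume "L a = L b"
    then have e: "(a $ 1) *\<^sub>R p + (a $ 2) *\<^sub>R J z p = (b $ 1) *\<^sub>R p + (b $ 2) *\<^sub>R J z p"
      using L_tan[of a] L_tan[of b] by simp
    have "g z ((a $ 1) *\<^sub>R p + (a $ 2) *\<^sub>R J z p) p = a $ 1" 
      "g z ((a $ 1) *\<^sub>R p + (a $ 2) *\<^sub>R J z p) (J z p) = a $ 2" for a :: "real^2"
      by (simp_all add: bilinear_overD[OF pt.g_bilinear] pt.T_closed D)
    then show "a = b" using e by (metis (mono_tags, lifting) vec_eq_iff exhaust_2)
  qed
  have L_ker: "?\<beta> (L a) w ?x0 = 0" for a w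
  proof -
    have "coord c (L a) ?x0 \<in> kernel_dist \<zeta> (cinv c ?x0)"
      unfolding L_tan cinv_cmap[OF c] kernel_dist_split(1)[where \<zeta> = \<zeta>, OF pq]
      by (intro span_add span_scale span_base) auto
    then show ?thesis using kernel_dist_component[OF c(1) x0] by blast
  qed
  define M where "M x a = coord c (kproj (L a) x) x" for x a
  have M: "linear (M x)" "inj (M x)" "range (M x) = kernel_dist \<zeta> (cinv c x)" if x: "x \<in> W" for x
  proof -
    have xc: "x \<in> cimg c" using x W_S by blast
    have k: "linear (\<lambda>a. kproj (L a) x)" using linear_compose[OF L_lin kproj_linear[OF x]] by (simp add: comp_def)
    show l: "linear (M x)"
      using linear_compose[OF k coord_field_linear[OF c(1) xc]] unfolding M_def[abs_def] by (simp add: comp_def)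
    have "kproj (L a) x = kproj (L b) x" if "M x a = M x b" for a b
      using that coord_field_self'[OF c(1) xc] unfolding M_def by metis
    then show i: "inj (M x)" using kproj_inj[OF W0 x L_lin L_inj L_ker] by (metis injD injI)
    have sub: "range (M x) \<subseteq> kernel_dist \<zeta> (cinv c x)"
      using kernel_dist_component[OF c(1) xc] kproj_kernel[OF x] unfolding M_def by blast
    \<comment> \<open>The inclusion is an equality by dimension: the normal form at
      \<open>cinv c x\<close> shows that the kernel is a plane, and \<open>M x\<close> is
      injective.\<close>
    obtain p' q' where s': "pt.split_form (cinv c x) p' q' (\<zeta> (cinv c x))" using s by blast
    note ks = kernel_dist_split[where \<zeta> = \<zeta>, OF s'] and lr = linear_range_span[OF l i]
    have "M x ` Basis \<subseteq> kernel_dist \<zeta> (cinv c x)" using sub by blast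
    from subspace_subset_span[OF lr(2) this] have "kernel_dist \<zeta> (cinv c x) \<subseteq> range (M x)"
      using lr(1,3) ks(4) by simp
    then show "range (M x) = kernel_dist \<zeta> (cinv c x)" using sub by blast
  qed
  show "\<exists>W X. open W \<and> z \<in> W \<and> (\<forall>m<2. smooth_vector_field_on A W (X m)) \<and>
      (\<forall>y\<in>W. kernel_dist \<zeta> y = span ((\<lambda>m. X m y) ` {..<2::nat}))"
  proof (intro exI conjI allI impI ballI)
    let ?N = "cdom c \<inter> cmap c -` W"
    let ?b = "\<lambda>m::nat. if m = 0 then axis 1 1 else axis 2 (1::real) :: real^2"
    let ?X = "\<lambda>m y. coord c (kproj (L (?b m)) (cmap c y)) (cmap c y)"
    show N: "open ?N"
      using homeo[OF c(1)] open_cdom[OF c(1)] open_W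
      by (intro continuous_open_preimage) (auto simp: homeomorphism_def)
    show "z \<in> ?N" using c W0 by blast
    show "smooth_vector_field_on A ?N (?X m)" for m
      by (rule smooth_vector_field_of_chart[OF c(1) N]) (auto intro: smooth_on_subset[OF kproj_smooth])
    fix y assume y: "y \<in> ?N"
    have "?b ` {..<2} = Basis" unfolding Basis_real_2 by (auto simp: lessThan_nat_numeral image_iff)
    then have "(\<lambda>m. ?X m y) ` {..<2} = M (cmap c y) ` Basis" unfolding M_def by (metis (no_types, lifting) image_image image_cong)
    then show "kernel_dist \<zeta> y = span ((\<lambda>m. ?X m y) ` {..<2::nat})"
      using linear_range_span(1)[OF M(1,2)[of "cmap c y"]] M(3)[of "cmap c y"] y cinv_cmap[OF c(1), of y] by simp
  qed
  obtain r F where F: "r > 0" "F 0 = ?x0" "F ` ball 0 r \<subseteq> W" "smooth_on (ball 0 r) F" "inj_on F (ball 0 r)"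
    "\<And>u. u \<in> ball 0 r \<Longrightarrow> (F has_derivative (\<lambda>a. kproj (L a) (F u))) (at u)"
    by (rule kernel_integral_surface[OF W0 L_lin L_inj L_ker]) blast
  have Fc: "F ` ball 0 r \<subseteq> cimg c" using F(3) W_S by blast
  note sm = smooth_map_into_of_chart[OF c(1) open_ball F(4) Fc]
  have "integral_patch A (kernel_dist \<zeta>) (ball 0 r) (cinv c \<circ> F)"
    unfolding integral_patch_def
  proof (intro conjI ballI open_ball sm(1))
    show "connected (ball (0::real^2) r)" by (simp add: convex_connected)
    show "inj_on (cinv c \<circ> F) (ball 0 r)"
    proof (rule comp_inj_on[OF F(5)])
      show "inj_on (cinv c) (F ` ball 0 r)"
        using Fc cmap_cinv[OF c(1)] by (intro inj_on_inverseI[of _ "cmap c"]) blast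
    qed
    fix u :: "real^2" assume u: "u \<in> ball 0 r"
    have "differential A (cinv c \<circ> F) u = M (F u)"
      using sm(2)[OF u] has_derivative_imp_frechet[OF F(6)[OF u]] by (simp add: M_def fun_eq_iff)
    then show "range (differential A (cinv c \<circ> F) u) = kernel_dist \<zeta> ((cinv c \<circ> F) u)"
      using M(3)[OF subsetD[OF F(3) imageI[OF u]]] by simp
  qed
  moreover have "z \<in> (cinv c \<circ> F) ` ball 0 r"
    using F(1,2) cinv_cmap[OF c] by (intro image_eqI[of _ _ 0]) auto
  ultimately show "\<exists>U \<phi>. integral_patch A (kernel_dist \<zeta>) U \<phi> \<and> z \<in> \<phi> ` U" by blast
qed

lemma kernel_dist_integrable_subbundle:
  assumes \<zeta>: "two_form A \<zeta>" "closed_form A \<zeta>" "\<And>z. \<exists>p q. pt.split_form z p q (\<zeta> z)"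
  shows "complex_line_subbundle A J (kernel_dist \<zeta>)" "integrable_distribution A (kernel_dist \<zeta>)"
proof -
  show "complex_line_subbundle A J (kernel_dist \<zeta>)"
    unfolding complex_line_subbundle_def subbundle_def
    using kernel_dist_split \<zeta>(3) kernel_dist_local(1)[OF \<zeta>] by meson
  show "integrable_distribution A (kernel_dist \<zeta>)"
    unfolding integrable_distribution_def using kernel_dist_local(2)[OF \<zeta>] by blast
qed

section \<open>Two-forms from decompositions\<close>

lemma orthogonal_decompositionsD:
  assumes "(H, V) \<in> \<D>"
  shows "complex_line_subbundle A J H" "integrable_distribution A H"
    "complex_line_subbundle A J V" "integrable_distribution A V"
    "{v + w | v w. v \<in> H z \<and> w \<in> V z} = TM z" "H z \<inter> V z = {0}"
    "v \<in> H z \<Longrightarrow> w \<in> V z \<Longrightarrow> g z v w = 0"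
  using assms unfolding orthogonal_decompositions_def by auto

text \<open>One nonvanishing section is enough to describe a complex line locally. The first field
  of a frame of two serves: at a zero of it the fibre would have dimension at most 1.\<close>

lemma subbundle_frame_nonzero:
  assumes D: "complex_line_subbundle A J D"
  obtains W X where "open W" "z \<in> W" "smooth_vector_field_on A W X" "\<And>y. y \<in> W \<Longrightarrow> X y \<in> D y \<and> X y \<noteq> 0"
proof -
  have sb: "subbundle A 2 D" using D unfolding complex_line_subbundle_def by blast
  then obtain W X where W: "open W" "z \<in> W" "\<forall>m<2. smooth_vector_field_on A W (X m)"
    "\<forall>y\<in>W. D y = span ((\<lambda>m. X m y) ` {..<2::nat})"
    unfolding subbundle_def by blast
  have two: "{..<2::nat} = {0, 1}" by auto
  have "X 0 y \<in> D y \<and> X 0 y \<noteq> 0" if y: "y \<in> W" for y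
  proof
    show "X 0 y \<in> D y" using W(4) y two by (simp add: span_base)
    show "X 0 y \<noteq> 0"
    proof
      assume "X 0 y = 0"
      then have "D y = span {X 1 y}" using W(4) y two span_insert_0 by simp
      then have "dim (D y) \<le> 1" using dim_le_card[of "D y" "{X 1 y}"] by simp
      then show False using complex_line_subbundleD(3)[OF D, of y] by simp
    qed
  qed
  then show thesis using that[OF W(1,2)] W(3) by force
qed

lemma adapted_form_eq:
  assumes HV: "(H, V) \<in> \<D>" and h: "h \<in> H z" "h \<noteq> 0"
  shows "pt.skew_over z (pt.adapted_form z h)" "pt.adapted z (H z) (V z) (pt.adapted_form z h)"
proof -
  note d = orthogonal_decompositionsD[OF HV]
  note H = complex_line_subbundleD[OF d(1), of z] and V = complex_line_subbundleD[OF d(3), of z]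
  have hT: "h \<in> TM z" using h H(2) by blast
  show sk: "pt.skew_over z (pt.adapted_form z h)" by (rule pt.adapted_form_skew[OF hT])
  obtain q where u: "pt.unitary z ((1 / sqrt (g z h h)) *\<^sub>R h) q"
    and eq: "H z = span {(1 / sqrt (g z h h)) *\<^sub>R h, J z ((1 / sqrt (g z h h)) *\<^sub>R h)}" "V z = span {q, J z q}"
    by (rule pt.decomposition_unitary[OF H(1,2,4,3) V(1,2,4,3) d(7) h])
  show "pt.adapted z (H z) (V z) (pt.adapted_form z h)"
    unfolding eq using pt.adapted_form_split[OF u hT h(2)] pt.adapted_split_form[OF u sk] by blast
qed

text \<open>Equality as functions also concerns arguments outside the tangent spaces, where both
  forms are 0 by the last clause of \<open>two_form\<close>.\<close>

lemma adapted_two_form_unique: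
  assumes HV: "(H, V) \<in> \<D>"
    and "two_form A \<zeta>" "\<And>z. pt.adapted z (H z) (V z) (\<zeta> z)"
    and "two_form A \<eta>" "\<And>z. pt.adapted z (H z) (V z) (\<eta> z)"
  shows "\<zeta> = \<eta>"
proof (intro ext)
  fix z v w
  note d = orthogonal_decompositionsD[OF HV]
  show "\<zeta> z v w = \<eta> z v w"
  proof (cases "v \<in> TM z \<and> w \<in> TM z")
    case True
    show ?thesis
      by (rule pt.adapted_unique[OF d(5) complex_line_subbundleD(2)[OF d(1)] complex_line_subbundleD(2)[OF d(3)]
          two_formD(2)[OF assms(2)] assms(3) two_formD(2)[OF assms(4)] assms(5)
          conjunct1[OF True] conjunct2[OF True]])
  next
    case False
    show ?thesis using two_formD(3)[OF assms(2) False] two_formD(3)[OF assms(4) False] by simp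
  qed
qed

text \<open>The form is defined by an arbitrary choice of h at each point. For smoothness, a smooth
  nonvanishing section X of H is used near a given point; by uniqueness of adapted forms it yields
  the same form.\<close>

lemma adapted_two_form_exists:
  assumes HV: "(H, V) \<in> \<D>"
  obtains \<zeta> where "two_form A \<zeta>" "\<And>z. pt.adapted z (H z) (V z) (\<zeta> z)"
proof -
  note d = orthogonal_decompositionsD[OF HV]
  define h where "h z = (SOME h. h \<in> H z \<and> h \<noteq> 0)" for z
  have h: "h z \<in> H z" "h z \<noteq> 0" for z
  proof -
    have "\<exists>h. h \<in> H z \<and> h \<noteq> 0" by (rule subbundle_frame_nonzero[OF d(1), of z]) blast
    from someI_ex[OF this] show "h z \<in> H z" "h z \<noteq> 0" unfolding h_def by auto
  qed
  define \<zeta> where "\<zeta> z v w = (if v \<in> TM z \<and> w \<in> TM z then pt.adapted_form z (h z) v w else 0)"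
    for z v w
  note H = complex_line_subbundleD[OF d(1)] and V = complex_line_subbundleD[OF d(3)]
  have ad: "pt.adapted z (H z) (V z) (\<zeta> z)" for z
  proof -
    have "\<And>v. v \<in> H z \<Longrightarrow> v \<in> TM z" "\<And>v. v \<in> V z \<Longrightarrow> v \<in> TM z"
      using H(2) V(2) by blast+
    then show ?thesis
      using adapted_form_eq(2)[OF HV h[of z]] unfolding pt.adapted_def by (simp add: \<zeta>_def)
  qed
  have sk: "pt.skew_over z (\<zeta> z)" for z
  proof -
    have bl: "bilinear_over (TM z) (pt.adapted_form z (h z))"
      and sk': "\<And>v w. v \<in> TM z \<Longrightarrow> w \<in> TM z \<Longrightarrow>
        pt.adapted_form z (h z) v w = - pt.adapted_form z (h z) w v"
      using adapted_form_eq(1)[OF HV h[of z]] unfolding pt.skew_over_def by blast+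
    show ?thesis
      unfolding pt.skew_over_def
    proof (intro conjI ballI)
      show "bilinear_over (TM z) (\<zeta> z)"
        unfolding bilinear_over_def by (simp add: \<zeta>_def pt.T_closed bilinear_overD[OF bl])
      show "\<zeta> z v w = - \<zeta> z w v" if "v \<in> TM z" "w \<in> TM z" for v w
        using sk'[OF that] that by (simp add: \<zeta>_def)
    qed
  qed
  have "two_form A \<zeta>"
  proof (rule two_formI[OF sk])
    show "\<zeta> z v w = 0" if "\<not> (v \<in> TM z \<and> w \<in> TM z)" for z v w
      using that by (auto simp: \<zeta>_def)
    fix c i j assume c: "c \<in> A"
    show "smooth_on (cimg c) (component A \<zeta> c i j)"
    proof (rule smooth_on_local)
      fix x0 assume x0: "x0 \<in> cimg c"
      obtain W X where W: "open W" "cinv c x0 \<in> W" "smooth_vector_field_on A W X"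
        and X: "\<And>y. y \<in> W \<Longrightarrow> X y \<in> H y \<and> X y \<noteq> 0"
        by (rule subbundle_frame_nonzero[OF d(1), of "cinv c x0"]) blast
      let ?S = "cmap c ` (cdom c \<inter> W)"
      define \<xi> where "\<xi> x = X (cinv c x) c" for x
      let ?g = "\<lambda>i j x. component A g c (i x) (j x) x" and ?w = "\<lambda>i j x. component A \<omega> c (i x) (j x) x"
      have S: "open ?S" "?S \<subseteq> cimg c" using open_cmap_image[OF c W(1)] by auto
      have \<xi>: "smooth_on ?S \<xi>" using W(3) c unfolding smooth_vector_field_on_def \<xi>_def by blast
      have X\<xi>: "coord c (\<xi> x) x = X (cinv c x)" "X (cinv c x) \<in> TM (cinv c x)"
        "X (cinv c x) \<noteq> 0" "X (cinv c x) \<in> H (cinv c x)" if x: "x \<in> ?S" for x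
      proof -
        have y: "cinv c x \<in> W" "cinv c x \<in> cdom c" "cmap c (cinv c x) = x"
          using x cinv_cmap[OF c] by auto
        show "X (cinv c x) \<in> H (cinv c x)" "X (cinv c x) \<noteq> 0" using X[OF y(1)] by auto
        then show T: "X (cinv c x) \<in> TM (cinv c x)" using H(2) by blast
        show "coord c (\<xi> x) x = X (cinv c x)"
          using coord_field_of[OF c y(2) T] y(3) by (simp add: \<xi>_def)
      qed
      \<comment> \<open>The formula of \<open>adapted_form\<close> with h = X, in components of g
        and \<omega>.\<close>
      have "smooth_on ?S (\<lambda>x. (?w (\<lambda>x. i) (\<lambda>x. j) x - 2 * ((?g \<xi> (\<lambda>x. i) x * ?w \<xi> (\<lambda>x. j) x
          - ?g \<xi> (\<lambda>x. j) x * ?w \<xi> (\<lambda>x. i) x) / ?g \<xi> \<xi> x)) / sqrt 2)"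
      proof (intro smooth_on_divide smooth_on_diff smooth_on_mult smooth_on_const S
          component_smooth[OF metric_smooth c S] component_smooth[OF two_formD(1)[OF kahler_two_form] c S] \<xi>)
        fix x assume x: "x \<in> ?S"
        have "g (cinv c x) (X (cinv c x)) (X (cinv c x)) > 0" using pt.g_pos X\<xi>[OF x] by blast
        then show "?g \<xi> \<xi> x \<noteq> 0" by (simp add: component_def X\<xi>(1)[OF x])
      qed simp
      then have "smooth_on ?S (component A \<zeta> c i j)"
      proof (rule smooth_on_cong[OF S(1), rotated])
        fix x assume x: "x \<in> ?S"
        let ?z = "cinv c x"
        have T: "coord c i x \<in> TM ?z" for i using coord_field_in'[OF c] x S(2) by blast
        have "\<zeta> ?z (coord c i x) (coord c j x) =
          pt.adapted_form ?z (X ?z) (coord c i x) (coord c j x)"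
          by (rule pt.adapted_unique[OF d(5) H(2) V(2) sk ad adapted_form_eq[OF HV X\<xi>(4,3)[OF x]] T T])
        then show "(?w (\<lambda>x. i) (\<lambda>x. j) x - 2 * ((?g \<xi> (\<lambda>x. i) x * ?w \<xi> (\<lambda>x. j) x
          - ?g \<xi> (\<lambda>x. j) x * ?w \<xi> (\<lambda>x. i) x) / ?g \<xi> \<xi> x)) / sqrt 2 = component A \<zeta> c i j x"
          by (simp add: component_def X\<xi>(1)[OF x] kahler_eq T X\<xi>(2)[OF x] pt.adapted_form_def)
      qed
      then show "\<exists>T. open T \<and> x0 \<in> T \<and> smooth_on T (component A \<zeta> c i j)"
        using S(1) W(2) x0 cinv_in[OF c x0] cmap_cinv[OF c x0] by (intro exI[of _ ?S]) (metis IntI image_eqI)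
    qed
  qed
  then show thesis using that ad by blast
qed

text \<open>An integral patch through the point, read in the chart, satisfies the hypotheses of
  \<open>ext_tangent_to_patch\<close> for \<omega> + \<surd>2 \<zeta>; closedness of \<omega>
  transfers the result to \<zeta>.\<close>

lemma ext_deriv_kernel:
  assumes D: "complex_line_subbundle A J D" "integrable_distribution A D" and \<zeta>: "two_form A \<zeta>"
    and ker: "\<And>z. D z = kernel_dist \<zeta> z" and c: "c \<in> A" "x \<in> cimg c"
    and ab: "coord c a x \<in> D (cinv c x)" "coord c b x \<in> D (cinv c x)"
  shows "ext_deriv A \<zeta> c a b w x = 0"
proof -
  let ?\<beta> = "component A (plus_kahler \<zeta>) c" and ?z = "cinv c x"
  have z: "?z \<in> cdom c" "cmap c ?z = x" using c by (auto intro: cinv_in cmap_cinv)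
  interpret smooth_form_on "cimg c" ?\<beta>
    by (rule two_form_chart[OF plus_kahler_two_form(1)[OF \<zeta>] c(1)])
  obtain U \<phi> u where p: "integral_patch A D U \<phi>" and u: "u \<in> U" "?z = \<phi> u"
    using D(2) unfolding integrable_distribution_def by blast
  have U: "open U" "continuous_on U \<phi>" "\<And>t. t \<in> U \<Longrightarrow> range (differential A \<phi> t) = D (\<phi> t)"
    using p unfolding integral_patch_def smooth_map_into_def by blast+
  let ?U = "U \<inter> \<phi> -` cdom c" and ?\<phi> = "cmap c \<circ> \<phi>"
  have oU: "open ?U" by (rule continuous_open_preimage[OF U(2,1) open_cdom[OF c(1)]])
  have sm: "smooth_on ?U ?\<phi>"
    using p c(1) unfolding integral_patch_def smooth_map_into_def by blast
  have uU: "u \<in> ?U" using u z by simp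
  have d: "fderiv ?\<phi> t a = differential A \<phi> t a c" if "t \<in> ?U" for t a
    using that c(1) by (simp add: differential_def)
  have ux: "?\<phi> u = x" using u(2) z(2) by simp
  obtain a' where a': "a = fderiv ?\<phi> u a'"
    using ab(1) U(3)[OF u(1)] d[OF uU] coord_field_self'[OF c] u(2) by (metis imageE)
  obtain b' where b': "b = fderiv ?\<phi> u b'"
    using ab(2) U(3)[OF u(1)] d[OF uU] coord_field_self'[OF c] u(2) by (metis imageE)
  obtain W X where W: "open W" "?z \<in> W" "\<forall>m<2. smooth_vector_field_on A W (X m)"
    and X: "\<forall>y\<in>W. D y = span ((\<lambda>m. X m y) ` {..<2::nat})"
    using D(1) unfolding complex_line_subbundle_def subbundle_def by blast
  have two: "{..<2::nat} = {0, 1}" by auto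
  have "coord c a x \<in> span {X 0 ?z, X 1 ?z}" using ab(1) X W(2) two by simp
  then obtain k0 k1 where k: "coord c a x = k0 *\<^sub>R X 0 ?z + k1 *\<^sub>R X 1 ?z"
    unfolding span_insert[of "X 0 ?z"] by (auto simp: span_singleton algebra_simps)
  let ?N = "cmap c ` (cdom c \<inter> W)"
  \<comment> \<open>A section of D that extends a: the coefficients of a in a local frame of D are
    held constant.\<close>
  define Y where "Y y = k0 *\<^sub>R X 0 (cinv c y) c + k1 *\<^sub>R X 1 (cinv c y) c" for y
  have N: "open ?N" "?\<phi> u \<in> ?N" "?N \<subseteq> cimg c"
    using open_cmap_image[OF c(1) W(1)] W(2) z ux by (auto intro: rev_image_eqI)
  have X': "smooth_on ?N (\<lambda>y. X m (cinv c y) c)" if "m < 2" for m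
    using W(3) c(1) that unfolding smooth_vector_field_on_def by blast
  have "smooth_on ?N Y"
    unfolding Y_def
    by (rule smooth_on_add[OF N(1) smooth_on_scaleR[OF N(1) smooth_on_const X'] smooth_on_scaleR[OF N(1) smooth_on_const X']])
      simp_all
  note Y' = smooth_on_has_derivative[OF this N(2)]
  have Yu: "Y (?\<phi> u) = fderiv ?\<phi> u a'"
  proof -
    have "a = (k0 *\<^sub>R X 0 ?z + k1 *\<^sub>R X 1 ?z) c"
      unfolding k[symmetric] by (rule coord_field_self'[OF c, symmetric])
    then show ?thesis unfolding Y_def ux a'[symmetric] by (simp add: scaleR_fun_def)
  qed
  have kerY: "?\<beta> (Y y) w y = 0" if y: "y \<in> ?N" for y w
  proof -
    obtain t where t: "t \<in> cdom c" "t \<in> W" "y = cmap c t" using y by blast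
    have "D t = span {X 0 t, X 1 t}" using X t(2) two by simp
    then have "k0 *\<^sub>R X 0 t + k1 *\<^sub>R X 1 t \<in> D t"
      by (simp only:) (intro span_add span_scale span_base; simp)
    then have "k0 *\<^sub>R X 0 t + k1 *\<^sub>R X 1 t \<in> kernel_dist \<zeta> t" by (simp only: ker)
    from kernel_distI[OF c(1) t(1) this, of w] show ?thesis
      unfolding t(3) Y_def cinv_cmap[OF c(1) t(1)] by (simp add: scaleR_fun_def)
  qed
  have "ext (fderiv ?\<phi> u a') (fderiv ?\<phi> u b') w (?\<phi> u) = 0"
  proof (rule ext_tangent_to_patch[OF oU uU _ sm _ Y' Yu N kerY])
    show "?\<phi> ` ?U \<subseteq> cimg c" by auto
    fix t a w assume t: "t \<in> ?U"
    have "differential A \<phi> t a \<in> kernel_dist \<zeta> (\<phi> t)" using U(3)[of t] t unfolding ker by blast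
    from kernel_distI[OF c(1) _ this, of w] t
    show "?\<beta> (fderiv ?\<phi> t a) w (?\<phi> t) = 0" by (simp add: d[OF t])
  qed
  then have "ext a b w x = 0" unfolding a'[symmetric] b'[symmetric] ux .
  then have "ext_deriv A (plus_kahler \<zeta>) c a b w x = 0"
    using ext_eq_ext_deriv[OF plus_kahler_two_form(1)[OF \<zeta>] c(1)] by simp
  then show ?thesis using plus_kahler_two_form(2)[OF \<zeta> c] by simp
qed

lemma adapted_split:
  assumes HV: "(H, V) \<in> \<D>"
    and \<zeta>: "two_form A \<zeta>" "\<And>z. pt.adapted z (H z) (V z) (\<zeta> z)"
  shows "\<exists>p q. pt.split_form z p q (\<zeta> z)" "H z = kernel_dist \<zeta> z" "V z = kernel_dist (\<lambda>z v w. - \<zeta> z v w) z"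
proof -
  note d = orthogonal_decompositionsD[OF HV]
  note H = complex_line_subbundleD[OF d(1), of z] and V = complex_line_subbundleD[OF d(3), of z]
  obtain h where h: "h \<in> H z" "h \<noteq> 0" by (rule subbundle_frame_nonzero[OF d(1), of z]) blast
  obtain p q where u: "pt.unitary z p q" and eq: "H z = span {p, J z p}" "V z = span {q, J z q}"
    by (rule pt.decomposition_unitary[OF H(1,2,4,3) V(1,2,4,3) d(7) h])
  have s: "pt.split_form z p q (\<zeta> z)"
    using \<zeta>(2)[of z] pt.adapted_split_form[OF u two_formD(2)[OF \<zeta>(1)]] unfolding eq by blast
  then show "\<exists>p q. pt.split_form z p q (\<zeta> z)" by blast
  show "H z = kernel_dist \<zeta> z" unfolding kernel_dist_def eq pt.kernel_split_form[OF s] ..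
  show "V z = kernel_dist (\<lambda>z v w. - \<zeta> z v w) z"
    unfolding kernel_dist_def eq pt.kernel_split_form[OF pt.split_form_swap[OF s]] ..
qed

text \<open>\<open>d \<zeta>\<close> vanishes on two vectors of \<open>\<H>\<close> and on two vectors of \<open>\<V>\<close>, hence everywhere: among
  three vectors from \<open>\<H> \<union> \<V>\<close> two lie in the same summand.\<close>

lemma adapted_closed:
  assumes HV: "(H, V) \<in> \<D>"
    and \<zeta>: "two_form A \<zeta>" "\<And>z. pt.adapted z (H z) (V z) (\<zeta> z)"
  shows "closed_form A \<zeta>"
  unfolding closed_form_iff[OF \<zeta>(1)]
proof (intro ballI allI)
  fix c x i j k assume c: "c \<in> A" "x \<in> cimg c"
  note d = orthogonal_decompositionsD[OF HV] and ker = adapted_split[OF HV \<zeta>]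
  let ?z = "cinv c x" and ?E = "\<lambda>i j k. ext_deriv A \<zeta> c i j k x"
  let ?H = "{a. coord c a x \<in> H ?z}" and ?V = "{a. coord c a x \<in> V ?z}"
  interpret smooth_form_on "cimg c" "component A \<zeta> c" by (rule two_form_chart[OF \<zeta>(1) c(1)])
  have E: "?E i j k = ext i j k x" for i j k using ext_eq_ext_deriv[OF \<zeta>(1) c(1)] by simp
  have H: "?E a b w = 0" if "a \<in> ?H" "b \<in> ?H" for a b w
    using ext_deriv_kernel[OF d(1,2) \<zeta>(1) ker(2) c] that by blast
  have V: "?E a b w = 0" if "a \<in> ?V" "b \<in> ?V" for a b w
  proof -
    have "ext_deriv A (\<lambda>z v w. - \<zeta> z v w) c a b w x = 0"
      using ext_deriv_kernel[OF d(3,4) two_form_minus(1)[OF \<zeta>(1)] ker(3) c] that by blast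
    moreover have "ext_deriv A (\<lambda>z v w. 0 + -1 * \<zeta> z v w) c a b w x = - ?E a b w"
      using two_form_combination(2)[OF zero_two_form \<zeta>(1) c, of "-1"]
      by (simp add: ext_deriv_def component_def[abs_def])
    ultimately show ?thesis by simp
  qed
  have dec: "\<exists>a\<in>?H. \<exists>b\<in>?V. v = a + b" for v
  proof -
    have "coord c v x \<in> TM ?z" by (rule coord_field_in'[OF c])
    then obtain s t where st: "coord c v x = s + t" "s \<in> H ?z" "t \<in> V ?z"
      unfolding d(5)[of ?z, symmetric] by blast
    have z: "?z \<in> cdom c" "cmap c ?z = x" using c by (auto intro: cinv_in cmap_cinv)
    have "s \<in> TM ?z" "t \<in> TM ?z"
      using st complex_line_subbundleD(2)[OF d(1)] complex_line_subbundleD(2)[OF d(3)] by blast+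
    then have "coord c (s c) x = s" "coord c (t c) x = t"
      using coord_field_of[OF c(1) z(1)] z(2) by auto
    moreover have "v = s c + t c" using st(1) coord_field_self'[OF c, of v] by (metis plus_fun_apply)
    ultimately show ?thesis using st by (intro bexI[of _ "s c"] bexI[of _ "t c"]) simp_all
  qed
  obtain i1 i2 j1 j2 k1 k2 where ijk: "i = i1 + i2" "j = j1 + j2" "k = k1 + k2"
    "i1 \<in> ?H" "i2 \<in> ?V" "j1 \<in> ?H" "j2 \<in> ?V" "k1 \<in> ?H" "k2 \<in> ?V"
    using dec[of i] dec[of j] dec[of k] by metis
  have cyc: "?E a b w = ?E b w a" for a b w unfolding E by (rule ext_cyclic)
  \<comment> \<open>The argument k is split only where i and j contribute from different summands.
    In each of the six terms a cyclic rotation, if necessary, brings two vectors of the same summand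
    to the front.\<close>
  have "?E i j k = ?E i1 j1 k + (?E i1 j2 k1 + ?E i1 j2 k2) + ((?E i2 j1 k1 + ?E i2 j1 k2) + ?E i2 j2 k)"
    unfolding E ijk(1,2,3)
    by (simp add: linear_add[OF ext_linear(1)[OF c(2)]] linear_add[OF ext_linear(2)[OF c(2)]] linear_add[OF ext_linear(3)[OF c(2)]])
  moreover have "?E i1 j1 k = 0" "?E i2 j2 k = 0" using H V ijk by blast+
  moreover have "?E i1 j2 k1 = 0" using cyc[of k1 i1 j2] H[of k1 i1 j2] ijk by simp
  moreover have "?E i1 j2 k2 = 0" using cyc[of i1 j2 k2] V[of j2 k2 i1] ijk by simp
  moreover have "?E i2 j1 k1 = 0" using cyc[of i2 j1 k1] H[of j1 k1 i2] ijk by simp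
  moreover have "?E i2 j1 k2 = 0" using cyc[of k2 i2 j1] V[of k2 i2 j1] ijk by simp
  ultimately show "?E i j k = 0" by simp
qed

section \<open>The correspondence and its inverse\<close>

lemma kernel_decomposition:
  assumes \<zeta>: "\<zeta> \<in> unit_closed_asd_forms A g J"
  defines "H \<equiv> kernel_dist \<zeta>" and "V \<equiv> kernel_dist (\<lambda>z v w. - \<zeta> z v w)"
  shows "(H, V) \<in> \<D>" "pt.adapted z (H z) (V z) (\<zeta> z)"
proof -
  have tf: "two_form A \<zeta>" and cl: "closed_form A \<zeta>" and s: "\<And>z. \<exists>p q. pt.split_form z p q (\<zeta> z)"
    using \<zeta> unit_asd_iff[of \<zeta>] unfolding unit_closed_asd_forms_def by blast+
  note mf = two_form_minus[OF tf]
  have ms: "\<exists>p q. pt.split_form z p q (\<lambda>v w. - \<zeta> z v w)" for z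
    using s[of z] pt.split_form_swap by blast
  have HV: "\<exists>p q. pt.unitary z p q \<and> H z = span {p, J z p} \<and> V z = span {q, J z q} \<and> pt.split_form z p q (\<zeta> z)" for z
  proof -
    obtain p q where pq: "pt.split_form z p q (\<zeta> z)" using s by blast
    then show ?thesis
      using pt.split_form_unitary[OF pq] pt.kernel_split_form[OF pq] pt.kernel_split_form[OF pt.split_form_swap[OF pq]]
      unfolding H_def V_def kernel_dist_def by blast
  qed
  have "{v + w | v w. v \<in> H z \<and> w \<in> V z} = TM z \<and> H z \<inter> V z = {0} \<and>
      (\<forall>v\<in>H z. \<forall>w\<in>V z. g z v w = 0)" for z
  proof -
    obtain p q where u: "pt.unitary z p q" and eq: "H z = span {p, J z p}" "V z = span {q, J z q}"
      using HV by blast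
    note D = pt.unitaryD[OF u]
    have Hi: "H z = {v \<in> TM z. g z v q = 0 \<and> g z v (J z q) = 0}"
      and Vi: "V z = {v \<in> TM z. g z v p = 0 \<and> g z v (J z p) = 0}"
      unfolding eq by (rule pt.unitary_span_pair[OF u]) (rule pt.unitary_span_pair[OF pt.unitary_swap[OF u]])
    have orth: "g z v w = 0" if "v \<in> H z" "w \<in> V z" for v w
      using pt.inner_coordinates[OF u, of v w] that unfolding Hi Vi by simp
    have "{v + w | v w. v \<in> H z \<and> w \<in> V z} = TM z"
    proof
      show "{v + w | v w. v \<in> H z \<and> w \<in> V z} \<subseteq> TM z"
        unfolding Hi Vi by (auto intro: pt.T_closed)
      show "TM z \<subseteq> {v + w | v w. v \<in> H z \<and> w \<in> V z}"
      proof
        fix v assume v: "v \<in> TM z"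
        have "v = (g z v p *\<^sub>R p + g z v (J z p) *\<^sub>R J z p) + (g z v q *\<^sub>R q + g z v (J z q) *\<^sub>R J z q)"
          using pt.unitary_expansion[OF u v] by (simp add: add.assoc)
        moreover have "g z v p *\<^sub>R p + g z v (J z p) *\<^sub>R J z p \<in> H z" "g z v q *\<^sub>R q + g z v (J z q) *\<^sub>R J z q \<in> V z"
          unfolding eq by (intro span_add span_scale span_base; simp)+
        ultimately show "v \<in> {v + w | v w. v \<in> H z \<and> w \<in> V z}" by blast
      qed
    qed
    moreover have "H z \<inter> V z = {0}"
    proof
      show "H z \<inter> V z \<subseteq> {0}"
      proof
        fix v assume v: "v \<in> H z \<inter> V z"
        then have "g z v v = 0" using orth by blast
        then show "v \<in> {0}" using pt.g_definite[of v z] v unfolding Hi by simp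
      qed
      show "{0} \<subseteq> H z \<inter> V z" unfolding eq by (simp add: span_zero)
    qed
    ultimately show ?thesis using orth by (intro conjI ballI)
  qed
  note split = this[THEN conjunct1] this[THEN conjunct2, THEN conjunct1] this[THEN conjunct2, THEN conjunct2]
  show "(H, V) \<in> \<D>"
    unfolding orthogonal_decompositions_def mem_Collect_eq prod.case
    by (intro conjI allI split
        kernel_dist_integrable_subbundle[OF tf cl s, folded H_def]
        kernel_dist_integrable_subbundle[OF mf(1) mf(2)[OF cl] ms, folded V_def])
  show "pt.adapted z (H z) (V z) (\<zeta> z)"
  proof -
    obtain p q where u: "pt.unitary z p q" and eq: "H z = span {p, J z p}" "V z = span {q, J z q}"
      and sf: "pt.split_form z p q (\<zeta> z)"
      using HV by blast
    show ?thesis unfolding eq using pt.adapted_split_form[OF u two_formD(2)[OF tf]] sf by blast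
  qed
qed

lemma corresponding_form_exists_unique:
  assumes "(H, V) \<in> \<D>"
  shows "\<exists>!\<zeta>. corresponding_form A g J H V \<zeta>"
  unfolding corresponding_form_iff[OF assms]
  using adapted_two_form_exists[OF assms] adapted_two_form_unique[OF assms] by metis

lemma corresponding_form_bij:
  "bij_betw (\<lambda>(H, V). THE \<zeta>. corresponding_form A g J H V \<zeta>)
    (\<D>) (unit_closed_asd_forms A g J)"
proof -
  let ?F = "\<lambda>(H, V). THE \<zeta>. corresponding_form A g J H V \<zeta>"
  have F: "two_form A (?F (H, V))" "\<And>z. pt.adapted z (H z) (V z) (?F (H, V) z)"
    if "(H, V) \<in> \<D>" for H V
    using corresponding_form_iff[OF that, THEN iffD1, OF theI'[OF corresponding_form_exists_unique[OF that]]]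
    by (simp_all only: prod.case)
  have inv: "(kernel_dist (?F HV), kernel_dist (\<lambda>z v w. - ?F HV z v w)) = HV"
    if "HV \<in> \<D>" for HV
  proof -
    obtain H V where HV: "HV = (H, V)" by (cases HV)
    show ?thesis
      using adapted_split(2,3)[OF that[unfolded HV] F[OF that[unfolded HV]]] unfolding HV by (auto simp: fun_eq_iff)
  qed
  show ?thesis
  \<comment> \<open>The inverse takes a form to its two kernels. It is an inverse on decompositions
    by \<open>adapted_split\<close>, and on forms by uniqueness of the adapted form.\<close>
  proof (rule bij_betw_byWitness[where f' = "\<lambda>\<zeta>. (kernel_dist \<zeta>, kernel_dist (\<lambda>z v w. - \<zeta> z v w))"])
    show "\<forall>HV\<in>\<D>. (kernel_dist (?F HV), kernel_dist (\<lambda>z v w. - ?F HV z v w)) = HV"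
      using inv by blast
    show "\<forall>\<zeta>\<in>unit_closed_asd_forms A g J. ?F (kernel_dist \<zeta>, kernel_dist (\<lambda>z v w. - \<zeta> z v w)) = \<zeta>"
    proof
      fix \<zeta> assume \<zeta>: "\<zeta> \<in> unit_closed_asd_forms A g J"
      note k = kernel_decomposition[OF \<zeta>]
      have "two_form A \<zeta>" using \<zeta> unfolding unit_closed_asd_forms_def by blast
      from adapted_two_form_unique[OF k(1) F[OF k(1)] this k(2)]
      show "?F (kernel_dist \<zeta>, kernel_dist (\<lambda>z v w. - \<zeta> z v w)) = \<zeta>" .
    qed
    show "?F ` \<D> \<subseteq> unit_closed_asd_forms A g J"
    proof
      fix \<zeta> assume "\<zeta> \<in> ?F ` \<D>"
      then obtain HV where "HV \<in> \<D>" "\<zeta> = ?F HV" by blast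
      moreover obtain H V where "HV = (H, V)" by (cases HV)
      ultimately have HV: "(H, V) \<in> \<D>" and \<zeta>: "\<zeta> = ?F (H, V)"
        by (simp_all only:)
      note F' = F[OF HV, folded \<zeta>]
      have "\<forall>z. \<exists>p q. pt.split_form z p q (\<zeta> z)" using adapted_split(1)[OF HV F'] by (rule allI)
      from unit_asd_iff[OF F'(1), THEN iffD2, OF this]
      show "\<zeta> \<in> unit_closed_asd_forms A g J"
        unfolding unit_closed_asd_forms_def mem_Collect_eq using F'(1) adapted_closed[OF HV F'] by (intro conjI) simp_all
    qed
    show "(\<lambda>\<zeta>. (kernel_dist \<zeta>, kernel_dist (\<lambda>z v w. - \<zeta> z v w))) ` unit_closed_asd_forms A g J
        \<subseteq> \<D>"
      using kernel_decomposition(1) by blast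
  qed
qed

end

theorem propositionA:
  fixes A :: "('a::{t2_space, second_countable_topology}, real^4) chart set"
    and g :: "'a \<Rightarrow> ('a, real^4) bilin"
    and J :: "'a \<Rightarrow> ('a, real^4) tvec \<Rightarrow> ('a, real^4) tvec"
  assumes "almost_kahler_surface A g J"
  shows "(\<forall>(H, V)\<in>orthogonal_decompositions A g J. \<exists>!\<zeta>. corresponding_form A g J H V \<zeta>) \<and>
    bij_betw (\<lambda>(H, V). THE \<zeta>. corresponding_form A g J H V \<zeta>)
      (orthogonal_decompositions A g J) (unit_closed_asd_forms A g J)"
proof -
  interpret almost_kahler A g J by unfold_locales (rule assms)
  show ?thesis using corresponding_form_exists_unique corresponding_form_bij by blast
qed

end
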